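(* Let $f_*\mathcal Com$ be the modular envelope of the cyclic operad $\mathcal Com$ and let $D$ be the Feynman transform of modular operads. For all $n\ge3$, the Euler characteristic of the complex $(Df_*\mathcal Com)(1,n)$ is $$\chi\big((Df_*\mathcal Com)(1,n)\big)=(-1)^n\,\frac{(n-1)!}{2}.$$
   Context: All objects are over a field $k$ of characteristic $0$. A cyclic operad $\mathcal O=\{\mathcal O((n))\}_{n\ge3}$ (non-unital) has $S_n$-modules and compositions along trees; a modular operad $\mathcal M=\{\mathcal M(g,n)\}$ ($2g-2+n>0$, in the sense of Getzler–Kapranov) has $S_n$-modules and compositions along connected graphs with genus-labeled vertices, the total genus of a graph being its first Betti number plus the sum of the vertex labels. The modular envelope $f_*$ is the left adjoint of the functor restricting a modular operad to its genus $0$ part. $\mathcal Com$ is the cyclic commutative operad, $\mathcal Com((n))=k$ (trivial representation) for $n\ge3$. The Feynman transform $D(\mathcal M)$ is the free $\mathfrak K$-twisted modular operad on the linear dual $\mathcal M^*$ (i.e. $D(\mathcal M)(g,n)$ is spanned by isomorphism classes of connected graphs of total genus $g$ with $n$ labeled legs, all vertices stable, with an orientation in $\det(k^{Edges})$ and each vertex of genus $h$ and valence $m$ labeled by an element of $\mathcal M(h,m)^*$), with differential given by the sum over one-edge graphs of the duals of the compositions of $\mathcal M$. A graph with $e$ edges and degree $0$ labels has degree of the same parity as $e$, so it contributes with sign $(-1)^e$ to $\chi$. *)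

theory Defs
  imports
    Complex_Main
    "HOL-Library.FuncSet"
    "HOL-Library.Function_Algebras"
    "HOL-Combinatorics.Permutations"
begin

section \<open>Vector spaces\<close>

text \<open>
  All vector spaces over the field \<open>'k\<close> are realised as subspaces of a space \<open>'b \<Rightarrow> 'k\<close> of
  functions with pointwise operations. Up to isomorphism this is no restriction: choosing bases, any
  family of vector spaces over \<open>'k\<close> embeds into \<open>'b \<Rightarrow> 'k\<close> for a suitable type \<open>'b\<close>.
\<close>

definition fscale :: "'k::field \<Rightarrow> ('b \<Rightarrow> 'k) \<Rightarrow> ('b \<Rightarrow> 'k)" where
  "fscale c f = (\<lambda>b. c * f b)"

global_interpretation fun_vs: vector_space fscale
  by unfold_locales (auto simp: fscale_def fun_eq_iff algebra_simps)

definition linear_from :: "('b \<Rightarrow> 'k::field) set \<Rightarrow> (('b \<Rightarrow> 'k) \<Rightarrow> ('c \<Rightarrow> 'k)) \<Rightarrow> bool" where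
  "linear_from V f \<longleftrightarrow>
     (\<forall>a\<in>V. \<forall>b\<in>V. f (a + b) = f a + f b) \<and> (\<forall>c. \<forall>a\<in>V. f (fscale c a) = fscale c (f a))"

text \<open>Only the values of a functional on \<open>V\<close> are relevant.\<close>

definition functionals :: "('b \<Rightarrow> 'k::field) set \<Rightarrow> (('b \<Rightarrow> 'k) \<Rightarrow> 'k) set" where
  "functionals V =
     {\<alpha>. (\<forall>a\<in>V. \<forall>b\<in>V. \<alpha> (a + b) = \<alpha> a + \<alpha> b) \<and> (\<forall>c. \<forall>a\<in>V. \<alpha> (fscale c a) = c * \<alpha> a)}"


section \<open>Stable graphs\<close>

text \<open>
  Half-edges (flags) are natural numbers. A vertex is the pair of its genus and the set of flags
  attached to it, an edge is the set of its two flags, and the flags that lie on no edge are the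
  legs; a leg is labelled by its own name. An operad is correspondingly indexed by pairs
  \<open>(g, I)\<close> with \<open>I\<close> a finite set of naturals, i.e. as a functor on finite sets and bijections;
  its component of arity \<open>n\<close> with the action of \<open>S\<^sub>n\<close> is the value at \<open>(g, {1..n})\<close>.
\<close>

type_synonym vertex = "nat \<times> nat set"

record graph =
  verts :: "vertex set"
  edges :: "nat set set"

definition stable_vertex :: "vertex \<Rightarrow> bool" where
  "stable_vertex v \<longleftrightarrow> finite (snd v) \<and> 2 * fst v + card (snd v) > 2"

definition flags :: "graph \<Rightarrow> nat set" where
  "flags \<Gamma> = \<Union> (snd ` verts \<Gamma>)"

definition legs :: "graph \<Rightarrow> nat set" where
  "legs \<Gamma> = flags \<Gamma> - \<Union> (edges \<Gamma>)"

definition joined :: "graph \<Rightarrow> nat set set \<Rightarrow> (vertex \<times> vertex) set" where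
  "joined \<Gamma> F = {(v, w). v \<in> verts \<Gamma> \<and> w \<in> verts \<Gamma> \<and>
                         (\<exists>e\<in>F. e \<inter> snd v \<noteq> {} \<and> e \<inter> snd w \<noteq> {})}"

definition stable_graph :: "graph \<Rightarrow> bool" where
  "stable_graph \<Gamma> \<longleftrightarrow>
     finite (verts \<Gamma>) \<and> verts \<Gamma> \<noteq> {} \<and>
     (\<forall>v\<in>verts \<Gamma>. stable_vertex v) \<and>
     (\<forall>v\<in>verts \<Gamma>. \<forall>w\<in>verts \<Gamma>. v \<noteq> w \<longrightarrow> snd v \<inter> snd w = {}) \<and>
     (\<forall>e\<in>edges \<Gamma>. card e = 2 \<and> e \<subseteq> flags \<Gamma>) \<and>
     (\<forall>e\<in>edges \<Gamma>. \<forall>e'\<in>edges \<Gamma>. e \<noteq> e' \<longrightarrow> e \<inter> e' = {}) \<and>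
     (\<forall>v\<in>verts \<Gamma>. \<forall>w\<in>verts \<Gamma>. (v, w) \<in> (joined \<Gamma> (edges \<Gamma>))\<^sup>*)"

text \<open>
  First Betti number plus the sum of the vertex genera. For a connected graph
  \<open>card (edges \<Gamma>) + 1 \<ge> card (verts \<Gamma>)\<close>, so the subtraction does not truncate.
\<close>

definition total_genus :: "graph \<Rightarrow> nat" where
  "total_genus \<Gamma> = (card (edges \<Gamma>) + 1 - card (verts \<Gamma>)) + (\<Sum>v\<in>verts \<Gamma>. fst v)"

text \<open>The vertex obtained by contracting all edges of a graph.\<close>

definition total_vertex :: "graph \<Rightarrow> vertex" where
  "total_vertex \<Gamma> = (total_genus \<Gamma>, legs \<Gamma>)"

definition corolla :: "vertex \<Rightarrow> graph" where
  "corolla v = \<lparr>verts = {v}, edges = {}\<rparr>"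

definition relabel_vertex :: "(nat \<Rightarrow> nat) \<Rightarrow> vertex \<Rightarrow> vertex" where
  "relabel_vertex f v = (fst v, f ` snd v)"

definition relabel_graph :: "(nat \<Rightarrow> nat) \<Rightarrow> graph \<Rightarrow> graph" where
  "relabel_graph f \<Gamma> = \<lparr>verts = relabel_vertex f ` verts \<Gamma>, edges = (\<lambda>e. f ` e) ` edges \<Gamma>\<rparr>"

text \<open>
  Contraction of a set \<open>F\<close> of edges: each connected component \<open>W\<close> of the graph with edge set \<open>F\<close>
  is a graph \<open>subgraph \<Gamma> F W\<close> of its own and becomes one vertex of \<open>contract \<Gamma> F\<close>.
\<close>

definition components :: "graph \<Rightarrow> nat set set \<Rightarrow> vertex set set" where
  "components \<Gamma> F = verts \<Gamma> // (joined \<Gamma> F)\<^sup>*"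

definition subgraph :: "graph \<Rightarrow> nat set set \<Rightarrow> vertex set \<Rightarrow> graph" where
  "subgraph \<Gamma> F W = \<lparr>verts = W, edges = {e \<in> F. e \<subseteq> \<Union> (snd ` W)}\<rparr>"

definition contract :: "graph \<Rightarrow> nat set set \<Rightarrow> graph" where
  "contract \<Gamma> F =
     \<lparr>verts = (\<lambda>W. total_vertex (subgraph \<Gamma> F W)) ` components \<Gamma> F, edges = edges \<Gamma> - F\<rparr>"

definition component_over :: "graph \<Rightarrow> nat set set \<Rightarrow> vertex \<Rightarrow> vertex set" where
  "component_over \<Gamma> F w = (THE W. W \<in> components \<Gamma> F \<and> total_vertex (subgraph \<Gamma> F W) = w)"


section \<open>Cyclic and modular operads\<close>

text \<open>
  \<open>op_act P v f\<close> is the isomorphism \<open>P (g, I) \<rightarrow> P (g, f ` I)\<close> induced by a map \<open>f\<close> injective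
  on \<open>I\<close>, where \<open>v = (g, I)\<close>; \<open>op_comp P \<Gamma>\<close> is the composition along \<open>\<Gamma>\<close>, a map from the tensor
  product of the \<open>P v\<close>, \<open>v\<close> a vertex of \<open>\<Gamma>\<close>, to \<open>P (total_vertex \<Gamma>)\<close>, given as a multilinear map
  on decorations of \<open>\<Gamma>\<close>.
\<close>

record ('k, 'b) operad_data =
  op_space :: "vertex \<Rightarrow> ('b \<Rightarrow> 'k) set"
  op_act :: "vertex \<Rightarrow> (nat \<Rightarrow> nat) \<Rightarrow> ('b \<Rightarrow> 'k) \<Rightarrow> ('b \<Rightarrow> 'k)"
  op_comp :: "graph \<Rightarrow> (vertex \<Rightarrow> 'b \<Rightarrow> 'k) \<Rightarrow> ('b \<Rightarrow> 'k)"

definition decorations :: "('k, 'b) operad_data \<Rightarrow> graph \<Rightarrow> (vertex \<Rightarrow> 'b \<Rightarrow> 'k) set" where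
  "decorations P \<Gamma> = (\<Pi>\<^sub>E v\<in>verts \<Gamma>. op_space P v)"

definition relabel_decoration ::
    "('k, 'b) operad_data \<Rightarrow> (nat \<Rightarrow> nat) \<Rightarrow> graph \<Rightarrow> (vertex \<Rightarrow> 'b \<Rightarrow> 'k) \<Rightarrow> (vertex \<Rightarrow> 'b \<Rightarrow> 'k)" where
  "relabel_decoration P f \<Gamma> x =
     (\<lambda>w\<in>verts (relabel_graph f \<Gamma>).
        let v = inv_into (verts \<Gamma>) (relabel_vertex f) w in op_act P v f (x v))"

definition contract_decoration ::
    "('k, 'b) operad_data \<Rightarrow> graph \<Rightarrow> nat set set \<Rightarrow> (vertex \<Rightarrow> 'b \<Rightarrow> 'k) \<Rightarrow> (vertex \<Rightarrow> 'b \<Rightarrow> 'k)" where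
  "contract_decoration P \<Gamma> F x =
     (\<lambda>w\<in>verts (contract \<Gamma> F).
        let W = component_over \<Gamma> F w in op_comp P (subgraph \<Gamma> F W) (restrict x W))"

text \<open>
  Cyclic and modular operads differ only in the graphs they are defined on: those of total genus
  \<open>0\<close>, i.e. the trees with all vertices of genus \<open>0\<close>, respectively all of them. The set \<open>A\<close> consists
  of the total genera allowed; at vertices and graphs of other genera the data are irrelevant.
\<close>

locale graph_operad =
  fixes A :: "nat set" and P :: "('k::field, 'b) operad_data"
  assumes subspace_space:
      "\<lbrakk>stable_vertex v; fst v \<in> A\<rbrakk> \<Longrightarrow> fun_vs.subspace (op_space P v)"
    and act_space:
      "\<lbrakk>stable_vertex v; fst v \<in> A; inj_on f (snd v); a \<in> op_space P v\<rbrakk>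
        \<Longrightarrow> op_act P v f a \<in> op_space P (relabel_vertex f v)"
    and act_linear:
      "\<lbrakk>stable_vertex v; fst v \<in> A; inj_on f (snd v)\<rbrakk>
        \<Longrightarrow> linear_from (op_space P v) (op_act P v f)"
    and act_cong:
      "\<lbrakk>stable_vertex v; fst v \<in> A; inj_on f (snd v); \<forall>i\<in>snd v. f i = f' i; a \<in> op_space P v\<rbrakk>
        \<Longrightarrow> op_act P v f a = op_act P v f' a"
    and act_id:
      "\<lbrakk>stable_vertex v; fst v \<in> A; a \<in> op_space P v\<rbrakk> \<Longrightarrow> op_act P v id a = a"
    and act_compose:
      "\<lbrakk>stable_vertex v; fst v \<in> A; inj_on f (snd v); inj_on f' (f ` snd v); a \<in> op_space P v\<rbrakk>
        \<Longrightarrow> op_act P (relabel_vertex f v) f' (op_act P v f a) = op_act P v (f' \<circ> f) a"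
    and comp_space:
      "\<lbrakk>stable_graph \<Gamma>; total_genus \<Gamma> \<in> A; x \<in> decorations P \<Gamma>\<rbrakk>
        \<Longrightarrow> op_comp P \<Gamma> x \<in> op_space P (total_vertex \<Gamma>)"
    and comp_multilinear:
      "\<lbrakk>stable_graph \<Gamma>; total_genus \<Gamma> \<in> A; x \<in> decorations P \<Gamma>; v \<in> verts \<Gamma>\<rbrakk>
        \<Longrightarrow> linear_from (op_space P v) (\<lambda>a. op_comp P \<Gamma> (x(v := a)))"
    and comp_relabel:
      "\<lbrakk>stable_graph \<Gamma>; total_genus \<Gamma> \<in> A; x \<in> decorations P \<Gamma>; inj_on f (flags \<Gamma>)\<rbrakk>
        \<Longrightarrow> op_comp P (relabel_graph f \<Gamma>) (relabel_decoration P f \<Gamma> x)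
              = op_act P (total_vertex \<Gamma>) f (op_comp P \<Gamma> x)"
    and comp_corolla:
      "\<lbrakk>stable_vertex v; fst v \<in> A; x \<in> decorations P (corolla v)\<rbrakk>
        \<Longrightarrow> op_comp P (corolla v) x = x v"
    and comp_assoc:
      "\<lbrakk>stable_graph \<Gamma>; total_genus \<Gamma> \<in> A; x \<in> decorations P \<Gamma>; F \<subseteq> edges \<Gamma>\<rbrakk>
        \<Longrightarrow> op_comp P (contract \<Gamma> F) (contract_decoration P \<Gamma> F x) = op_comp P \<Gamma> x"

definition graph_operad_hom ::
    "nat set \<Rightarrow> ('k::field, 'a) operad_data \<Rightarrow> ('k, 'b) operad_data
      \<Rightarrow> (vertex \<Rightarrow> ('a \<Rightarrow> 'k) \<Rightarrow> ('b \<Rightarrow> 'k)) \<Rightarrow> bool" where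
  "graph_operad_hom A P Q \<phi> \<longleftrightarrow>
     (\<forall>v. stable_vertex v \<and> fst v \<in> A \<longrightarrow>
        linear_from (op_space P v) (\<phi> v) \<and> \<phi> v ` op_space P v \<subseteq> op_space Q v) \<and>
     (\<forall>v f a. stable_vertex v \<and> fst v \<in> A \<and> inj_on f (snd v) \<and> a \<in> op_space P v \<longrightarrow>
        \<phi> (relabel_vertex f v) (op_act P v f a) = op_act Q v f (\<phi> v a)) \<and>
     (\<forall>\<Gamma> x. stable_graph \<Gamma> \<and> total_genus \<Gamma> \<in> A \<and> x \<in> decorations P \<Gamma> \<longrightarrow>
        \<phi> (total_vertex \<Gamma>) (op_comp P \<Gamma> x) = op_comp Q \<Gamma> (\<lambda>v\<in>verts \<Gamma>. \<phi> v (x v)))"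

definition cyclic_operad :: "('k::field, 'b) operad_data \<Rightarrow> bool" where
  "cyclic_operad = graph_operad {0}"

definition cyclic_hom ::
    "('k::field, 'a) operad_data \<Rightarrow> ('k, 'b) operad_data
      \<Rightarrow> (vertex \<Rightarrow> ('a \<Rightarrow> 'k) \<Rightarrow> ('b \<Rightarrow> 'k)) \<Rightarrow> bool" where
  "cyclic_hom = graph_operad_hom {0}"

definition modular_operad :: "('k::field, 'b) operad_data \<Rightarrow> bool" where
  "modular_operad = graph_operad UNIV"

definition modular_hom ::
    "('k::field, 'a) operad_data \<Rightarrow> ('k, 'b) operad_data
      \<Rightarrow> (vertex \<Rightarrow> ('a \<Rightarrow> 'k) \<Rightarrow> ('b \<Rightarrow> 'k)) \<Rightarrow> bool" where
  "modular_hom = graph_operad_hom UNIV"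

definition com_operad :: "('k::field, unit) operad_data" where
  "com_operad =
     \<lparr>op_space = (\<lambda>v. UNIV),
      op_act = (\<lambda>v f a. a),
      op_comp = (\<lambda>\<Gamma> x u. \<Prod>v\<in>verts \<Gamma>. x v u)\<rparr>"

text \<open>
  \<open>M\<close> with unit \<open>\<eta>\<close> is the value at \<open>Q\<close> of the left adjoint of the restriction from modular to
  cyclic operads, expressed by the universal property of the unit. In these encodings the genus
  \<open>0\<close> part of a modular operad is the same data regarded as a cyclic operad. Test
  operads live in the same universe \<open>'b \<Rightarrow> 'k\<close> as \<open>M\<close>, since a formula cannot quantify over types.
\<close>

definition modular_envelope ::
    "('k::field, 'a) operad_data \<Rightarrow> ('k, 'b) operad_data
      \<Rightarrow> (vertex \<Rightarrow> ('a \<Rightarrow> 'k) \<Rightarrow> ('b \<Rightarrow> 'k)) \<Rightarrow> bool" where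
  "modular_envelope Q M \<eta> \<longleftrightarrow>
     cyclic_operad Q \<and> modular_operad M \<and> cyclic_hom Q M \<eta> \<and>
     (\<forall>(P :: ('k, 'b) operad_data) \<phi>. modular_operad P \<and> cyclic_hom Q P \<phi> \<longrightarrow>
        (\<exists>\<psi>. modular_hom M P \<psi> \<and>
             (\<forall>v a. stable_vertex v \<and> fst v = 0 \<and> a \<in> op_space Q v \<longrightarrow> \<psi> v (\<eta> v a) = \<phi> v a) \<and>
             (\<forall>\<psi>'. modular_hom M P \<psi>' \<and>
                   (\<forall>v a. stable_vertex v \<and> fst v = 0 \<and> a \<in> op_space Q v \<longrightarrow>
                          \<psi>' v (\<eta> v a) = \<phi> v a) \<longrightarrow>
                   (\<forall>v a. stable_vertex v \<and> a \<in> op_space M v \<longrightarrow> \<psi>' v a = \<psi> v a))))"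


section \<open>Cochain complexes and the Feynman transform\<close>

record ('k, 'x) cochain_complex =
  cochains :: "nat \<Rightarrow> ('x \<Rightarrow> 'k) set"
  coboundary :: "nat \<Rightarrow> ('x \<Rightarrow> 'k) \<Rightarrow> ('x \<Rightarrow> 'k)"

text \<open>
  Meant for complexes of finite total dimension; note that \<open>fun_vs.dim\<close> is \<open>0\<close> on
  infinite-dimensional spaces.
\<close>

definition euler_char :: "('k::field, 'x) cochain_complex \<Rightarrow> int" where
  "euler_char C =
     (\<Sum>i | fun_vs.dim (cochains C i) \<noteq> 0. (- 1) ^ i * int (fun_vs.dim (cochains C i)))"

text \<open>
  The tensor product of the duals \<open>(M v)\<^sup>*\<close>, \<open>v\<close> a vertex of \<open>\<Gamma>\<close>, realised as the span of the
  decomposable multilinear forms on decorations (for arbitrary vector spaces \<open>V\<^sub>v\<close>, the map from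
  the tensor product of the \<open>V\<^sub>v\<^sup>*\<close> to the multilinear forms on the \<open>V\<^sub>v\<close> is injective).
\<close>

definition dual_labels ::
    "('k::field, 'b) operad_data \<Rightarrow> graph \<Rightarrow> ((vertex \<Rightarrow> 'b \<Rightarrow> 'k) \<Rightarrow> 'k) set" where
  "dual_labels M \<Gamma> = fun_vs.span
     {(\<lambda>x. if x \<in> decorations M \<Gamma> then \<Prod>v\<in>verts \<Gamma>. \<alpha> v (x v) else 0) | \<alpha>.
        \<forall>v\<in>verts \<Gamma>. \<alpha> v \<in> functionals (op_space M v)}"

text \<open>
  The graphs spanning the component \<open>(g, n)\<close> in degree \<open>d\<close> (the number of edges), together with an
  ordering \<open>es\<close> of their edges and arguments for the vertex labels.
\<close>

type_synonym ('k, 'b) cell = "graph \<times> nat set list \<times> (vertex \<Rightarrow> 'b \<Rightarrow> 'k)"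

definition cells :: "('k, 'b) operad_data \<Rightarrow> nat \<Rightarrow> nat \<Rightarrow> nat \<Rightarrow> ('k, 'b) cell set" where
  "cells M g n d =
     {(\<Gamma>, es, x). stable_graph \<Gamma> \<and> total_genus \<Gamma> = g \<and> legs \<Gamma> = {1..n} \<and>
                  distinct es \<and> set es = edges \<Gamma> \<and> length es = d \<and> x \<in> decorations M \<Gamma>}"

text \<open>
  An element assigns to every \<open>\<Gamma>\<close> an element of \<open>det(k\<^sup>E\<^sup>d\<^sup>g\<^sup>e\<^sup>s) \<otimes> (\<Otimes>\<^sub>v M(v)\<^sup>*)\<close>, recorded as
  an alternating function of the edge orderings of \<open>\<Gamma>\<close> with values in \<open>dual_labels M \<Gamma>\<close>,
  compatibly with all isomorphisms of graphs that fix the legs; it is determined by its values on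
  representatives of the isomorphism classes. So the space is the direct sum over isomorphism
  classes of the \<open>Aut(\<Gamma>)\<close>-invariants. The groups \<open>Aut(\<Gamma>)\<close> being finite and \<open>'k\<close> of
  characteristic \<open>0\<close>, invariants are canonically identified with the coinvariants by which the
  free twisted modular operad is often described.
\<close>

definition feynman_cochains ::
    "('k::field_char_0, 'b) operad_data \<Rightarrow> nat \<Rightarrow> nat \<Rightarrow> nat \<Rightarrow> (('k, 'b) cell \<Rightarrow> 'k) set" where
  "feynman_cochains M g n d =
     {\<Psi>. (\<forall>c. c \<notin> cells M g n d \<longrightarrow> \<Psi> c = 0) \<and>
         (\<forall>\<Gamma> es. (\<lambda>x. \<Psi> (\<Gamma>, es, x)) \<in> dual_labels M \<Gamma>) \<and>
         (\<forall>\<Gamma> es x \<pi>. (\<Gamma>, es, x) \<in> cells M g n d \<and> \<pi> permutes {..<d} \<longrightarrow>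
            \<Psi> (\<Gamma>, permute_list \<pi> es, x) = of_int (sign \<pi>) * \<Psi> (\<Gamma>, es, x)) \<and>
         (\<forall>\<Gamma> es x f. (\<Gamma>, es, x) \<in> cells M g n d \<and> inj_on f (flags \<Gamma>) \<and> (\<forall>l\<in>legs \<Gamma>. f l = l) \<longrightarrow>
            \<Psi> (relabel_graph f \<Gamma>, map (\<lambda>e. f ` e) es, relabel_decoration M f \<Gamma> x) = \<Psi> (\<Gamma>, es, x))}"

text \<open>
  The component at \<open>\<Gamma>\<close> of the differential sums, over the edges \<open>e\<close> of \<open>\<Gamma>\<close>, the dual of the
  composition along the one-edge graph that is contracted in \<open>\<Gamma>/e\<close>, with the sign of moving \<open>e\<close>
  to the front of the edge ordering.
\<close>

definition feynman_differential ::
    "('k::field_char_0, 'b) operad_data \<Rightarrow> nat \<Rightarrow> nat \<Rightarrow> nat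
      \<Rightarrow> (('k, 'b) cell \<Rightarrow> 'k) \<Rightarrow> (('k, 'b) cell \<Rightarrow> 'k)" where
  "feynman_differential M g n d \<Psi> = (\<lambda>(\<Gamma>, es, x).
     if (\<Gamma>, es, x) \<in> cells M g n (Suc d) then
       \<Sum>i\<le>d. (- 1) ^ i *
         \<Psi> (contract \<Gamma> {es ! i}, take i es @ drop (Suc i) es, contract_decoration M \<Gamma> {es ! i} x)
     else 0)"

text \<open>The complex \<open>D(M)(g, n)\<close> for a modular operad \<open>M\<close> with finite-dimensional components.\<close>

definition feynman_transform ::
    "('k::field_char_0, 'b) operad_data \<Rightarrow> nat \<Rightarrow> nat \<Rightarrow> ('k, ('k, 'b) cell) cochain_complex" where
  "feynman_transform M g n =
     \<lparr>cochains = feynman_cochains M g n, coboundary = feynman_differential M g n\<rparr>"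

end

theory Submission
  imports Defs
begin

text \<open>
  Contracting spanning trees shows that the envelope of \<open>Com\<close> is one-dimensional in genus \<open>0\<close> and \<open>1\<close>
  with trivial actions, so in degree \<open>d\<close> the complex has a basis indexed by the isomorphism classes of
  stable graphs of genus \<open>1\<close> with \<open>d\<close> edges and without automorphisms that are odd on edges. It remains
  to count these classes with the signs \<open>(-1)\<^sup>d\<close>.

  Fix an equivalence relation \<open>Q\<close> on the legs with a class \<open>S\<close> of at least two elements, and consider the
  graphs in which \<open>Q\<close>-equivalent legs lie on the same vertex. Either \<open>S\<close> makes up all but one of the flags of
  a vertex of genus \<open>0\<close>, and the edge at this vertex can be contracted, or \<open>S\<close> can be moved to a new such
  vertex; this matches the graphs in pairs of opposite sign. Induction on \<open>Q\<close> therefore cancels all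
  graphs having two legs on a common vertex. The remaining ones are cycles of \<open>n\<close> trivalent vertices with
  one leg each; there are \<open>(n-1)!/2\<close> of them, up to rotation and reflection, and they have \<open>n\<close> edges.
\<close>

section \<open>Stable graphs\<close>

text \<open>The envelope is known only through its universal property, so its size is bounded from
  two sides: the universal property forces \<open>M\<close> into the span of explicit composites,
  and a map to \<open>modular_com\<close> shows that these composites do not vanish. A genus one
  graph has only vertices of genus zero and one, so no other components of \<open>M\<close> have to
  be known.

  The pairing has to work on isomorphism classes and to respect the absence of odd automorphisms.
  Both hold because isomorphisms fix the legs: an automorphism fixes the vertex carrying
  \<open>S\<close> and, once \<open>S\<close> has been moved away, also the new edge. The pairing is
  compatible with \<open>Q \<subseteq> same_vertex \<Gamma>\<close> but not with equality, since
  contraction may put \<open>S\<close> next to further legs; this is why the exact relation is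
  reached by induction and not directly.

  The factor 1/2 comes from reading a cycle from leg 1 on. This rules out rotations and leaves
  (n-1)! orders of the other legs, with each cycle read in two directions. For n at least 3 the two
  readings differ, and no reflection is an automorphism.\<close>

lemma stable_graphD:
  assumes "stable_graph \<Gamma>"
  shows "finite (verts \<Gamma>)" "verts \<Gamma> \<noteq> {}"
    and "\<And>v. v \<in> verts \<Gamma> \<Longrightarrow> stable_vertex v"
    and "\<And>v w. v \<in> verts \<Gamma> \<Longrightarrow> w \<in> verts \<Gamma> \<Longrightarrow> v \<noteq> w \<Longrightarrow> snd v \<inter> snd w = {}"
    and "\<And>e. e \<in> edges \<Gamma> \<Longrightarrow> card e = 2" "\<And>e. e \<in> edges \<Gamma> \<Longrightarrow> e \<subseteq> flags \<Gamma>"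
    and "\<And>e e'. e \<in> edges \<Gamma> \<Longrightarrow> e' \<in> edges \<Gamma> \<Longrightarrow> e \<noteq> e' \<Longrightarrow> e \<inter> e' = {}"
    and "\<And>v w. v \<in> verts \<Gamma> \<Longrightarrow> w \<in> verts \<Gamma> \<Longrightarrow> (v, w) \<in> (joined \<Gamma> (edges \<Gamma>))\<^sup>*"
  using assms unfolding stable_graph_def by auto

lemma vertex_unique:
  assumes "stable_graph \<Gamma>" "v \<in> verts \<Gamma>" "w \<in> verts \<Gamma>" "i \<in> snd v" "i \<in> snd w"
  shows "v = w"
  using stable_graphD(4)[OF assms(1-3)] assms(4,5) by blast

lemma edge_unique:
  assumes "stable_graph \<Gamma>" "e \<in> edges \<Gamma>" "e' \<in> edges \<Gamma>" "i \<in> e" "i \<in> e'"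
  shows "e = e'"
  using stable_graphD(7)[OF assms(1-3)] assms(4,5) by blast

lemma flag_vertexE:
  assumes "i \<in> flags \<Gamma>"
  obtains v where "v \<in> verts \<Gamma>" "i \<in> snd v"
  using assms unfolding flags_def by blast

lemma snd_subset_flags: "v \<in> verts \<Gamma> \<Longrightarrow> snd v \<subseteq> flags \<Gamma>"
  unfolding flags_def by blast

lemma finite_flags:
  assumes "stable_graph \<Gamma>" shows "finite (flags \<Gamma>)"
  using stable_graphD(1,3)[OF assms] unfolding flags_def stable_vertex_def by auto

lemma finite_edges:
  assumes "stable_graph \<Gamma>" shows "finite (edges \<Gamma>)"
  using stable_graphD(6)[OF assms] finite_flags[OF assms]
  by (meson PowI finite_Pow_iff finite_subset subsetI)

lemma legs_subset_flags: "legs \<Gamma> \<subseteq> flags \<Gamma>"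
  unfolding legs_def by blast

lemma finite_legs:
  assumes "stable_graph \<Gamma>" shows "finite (legs \<Gamma>)"
  using finite_flags[OF assms] legs_subset_flags finite_subset by blast

lemma card_flags:
  assumes "stable_graph \<Gamma>"
  shows "card (flags \<Gamma>) = (\<Sum>v\<in>verts \<Gamma>. card (snd v))"
proof -
  have "card (flags \<Gamma>) = card (\<Union>v\<in>verts \<Gamma>. snd v)"
    unfolding flags_def by simp
  also have "\<dots> = (\<Sum>v\<in>verts \<Gamma>. card (snd v))"
    using stable_graphD[OF assms] by (intro card_UN_disjoint) (auto simp: stable_vertex_def)
  finally show ?thesis .
qed

lemma card_Union_edges:
  assumes "stable_graph \<Gamma>"
  shows "card (\<Union> (edges \<Gamma>)) = 2 * card (edges \<Gamma>)"
proof -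
  have "card (\<Union> (edges \<Gamma>)) = sum card (edges \<Gamma>)"
    using stable_graphD[OF assms]
    by (intro card_Union_disjoint) (auto simp: pairwise_def disjnt_def intro: card_ge_0_finite)
  also have "\<dots> = 2 * card (edges \<Gamma>)"
    using stable_graphD(5)[OF assms] by simp
  finally show ?thesis .
qed

lemma card_flags_legs:
  assumes "stable_graph \<Gamma>"
  shows "card (flags \<Gamma>) = card (legs \<Gamma>) + 2 * card (edges \<Gamma>)"
proof -
  have "\<Union> (edges \<Gamma>) \<subseteq> flags \<Gamma>"
    using stable_graphD(6)[OF assms] by blast
  then show ?thesis
    using card_Union_edges[OF assms] finite_flags[OF assms] unfolding legs_def
    by (metis card_Diff_subset card_mono finite_subset le_add_diff_inverse2)
qed

lemma edge_partner:
  assumes "stable_graph \<Gamma>" "e \<in> edges \<Gamma>" "i \<in> e"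
  obtains j where "j \<noteq> i" "e = {i, j}"
proof -
  obtain x y where "e = {x, y}" "x \<noteq> y"
    using stable_graphD(5)[OF assms(1,2)] by (auto simp: card_2_iff)
  then show ?thesis
    using assms(3) that[of x] that[of y] by auto
qed

lemma joinedI:
  assumes "v \<in> verts \<Gamma>" "w \<in> verts \<Gamma>" "e \<in> F" "i \<in> e" "i \<in> snd v" "j \<in> e" "j \<in> snd w"
  shows "(v, w) \<in> joined \<Gamma> F"
  using assms unfolding joined_def by blast

lemma joined_sym: "sym (joined \<Gamma> F)"
  unfolding joined_def sym_def by blast

lemma equiv_joined: "equiv UNIV ((joined \<Gamma> F)\<^sup>*)"
  by (simp add: equiv_def refl_rtrancl sym_rtrancl[OF joined_sym] trans_rtrancl)

lemma joined_rtrancl_verts: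
  assumes "(v, w) \<in> (joined \<Gamma> F)\<^sup>*" "v \<in> verts \<Gamma>"
  shows "w \<in> verts \<Gamma>"
  using assms by (induction rule: rtrancl_induct) (auto simp: joined_def)

lemma closed_rtrancl:
  assumes "(v, w) \<in> (joined \<Gamma> F)\<^sup>*" "v \<in> T"
    and "\<And>v w. v \<in> T \<Longrightarrow> (v, w) \<in> joined \<Gamma> F \<Longrightarrow> w \<in> T"
  shows "w \<in> T"
  using assms(1,2) by (induction rule: rtrancl_induct) (auto intro: assms(3))

text \<open>The vertices reachable from \<open>v\<close> form a nonempty closed set, so it suffices
  that closed sets exhaust the graph. For modified graphs this avoids rewriting paths: a closed set
  is pulled back to the original graph instead.\<close>

lemma connectedI:
  assumes "\<And>T. T \<subseteq> verts \<Gamma> \<Longrightarrow> T \<noteq> {} \<Longrightarrow> (\<And>v w. v \<in> T \<Longrightarrow> (v, w) \<in> joined \<Gamma> F \<Longrightarrow> w \<in> T)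
             \<Longrightarrow> verts \<Gamma> \<subseteq> T"
    and "v \<in> verts \<Gamma>" "w \<in> verts \<Gamma>"
  shows "(v, w) \<in> (joined \<Gamma> F)\<^sup>*"
proof -
  let ?T = "{u. (v, u) \<in> (joined \<Gamma> F)\<^sup>*}"
  have "verts \<Gamma> \<subseteq> ?T"
    using joined_rtrancl_verts[OF _ assms(2)] by (intro assms(1)) (blast intro: rtrancl_into_rtrancl)+
  then show ?thesis
    using assms(3) by blast
qed

lemma crossing_edge:
  assumes "stable_graph \<Gamma>" "v \<in> T" "v \<in> verts \<Gamma>" "w \<in> verts \<Gamma>" "w \<notin> T"
  obtains v' w' e where "v' \<in> T" "v' \<in> verts \<Gamma>" "w' \<in> verts \<Gamma>" "w' \<notin> T" "e \<in> edges \<Gamma>"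
    "e \<inter> snd v' \<noteq> {}" "e \<inter> snd w' \<noteq> {}"
proof -
  have "(v, w) \<in> (joined \<Gamma> (edges \<Gamma>))\<^sup>*"
    using assms stable_graphD(8) by blast
  then have "\<exists>v'\<in>T. \<exists>w'. (v', w') \<in> joined \<Gamma> (edges \<Gamma>) \<and> w' \<notin> T"
    using closed_rtrancl[of v w \<Gamma> "edges \<Gamma>" T] assms(2,5) by blast
  then show ?thesis
    using that unfolding joined_def by blast
qed

text \<open>The flag \<open>i\<close> of the crossing edge cannot lie on \<open>w'\<close> as well,
  because vertices are disjoint, so the other flag of the edge does.\<close>

lemma crossing_edge':
  assumes "stable_graph \<Gamma>" "v \<in> T" "v \<in> verts \<Gamma>" "w \<in> verts \<Gamma>" "w \<notin> T"
  obtains v' w' i j where "v' \<in> T" "v' \<in> verts \<Gamma>" "w' \<in> verts \<Gamma>" "w' \<notin> T" "{i, j} \<in> edges \<Gamma>"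
    "i \<noteq> j" "i \<in> snd v'" "j \<in> snd w'"
proof -
  obtain v' w' e where *: "v' \<in> T" "v' \<in> verts \<Gamma>" "w' \<in> verts \<Gamma>" "w' \<notin> T" "e \<in> edges \<Gamma>"
    "e \<inter> snd v' \<noteq> {}" "e \<inter> snd w' \<noteq> {}"
    using crossing_edge[OF assms] by metis
  then obtain i where i: "i \<in> e" "i \<in> snd v'" by blast
  obtain j where j: "j \<noteq> i" "e = {i, j}"
    using edge_partner[OF assms(1) *(5) i(1)] by metis
  have "i \<notin> snd w'"
    using vertex_unique[OF assms(1) *(2,3)] i *(1,4) by blast
  then show ?thesis
    using that[of v' w' i j] * i j by auto
qed

text \<open>A largest vertex set \<open>T\<close> connected by \<open>card T - 1\<close> edges must
  be everything, since an edge leaving it would enlarge it. Keeping the edges of \<open>F\<close>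
  inside \<open>T\<close> ensures that the crossing edge is new, so that the count stays
  exact.\<close>

lemma spanning_tree:
  assumes "stable_graph \<Gamma>"
  obtains F where "F \<subseteq> edges \<Gamma>" "card F + 1 = card (verts \<Gamma>)"
    "\<And>v w. v \<in> verts \<Gamma> \<Longrightarrow> w \<in> verts \<Gamma> \<Longrightarrow> (v, w) \<in> (joined \<Gamma> F)\<^sup>*"
proof -
  define good where "good T \<longleftrightarrow> T \<subseteq> verts \<Gamma> \<and> T \<noteq> {} \<and> (\<exists>F\<subseteq>edges \<Gamma>. card F + 1 = card T
    \<and> (\<forall>e\<in>F. e \<subseteq> \<Union> (snd ` T)) \<and> (\<forall>v\<in>T. \<forall>w\<in>T. (v, w) \<in> (joined \<Gamma> F)\<^sup>*))" for T
  obtain v0 where v0: "v0 \<in> verts \<Gamma>"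
    using stable_graphD(2)[OF assms] by blast
  have v0_good: "good {v0}"
    unfolding good_def using v0 by (auto intro!: exI[of _ "{}"])
  have bound: "\<forall>T. good T \<longrightarrow> card T < Suc (card (verts \<Gamma>))"
    unfolding good_def using card_mono[OF stable_graphD(1)[OF assms]] by (simp add: less_Suc_eq_le)
  obtain T where T: "good T" and max: "\<And>T'. good T' \<Longrightarrow> card T' \<le> card T"
    using ex_has_greatest_nat[of good, OF v0_good bound] that by metis
  obtain F where "F \<subseteq> edges \<Gamma> \<and> card F + 1 = card T
    \<and> (\<forall>e\<in>F. e \<subseteq> \<Union> (snd ` T)) \<and> (\<forall>v\<in>T. \<forall>w\<in>T. (v, w) \<in> (joined \<Gamma> F)\<^sup>*)"
    using T unfolding good_def by auto
  then have F: "F \<subseteq> edges \<Gamma>" "card F + 1 = card T" "\<And>e. e \<in> F \<Longrightarrow> e \<subseteq> \<Union> (snd ` T)"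
    "\<And>v w. v \<in> T \<Longrightarrow> w \<in> T \<Longrightarrow> (v, w) \<in> (joined \<Gamma> F)\<^sup>*"
    by simp_all
  have TV: "T \<subseteq> verts \<Gamma>" "T \<noteq> {}"
    using T unfolding good_def by simp_all
  have "T = verts \<Gamma>"
  proof (rule ccontr)
    assume "T \<noteq> verts \<Gamma>"
    then obtain v w where "v \<in> T" "v \<in> verts \<Gamma>" "w \<in> verts \<Gamma>" "w \<notin> T"
      using TV by blast
    then obtain v' w' i j where *: "v' \<in> T" "v' \<in> verts \<Gamma>" "w' \<in> verts \<Gamma>" "w' \<notin> T"
      "{i, j} \<in> edges \<Gamma>" "i \<noteq> j" "i \<in> snd v'" "j \<in> snd w'"
      by (rule crossing_edge'[OF assms]) blast
    have "j \<notin> \<Union> (snd ` T)"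
      using vertex_unique[OF assms _ *(3) _ *(8)] TV(1) *(4) by blast
    then have nF: "{i, j} \<notin> F"
      using F(3) by blast
    let ?F = "insert {i, j} F"
    have "finite F" "finite T"
      using F(1) finite_edges[OF assms] TV(1) stable_graphD(1)[OF assms] finite_subset by blast+
    then have "card ?F + 1 = card (insert w' T)"
      using nF *(4) F(2) by simp
    moreover have "\<forall>e\<in>?F. e \<subseteq> \<Union> (snd ` insert w' T)"
      using F(3) *(1,7,8) by auto
    moreover have conn: "(v, w) \<in> (joined \<Gamma> ?F)\<^sup>*" if "v \<in> insert w' T" "w \<in> insert w' T" for v w
    proof -
      have mono: "(joined \<Gamma> F)\<^sup>* \<subseteq> (joined \<Gamma> ?F)\<^sup>*"
        by (rule rtrancl_mono) (auto simp: joined_def)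
      have "(v', w') \<in> joined \<Gamma> ?F"
        using * by (auto simp: joined_def)
      then have "(v', u) \<in> (joined \<Gamma> ?F)\<^sup>*" if "u \<in> insert w' T" for u
        using that by (blast intro: subsetD[OF mono F(4)[OF *(1)]] r_into_rtrancl)
      then show ?thesis
        using that sym_rtrancl[OF joined_sym] by (metis rtrancl_trans symD)
    qed
    ultimately have "good (insert w' T)"
      unfolding good_def using TV *(3,5) F(1) by (intro conjI exI[of _ ?F]) auto
    then have "card (insert w' T) \<le> card T"
      by (rule max)
    then show False
      using *(4) \<open>finite T\<close> by simp
  qed
  then show ?thesis
    using that F by blast
qed

lemma card_verts_le:
  assumes "stable_graph \<Gamma>"
  shows "card (verts \<Gamma>) \<le> card (edges \<Gamma>) + 1"
proof -
  obtain F where "F \<subseteq> edges \<Gamma>" "card F + 1 = card (verts \<Gamma>)"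
    using spanning_tree[OF assms] by metis
  then show ?thesis
    using card_mono[OF finite_edges[OF assms]] by (metis add_le_mono1)
qed

text \<open>By \<open>card_verts_le\<close> the subtraction in \<open>total_genus\<close> does not
  truncate; the additive form is the one that linear arithmetic can use.\<close>

lemma total_genus_eq_iff:
  assumes "stable_graph \<Gamma>"
  shows "total_genus \<Gamma> = g \<longleftrightarrow> card (edges \<Gamma>) + 1 + (\<Sum>v\<in>verts \<Gamma>. fst v) = g + card (verts \<Gamma>)"
  using card_verts_le[OF assms] unfolding total_genus_def by linarith

text \<open>Sum of the stability inequality \<open>3 \<le> 2 * fst v + card (snd v)\<close> over the
  vertices, with the flags counted as legs plus two per edge. It bounds the size of the graph and
  shows that contracting everything leaves a stable vertex.\<close>

lemma card_verts_legs:
  assumes "stable_graph \<Gamma>"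
  shows "card (verts \<Gamma>) + 2 \<le> 2 * total_genus \<Gamma> + card (legs \<Gamma>)"
proof -
  have "3 * card (verts \<Gamma>) = (\<Sum>v\<in>verts \<Gamma>. 3)"
    by simp
  also have "\<dots> \<le> (\<Sum>v\<in>verts \<Gamma>. 2 * fst v + card (snd v))"
    using stable_graphD(3)[OF assms] by (intro sum_mono) (fastforce simp: stable_vertex_def)
  also have "\<dots> = 2 * (\<Sum>v\<in>verts \<Gamma>. fst v) + card (legs \<Gamma>) + 2 * card (edges \<Gamma>)"
    using card_flags[OF assms] card_flags_legs[OF assms] by (simp add: sum.distrib sum_distrib_left)
  finally show ?thesis
    using total_genus_eq_iff[OF assms, of "total_genus \<Gamma>"] by simp
qed

lemma stable_total_vertex:
  assumes "stable_graph \<Gamma>"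
  shows "stable_vertex (total_vertex \<Gamma>)"
proof -
  have "card (verts \<Gamma>) > 0"
    using stable_graphD(1,2)[OF assms] by (simp add: card_gt_0_iff)
  then show ?thesis
    using card_verts_legs[OF assms] finite_legs[OF assms]
    by (simp add: stable_vertex_def total_vertex_def)
qed

lemma genus_le_total_genus:
  assumes "stable_graph \<Gamma>" "v \<in> verts \<Gamma>"
  shows "fst v \<le> total_genus \<Gamma>"
  using member_le_sum[OF assms(2), of fst] stable_graphD(1)[OF assms(1)]
  unfolding total_genus_def by (simp add: trans_le_add2)

text \<open>The first Betti number and the vertex genera are nonnegative and add up to one: there is
  either one independent cycle or one vertex of genus one.\<close>

lemma genus_one_cases:
  assumes "stable_graph \<Gamma>" "total_genus \<Gamma> = 1"
  obtains (cycle) "\<And>v. v \<in> verts \<Gamma> \<Longrightarrow> fst v = 0" "card (edges \<Gamma>) = card (verts \<Gamma>)"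
  | (tree) w where "w \<in> verts \<Gamma>" "fst w = 1" "\<And>v. v \<in> verts \<Gamma> \<Longrightarrow> v \<noteq> w \<Longrightarrow> fst v = 0"
      "card (edges \<Gamma>) + 1 = card (verts \<Gamma>)"
proof (cases "\<exists>w\<in>verts \<Gamma>. fst w \<noteq> 0")
  case True
  then obtain w where w: "w \<in> verts \<Gamma>" "fst w \<noteq> 0" by blast
  have fin: "finite (verts \<Gamma>)"
    by (rule stable_graphD(1)[OF assms(1)])
  have *: "card (edges \<Gamma>) + 1 + (fst w + (\<Sum>v\<in>verts \<Gamma> - {w}. fst v)) = 1 + card (verts \<Gamma>)"
    using total_genus_eq_iff[OF assms(1), of 1] assms(2) sum.remove[OF fin w(1), of fst] by simp
  then have "fst w = 1" "(\<Sum>v\<in>verts \<Gamma> - {w}. fst v) = 0"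
    using card_verts_le[OF assms(1)] w(2) by linarith+
  then show ?thesis
    using * fin w(1) by (intro tree[of w]) auto
next
  case False
  then show ?thesis
    using total_genus_eq_iff[OF assms(1), of 1] assms(2) by (intro cycle) auto
qed

section \<open>Relabelling\<close>

lemma relabel_graph_simps [simp]:
  "verts (relabel_graph f \<Gamma>) = relabel_vertex f ` verts \<Gamma>"
  "edges (relabel_graph f \<Gamma>) = (`) f ` edges \<Gamma>"
  unfolding relabel_graph_def by simp_all

lemma relabel_vertex_simps [simp]:
  "fst (relabel_vertex f v) = fst v" "snd (relabel_vertex f v) = f ` snd v"
  unfolding relabel_vertex_def by simp_all

lemma graph_eqI: "verts \<Gamma> = verts \<Delta> \<Longrightarrow> edges \<Gamma> = edges \<Delta> \<Longrightarrow> \<Gamma> = (\<Delta> :: graph)"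
  by simp

lemma flags_relabel: "flags (relabel_graph f \<Gamma>) = f ` flags \<Gamma>"
  unfolding flags_def by auto

lemma inj_on_relabel_vertex:
  assumes "inj_on f (flags \<Gamma>)"
  shows "inj_on (relabel_vertex f) (verts \<Gamma>)"
proof (rule inj_onI)
  fix v w assume *: "v \<in> verts \<Gamma>" "w \<in> verts \<Gamma>" "relabel_vertex f v = relabel_vertex f w"
  then have "f ` snd v = f ` snd w" "fst v = fst w"
    unfolding relabel_vertex_def by auto
  then show "v = w"
    using inj_on_image_eq_iff[OF assms] snd_subset_flags *(1,2) prod_eq_iff by metis
qed

lemma inj_on_image_edges:
  assumes "stable_graph \<Gamma>" "inj_on f (flags \<Gamma>)"
  shows "inj_on ((`) f) (edges \<Gamma>)"
  using stable_graphD(6)[OF assms(1)] inj_on_image_eq_iff[OF assms(2)] by (meson inj_onI)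

lemma legs_relabel:
  assumes "stable_graph \<Gamma>" "inj_on f (flags \<Gamma>)"
  shows "legs (relabel_graph f \<Gamma>) = f ` legs \<Gamma>"
proof -
  have "\<Union> (edges \<Gamma>) \<subseteq> flags \<Gamma>"
    using stable_graphD(6)[OF assms(1)] by blast
  then have "f ` legs \<Gamma> = f ` flags \<Gamma> - f ` \<Union> (edges \<Gamma>)"
    unfolding legs_def using assms(2) by (simp add: inj_on_image_set_diff)
  then show ?thesis
    unfolding legs_def flags_relabel by auto
qed

lemma card_verts_relabel:
  "inj_on f (flags \<Gamma>) \<Longrightarrow> card (verts (relabel_graph f \<Gamma>)) = card (verts \<Gamma>)"
  by (simp add: card_image inj_on_relabel_vertex)

lemma card_edges_relabel:
  "stable_graph \<Gamma> \<Longrightarrow> inj_on f (flags \<Gamma>) \<Longrightarrow> card (edges (relabel_graph f \<Gamma>)) = card (edges \<Gamma>)"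
  by (simp add: card_image inj_on_image_edges)

lemma total_genus_relabel:
  assumes "stable_graph \<Gamma>" "inj_on f (flags \<Gamma>)"
  shows "total_genus (relabel_graph f \<Gamma>) = total_genus \<Gamma>"
  unfolding total_genus_def card_verts_relabel[OF assms(2)] card_edges_relabel[OF assms]
  by (simp add: sum.reindex[OF inj_on_relabel_vertex[OF assms(2)]])

lemma stable_vertex_relabel:
  assumes "stable_vertex v" "inj_on f (snd v)"
  shows "stable_vertex (relabel_vertex f v)"
  using assms by (simp add: stable_vertex_def card_image)

lemma stable_graph_relabel:
  assumes "stable_graph \<Gamma>" "inj_on f (flags \<Gamma>)"
  shows "stable_graph (relabel_graph f \<Gamma>)"
  unfolding stable_graph_def
proof (intro conjI ballI impI)
  note sg = stable_graphD[OF assms(1)]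
  show "finite (verts (relabel_graph f \<Gamma>))" "verts (relabel_graph f \<Gamma>) \<noteq> {}"
    using sg(1,2) by auto
  show "stable_vertex v" if "v \<in> verts (relabel_graph f \<Gamma>)" for v
    using that sg(3) stable_vertex_relabel inj_on_subset[OF assms(2) snd_subset_flags] by auto
  show "snd v \<inter> snd w = {}"
    if vw: "v \<in> verts (relabel_graph f \<Gamma>)" "w \<in> verts (relabel_graph f \<Gamma>)" "v \<noteq> w" for v w
  proof -
    obtain v' w' where *: "v' \<in> verts \<Gamma>" "w' \<in> verts \<Gamma>" "v = relabel_vertex f v'"
      "w = relabel_vertex f w'" using vw by auto
    then have "v' \<noteq> w'" using vw(3) by blast
    then have "f ` (snd v' \<inter> snd w') = {}" using sg(4) * by simp
    then show ?thesis
      using inj_on_image_Int[OF assms(2) snd_subset_flags snd_subset_flags] * by auto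
  qed
  show "card e = 2" "e \<subseteq> flags (relabel_graph f \<Gamma>)" if "e \<in> edges (relabel_graph f \<Gamma>)" for e
    using that sg(5,6) inj_on_subset[OF assms(2)] by (auto simp: card_image flags_relabel)
  show "e \<inter> e' = {}"
    if ee: "e \<in> edges (relabel_graph f \<Gamma>)" "e' \<in> edges (relabel_graph f \<Gamma>)" "e \<noteq> e'" for e e'
  proof -
    obtain d d' where *: "d \<in> edges \<Gamma>" "d' \<in> edges \<Gamma>" "e = f ` d" "e' = f ` d'"
      using ee by auto
    then have "d \<noteq> d'" using ee(3) by blast
    then have "f ` (d \<inter> d') = {}" using sg(7) * by simp
    then show ?thesis
      using inj_on_image_Int[OF assms(2) sg(6) sg(6)] * by auto
  qed
  show "(v, w) \<in> (joined (relabel_graph f \<Gamma>) (edges (relabel_graph f \<Gamma>)))\<^sup>*"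
    if vw: "v \<in> verts (relabel_graph f \<Gamma>)" "w \<in> verts (relabel_graph f \<Gamma>)" for v w
  proof -
    obtain v' w' where *: "v' \<in> verts \<Gamma>" "w' \<in> verts \<Gamma>" "v = relabel_vertex f v'"
      "w = relabel_vertex f w'" using vw by auto
    have "(relabel_vertex f v', relabel_vertex f u)
            \<in> (joined (relabel_graph f \<Gamma>) (edges (relabel_graph f \<Gamma>)))\<^sup>*"
      if "(v', u) \<in> (joined \<Gamma> (edges \<Gamma>))\<^sup>*" for u
      using that
    proof (induction rule: rtrancl_induct)
      case (step y z)
      obtain e where e: "y \<in> verts \<Gamma>" "z \<in> verts \<Gamma>" "e \<in> edges \<Gamma>" "e \<inter> snd y \<noteq> {}" "e \<inter> snd z \<noteq> {}"
        using step(2) unfolding joined_def by blast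
      then have "f ` e \<inter> f ` snd y \<noteq> {}" "f ` e \<inter> f ` snd z \<noteq> {}" by blast+
      then have "(relabel_vertex f y, relabel_vertex f z)
          \<in> joined (relabel_graph f \<Gamma>) (edges (relabel_graph f \<Gamma>))"
        unfolding joined_def using e(1-3) by auto
      then show ?case using step(3) by (rule rtrancl_into_rtrancl[rotated])
    qed simp
    then show ?thesis using sg(8)[OF *(1,2)] * by blast
  qed
qed

lemma relabel_graph_compose: "relabel_graph g (relabel_graph f \<Gamma>) = relabel_graph (g \<circ> f) \<Gamma>"
  by (rule graph_eqI) (auto simp: relabel_vertex_def image_image image_comp)

lemma relabel_graph_cong:
  assumes "\<And>i. i \<in> flags \<Gamma> \<Longrightarrow> f i = g i" "stable_graph \<Gamma>"
  shows "relabel_graph f \<Gamma> = relabel_graph g \<Gamma>"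
proof (rule graph_eqI)
  have "relabel_vertex f v = relabel_vertex g v" if "v \<in> verts \<Gamma>" for v
    using snd_subset_flags[OF that] assms(1) unfolding relabel_vertex_def
    by (auto intro!: image_cong)
  then show "verts (relabel_graph f \<Gamma>) = verts (relabel_graph g \<Gamma>)"
    by simp
  have "f ` e = g ` e" if "e \<in> edges \<Gamma>" for e
    using stable_graphD(6)[OF assms(2) that] assms(1) by (auto intro!: image_cong)
  then show "edges (relabel_graph f \<Gamma>) = edges (relabel_graph g \<Gamma>)"
    by simp
qed

lemma relabel_graph_id:
  assumes "\<And>i. i \<in> flags \<Gamma> \<Longrightarrow> f i = i" "stable_graph \<Gamma>"
  shows "relabel_graph f \<Gamma> = \<Gamma>"
  using relabel_graph_cong[of \<Gamma> f id] assms
  by (auto simp: relabel_graph_def relabel_vertex_def)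

section \<open>Contraction of edges\<close>

lemma componentsE:
  assumes "W \<in> components \<Gamma> F"
  obtains v where "v \<in> verts \<Gamma>" "W = (joined \<Gamma> F)\<^sup>* `` {v}"
  using assms unfolding components_def by (blast elim: quotientE)

lemma component_eq:
  assumes "W \<in> components \<Gamma> F" "v \<in> W"
  shows "W = (joined \<Gamma> F)\<^sup>* `` {v}"
proof -
  obtain u where u: "u \<in> verts \<Gamma>" "W = (joined \<Gamma> F)\<^sup>* `` {u}"
    by (rule componentsE[OF assms(1)])
  then have "(u, v) \<in> (joined \<Gamma> F)\<^sup>*"
    using assms(2) by blast
  then show ?thesis
    using equiv_class_eq[OF equiv_joined] u(2) by blast
qed

lemma component_subset_verts: "W \<in> components \<Gamma> F \<Longrightarrow> W \<subseteq> verts \<Gamma>"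
  using joined_rtrancl_verts by (blast elim: componentsE)

lemma component_nonempty: "W \<in> components \<Gamma> F \<Longrightarrow> W \<noteq> {}"
  by (blast elim: componentsE)

lemma components_disjoint:
  "W \<in> components \<Gamma> F \<Longrightarrow> W' \<in> components \<Gamma> F \<Longrightarrow> W \<noteq> W' \<Longrightarrow> W \<inter> W' = {}"
  using component_eq by blast

lemma Union_components: "\<Union> (components \<Gamma> F) = verts \<Gamma>"
proof
  show "\<Union> (components \<Gamma> F) \<subseteq> verts \<Gamma>"
    using component_subset_verts by blast
  show "verts \<Gamma> \<subseteq> \<Union> (components \<Gamma> F)"
    unfolding components_def by (blast intro: quotientI)
qed

lemma subgraph_simps [simp]:
  "verts (subgraph \<Gamma> F W) = W" "edges (subgraph \<Gamma> F W) = {e \<in> F. e \<subseteq> \<Union> (snd ` W)}"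
  by (simp_all add: subgraph_def)

text \<open>By connectedness some edge leaves \<open>W\<close>. It is not contained in the flags of
  \<open>W\<close>, hence is no edge of the subgraph, and its flag at \<open>W\<close> survives as a
  leg.\<close>

lemma legs_component_nonempty:
  assumes "stable_graph \<Gamma>" "F \<subseteq> edges \<Gamma>" "W \<in> components \<Gamma> F" "W \<noteq> verts \<Gamma>"
  shows "legs (subgraph \<Gamma> F W) \<noteq> {}"
proof -
  note W = component_subset_verts[OF assms(3)] component_nonempty[OF assms(3)]
  obtain v w where "v \<in> W" "v \<in> verts \<Gamma>" "w \<in> verts \<Gamma>" "w \<notin> W"
    using W assms(4) by blast
  then obtain v' w' i j where *: "v' \<in> W" "v' \<in> verts \<Gamma>" "w' \<in> verts \<Gamma>" "w' \<notin> W"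
    "{i, j} \<in> edges \<Gamma>" "i \<noteq> j" "i \<in> snd v'" "j \<in> snd w'"
    by (rule crossing_edge'[OF assms(1)]) blast
  have "i \<notin> e" if "e \<in> F" "e \<subseteq> \<Union> (snd ` W)" for e
  proof
    assume "i \<in> e"
    then have "e = {i, j}"
      using edge_unique[OF assms(1) _ *(5)] \<open>e \<in> F\<close> assms(2) by blast
    then obtain u where "u \<in> W" "j \<in> snd u"
      using \<open>e \<subseteq> \<Union> (snd ` W)\<close> by blast
    then show False
      using vertex_unique[OF assms(1) _ *(3) _ *(8)] W(1) *(4) by blast
  qed
  then have "i \<in> legs (subgraph \<Gamma> F W)"
    unfolding legs_def flags_def subgraph_def using *(1,7) by auto
  then show ?thesis by blast
qed

text \<open>A contraction stores its vertices as a set of pairs of a genus and a set of legs, so two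
  components with equal pairs would collapse into one. If there are two components, each has a leg,
  and flags of disjoint components are distinct.\<close>

lemma inj_on_total_vertex:
  assumes "stable_graph \<Gamma>" "F \<subseteq> edges \<Gamma>"
  shows "inj_on (\<lambda>W. total_vertex (subgraph \<Gamma> F W)) (components \<Gamma> F)"
proof (rule inj_onI, rule ccontr)
  fix W W' assume *: "W \<in> components \<Gamma> F" "W' \<in> components \<Gamma> F"
    "total_vertex (subgraph \<Gamma> F W) = total_vertex (subgraph \<Gamma> F W')" "W \<noteq> W'"
  have "W \<inter> W' = {}"
    by (rule components_disjoint) (use * in auto)
  moreover have sub: "W \<subseteq> verts \<Gamma>" "W' \<subseteq> verts \<Gamma>" "W' \<noteq> {}"
    using component_subset_verts component_nonempty *(1,2) by metis+
  ultimately have "W \<noteq> verts \<Gamma>"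
    by blast
  then obtain i where i: "i \<in> legs (subgraph \<Gamma> F W)"
    using legs_component_nonempty[OF assms *(1)] by blast
  moreover have "i \<in> legs (subgraph \<Gamma> F W')"
    using *(3) i unfolding total_vertex_def by simp
  ultimately obtain v v' where "v \<in> W" "v' \<in> W'" "i \<in> snd v" "i \<in> snd v'"
    unfolding legs_def flags_def subgraph_def by auto
  then show False
    using vertex_unique[OF assms(1)] sub \<open>W \<inter> W' = {}\<close> by blast
qed

lemma component_over_total_vertex:
  assumes "stable_graph \<Gamma>" "F \<subseteq> edges \<Gamma>" "W \<in> components \<Gamma> F"
  shows "component_over \<Gamma> F (total_vertex (subgraph \<Gamma> F W)) = W"
  unfolding component_over_def
  by (rule the_equality) (use assms inj_onD[OF inj_on_total_vertex[OF assms(1,2)]] in auto)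

section \<open>The commutative modular operad\<close>

text \<open>A copy of the field inside \<open>'b \<Rightarrow> 'k\<close>: the functions supported
  at one point. The point \<open>undefined\<close> only serves as some element of the arbitrary type
  \<open>'b\<close>.\<close>

definition line :: "'k \<Rightarrow> 'b \<Rightarrow> 'k::zero" where
  "line c = (\<lambda>b. if b = undefined then c else 0)"

lemma line_undefined [simp]: "line c undefined = c"
  by (simp add: line_def)

lemma line_add: "line (c + d) = line c + (line d :: 'b \<Rightarrow> 'k::field)"
  by (auto simp: line_def fun_eq_iff)

lemma line_scale: "line (c * d) = fscale c (line d :: 'b \<Rightarrow> 'k::field)"
  by (auto simp: line_def fscale_def fun_eq_iff)

lemma subspace_line: "fun_vs.subspace (range (\<lambda>c. fscale c u))"
proof (rule fun_vs.subspaceI)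
  show "0 \<in> range (\<lambda>c. fscale c u)"
    by (rule range_eqI[of _ _ 0]) (auto simp: fscale_def fun_eq_iff)
  show "x + y \<in> range (\<lambda>c. fscale c u)" if "x \<in> range (\<lambda>c. fscale c u)" "y \<in> range (\<lambda>c. fscale c u)" for x y
    using that fun_vs.scale_left_distrib by (metis (no_types, lifting) rangeE rangeI)
  show "fscale c x \<in> range (\<lambda>c. fscale c u)" if "x \<in> range (\<lambda>c. fscale c u)" for c x
    using that fun_vs.scale_scale by (metis (no_types, lifting) rangeE rangeI)
qed

text \<open>
  Test operads have to live in the universe \<open>'b \<Rightarrow> 'k\<close> of the envelope, so the field is embedded there
  as a line.
\<close>

definition modular_com :: "('k::field, 'b) operad_data" where
  "modular_com =
     \<lparr>op_space = (\<lambda>v. range line),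
      op_act = (\<lambda>v f a. a),
      op_comp = (\<lambda>\<Gamma> x. line (\<Prod>v\<in>verts \<Gamma>. x v undefined))\<rparr>"

lemma modular_com_simps [simp]:
  "op_space modular_com v = range line"
  "op_act modular_com v f a = a"
  "op_comp modular_com \<Gamma> x = line (\<Prod>v\<in>verts \<Gamma>. x v undefined)"
  by (simp_all add: modular_com_def)

text \<open>Associativity regroups the product over all vertices by the components of the contracted
  edges; \<open>inj_on_total_vertex\<close> is what keeps the factors apart.\<close>

lemma modular_operad_modular_com: "modular_operad (modular_com :: ('k::field, 'b) operad_data)"
  unfolding modular_operad_def
proof (unfold_locales, goal_cases)
  case (1 v)
  have "fun_vs.subspace (range (line :: 'k \<Rightarrow> 'b \<Rightarrow> 'k))"
  proof (rule fun_vs.subspaceI)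
    show "0 \<in> range (line :: 'k \<Rightarrow> 'b \<Rightarrow> 'k)"
      by (rule range_eqI[of _ _ 0]) (auto simp: line_def fun_eq_iff)
  qed (auto simp flip: line_add line_scale)
  then show ?case by simp
next
  case (8 \<Gamma> x v)
  have "(\<Prod>w\<in>verts \<Gamma>. (x(v := a)) w undefined)
          = a undefined * (\<Prod>w\<in>verts \<Gamma> - {v}. x w undefined)" for a
    using 8 stable_graphD(1) by (simp add: prod.remove[of _ v])
  then show ?case
    by (auto simp: linear_from_def line_def fun_eq_iff fscale_def algebra_simps)
next
  case (9 \<Gamma> x f)
  have inj: "inj_on (relabel_vertex f) (verts \<Gamma>)"
    by (rule inj_on_relabel_vertex) fact
  have "(\<Prod>w\<in>verts (relabel_graph f \<Gamma>). relabel_decoration modular_com f \<Gamma> x w undefined)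
          = (\<Prod>v\<in>verts \<Gamma>. x v undefined)"
    unfolding relabel_graph_simps prod.reindex[OF inj]
    by (rule prod.cong) (auto simp: relabel_decoration_def inv_into_f_f[OF inj])
  then show ?case by simp
next
  case (10 v x)
  then show ?case
    by (auto simp: decorations_def corolla_def PiE_def Pi_def)
next
  case (11 \<Gamma> x F)
  let ?t = "\<lambda>W. total_vertex (subgraph \<Gamma> F W)"
  have fin: "finite (verts \<Gamma>)" "\<And>W. W \<in> components \<Gamma> F \<Longrightarrow> finite W"
    using stable_graphD(1)[OF 11(1)] component_subset_verts finite_subset by metis+
  have "(\<Prod>w\<in>verts (contract \<Gamma> F). contract_decoration modular_com \<Gamma> F x w undefined)
          = (\<Prod>W\<in>components \<Gamma> F. contract_decoration modular_com \<Gamma> F x (?t W) undefined)"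
    by (simp add: contract_def prod.reindex[OF inj_on_total_vertex[OF 11(1,4)]])
  also have "\<dots> = (\<Prod>W\<in>components \<Gamma> F. \<Prod>v\<in>W. x v undefined)"
  proof (rule prod.cong)
    fix W assume W: "W \<in> components \<Gamma> F"
    then have "?t W \<in> verts (contract \<Gamma> F)"
      by (simp add: contract_def)
    then show "contract_decoration modular_com \<Gamma> F x (?t W) undefined = (\<Prod>v\<in>W. x v undefined)"
      by (simp add: contract_decoration_def component_over_total_vertex[OF 11(1,4) W])
  qed simp
  also have "\<dots> = (\<Prod>v\<in>\<Union> (components \<Gamma> F). x v undefined)"
    by (subst prod.Union_disjoint) (use fin(2) components_disjoint[of _ \<Gamma> F] in auto)
  finally show ?case
    by (simp add: Union_components)
qed (auto simp: linear_from_def)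

lemma cyclic_hom_modular_com:
  "cyclic_hom com_operad (modular_com :: ('k::field, 'b) operad_data) (\<lambda>v a. line (a ()))"
  unfolding cyclic_hom_def graph_operad_hom_def
proof (intro conjI allI impI)
  show "linear_from (op_space com_operad v) (\<lambda>a. line (a ()) :: 'b \<Rightarrow> 'k)" for v
    by (auto simp: linear_from_def line_def fun_eq_iff fscale_def)
qed (auto simp: com_operad_def intro!: arg_cong[of _ _ line])

section \<open>The modular envelope in genus at most one\<close>

text \<open>What remains of a genus one graph after contracting a spanning tree. Its composite is
  the self-gluing of a corolla with legs \<open>I\<close> along two extra flags, and will generate
  the genus one part.\<close>

definition loop_graph :: "nat \<Rightarrow> nat \<Rightarrow> nat set \<Rightarrow> graph" where
  "loop_graph a b I = \<lparr>verts = {(0, insert a (insert b I))}, edges = {{a, b}}\<rparr>"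

definition fresh_pair :: "nat \<Rightarrow> nat \<Rightarrow> nat set \<Rightarrow> bool" where
  "fresh_pair a b I \<longleftrightarrow> a \<noteq> b \<and> a \<notin> I \<and> b \<notin> I"

lemma fresh_pair_exists:
  assumes "finite I" obtains a b where "fresh_pair a b I"
proof -
  obtain a where "a \<notin> I"
    using ex_new_if_finite[OF infinite_UNIV_nat assms] by blast
  moreover obtain b where "b \<notin> insert a I"
    using ex_new_if_finite[OF infinite_UNIV_nat, of "insert a I"] assms by blast
  ultimately show ?thesis
    using that[of a b] by (auto simp: fresh_pair_def)
qed

lemma loop_graph_simps [simp]:
  "verts (loop_graph a b I) = {(0, insert a (insert b I))}"
  "edges (loop_graph a b I) = {{a, b}}"
  "flags (loop_graph a b I) = insert a (insert b I)"
  by (simp_all add: loop_graph_def flags_def)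

lemma stable_vertex_one: "stable_vertex (Suc 0, I) \<longleftrightarrow> finite I \<and> I \<noteq> {}"
  by (auto simp: stable_vertex_def card_gt_0_iff)

lemma loop_graph_stable:
  assumes "fresh_pair a b I" "stable_vertex (Suc 0, I)"
  shows "stable_graph (loop_graph a b I)"
proof -
  have "card (insert a (insert b I)) = 2 + card I" "card I > 0"
    using assms by (auto simp: fresh_pair_def stable_vertex_one card_gt_0_iff)
  then show ?thesis
    using assms by (auto simp: stable_graph_def stable_vertex_def fresh_pair_def)
qed

lemma loop_graph_total:
  assumes "fresh_pair a b I"
  shows "total_genus (loop_graph a b I) = 1" "total_vertex (loop_graph a b I) = (1, I)"
  using assms by (auto simp: total_vertex_def total_genus_def legs_def fresh_pair_def)

locale com_envelope =
  fixes M :: "('k::field, 'b) operad_data" and \<eta> :: "vertex \<Rightarrow> (unit \<Rightarrow> 'k) \<Rightarrow> ('b \<Rightarrow> 'k)"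
  assumes envelope: "modular_envelope com_operad M \<eta>"
begin

lemma operad: "graph_operad UNIV M"
  using envelope unfolding modular_envelope_def modular_operad_def by blast

sublocale M: graph_operad UNIV M
  by (rule operad)

lemma hom: "graph_operad_hom {0} com_operad M \<eta>"
  using envelope unfolding modular_envelope_def cyclic_hom_def by blast

definition eta :: "vertex \<Rightarrow> 'b \<Rightarrow> 'k" where
  "eta v = \<eta> v (\<lambda>_. 1)"

lemma eta_space: "stable_vertex v \<Longrightarrow> fst v = 0 \<Longrightarrow> eta v \<in> op_space M v"
proof -
  assume "stable_vertex v" "fst v = 0"
  then have "\<eta> v ` op_space com_operad v \<subseteq> op_space M v"
    using hom unfolding graph_operad_hom_def by blast
  then show ?thesis
    by (auto simp: com_operad_def eta_def)
qed

lemma eta_act: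
  assumes "stable_vertex v" "fst v = 0" "inj_on f (snd v)"
  shows "op_act M v f (eta v) = eta (relabel_vertex f v)"
proof -
  have "\<forall>v f a. stable_vertex v \<and> fst v \<in> {0} \<and> inj_on f (snd v) \<and> a \<in> op_space com_operad v \<longrightarrow>
        \<eta> (relabel_vertex f v) (op_act com_operad v f a) = op_act M v f (\<eta> v a)"
    using hom unfolding graph_operad_hom_def by blast
  from this[rule_format, of v f "\<lambda>_. 1"] show ?thesis
    using assms unfolding eta_def com_operad_def by simp
qed

lemma eta_scale:
  assumes "stable_vertex v" "fst v = 0"
  shows "\<eta> v a = fscale (a ()) (eta v)"
proof -
  have "linear_from (op_space com_operad v) (\<eta> v)"
    using hom assms unfolding graph_operad_hom_def by blast
  then have "\<eta> v (fscale (a ()) (\<lambda>_. 1)) = fscale (a ()) (eta v)"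
    unfolding linear_from_def eta_def com_operad_def by simp
  then show ?thesis
    by (simp add: fscale_def)
qed

definition composite :: "graph \<Rightarrow> 'b \<Rightarrow> 'k" where
  "composite \<Gamma> = op_comp M \<Gamma> (\<lambda>v\<in>verts \<Gamma>. eta v)"

definition genus_zero_verts :: "graph \<Rightarrow> bool" where
  "genus_zero_verts \<Gamma> \<longleftrightarrow> stable_graph \<Gamma> \<and> (\<forall>v\<in>verts \<Gamma>. fst v = 0)"

lemma eta_decoration: "genus_zero_verts \<Gamma> \<Longrightarrow> (\<lambda>v\<in>verts \<Gamma>. eta v) \<in> decorations M \<Gamma>"
  using eta_space stable_graphD(3) unfolding decorations_def genus_zero_verts_def by auto

lemma composite_space: "genus_zero_verts \<Gamma> \<Longrightarrow> composite \<Gamma> \<in> op_space M (total_vertex \<Gamma>)"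
  unfolding composite_def using M.comp_space eta_decoration
  by (auto simp: genus_zero_verts_def)

text \<open>In Com the composite of ones along a tree is one, and \<open>\<eta>\<close> respects
  composition along trees.\<close>

lemma composite_tree:
  assumes "genus_zero_verts \<Gamma>" "total_genus \<Gamma> = 0"
  shows "composite \<Gamma> = eta (total_vertex \<Gamma>)"
proof -
  have "\<forall>\<Gamma> x. stable_graph \<Gamma> \<and> total_genus \<Gamma> \<in> {0} \<and> x \<in> decorations com_operad \<Gamma> \<longrightarrow>
        \<eta> (total_vertex \<Gamma>) (op_comp com_operad \<Gamma> x) = op_comp M \<Gamma> (\<lambda>v\<in>verts \<Gamma>. \<eta> v (x v))"
    using hom unfolding graph_operad_hom_def by blast
  moreover have "(\<lambda>v\<in>verts \<Gamma>. (\<lambda>_. 1) :: unit \<Rightarrow> 'k) \<in> decorations com_operad \<Gamma>"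
    by (auto simp: decorations_def com_operad_def)
  ultimately have "\<eta> (total_vertex \<Gamma>) (op_comp com_operad \<Gamma> (\<lambda>v\<in>verts \<Gamma>. \<lambda>_. 1))
     = op_comp M \<Gamma> (\<lambda>v\<in>verts \<Gamma>. \<eta> v ((\<lambda>v\<in>verts \<Gamma>. \<lambda>_. 1) v))"
    using assms unfolding genus_zero_verts_def by blast
  moreover have "op_comp com_operad \<Gamma> (\<lambda>v\<in>verts \<Gamma>. \<lambda>_. 1) = (\<lambda>_. 1 :: 'k)"
    by (auto simp: com_operad_def)
  moreover have "(\<lambda>v\<in>verts \<Gamma>. \<eta> v ((\<lambda>v\<in>verts \<Gamma>. \<lambda>_. 1) v)) = (\<lambda>v\<in>verts \<Gamma>. eta v)"
    by (auto simp: eta_def)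
  ultimately show ?thesis
    unfolding composite_def by (simp add: eta_def[abs_def])
qed

lemma composite_relabel:
  assumes "genus_zero_verts \<Gamma>" "inj_on f (flags \<Gamma>)"
  shows "composite (relabel_graph f \<Gamma>) = op_act M (total_vertex \<Gamma>) f (composite \<Gamma>)"
proof -
  have \<Gamma>: "stable_graph \<Gamma>" "\<And>v. v \<in> verts \<Gamma> \<Longrightarrow> fst v = 0"
    using assms(1) unfolding genus_zero_verts_def by auto
  have "relabel_decoration M f \<Gamma> (\<lambda>v\<in>verts \<Gamma>. eta v) = (\<lambda>w\<in>verts (relabel_graph f \<Gamma>). eta w)"
  proof
    fix w
    show "relabel_decoration M f \<Gamma> (\<lambda>v\<in>verts \<Gamma>. eta v) w = (\<lambda>w\<in>verts (relabel_graph f \<Gamma>). eta w) w"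
    proof (cases "w \<in> verts (relabel_graph f \<Gamma>)")
      case True
      then obtain v where v: "v \<in> verts \<Gamma>" "w = relabel_vertex f v"
        by auto
      have "inv_into (verts \<Gamma>) (relabel_vertex f) w = v"
        using v inv_into_f_f[OF inj_on_relabel_vertex[OF assms(2)]] by simp
      then show ?thesis
        using v True eta_act[OF stable_graphD(3)[OF \<Gamma>(1) v(1)] \<Gamma>(2)[OF v(1)]
            inj_on_subset[OF assms(2) snd_subset_flags[OF v(1)]]]
        by (simp add: relabel_decoration_def)
    qed (simp add: relabel_decoration_def)
  qed
  then show ?thesis
    unfolding composite_def
    using M.comp_relabel[OF \<Gamma>(1) UNIV_I eta_decoration[OF assms(1)] assms(2)] by metis
qed

lemma genus_zero_verts_loop_graph:
  "fresh_pair a b I \<Longrightarrow> stable_vertex (Suc 0, I) \<Longrightarrow> genus_zero_verts (loop_graph a b I)"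
  using loop_graph_stable by (simp add: genus_zero_verts_def)

text \<open>Extending \<open>f\<close> by \<open>a \<mapsto> a'\<close> and
  \<open>b \<mapsto> b'\<close> gives an isomorphism of loop graphs, and the action depends only on
  the values on \<open>I\<close>. For \<open>f = id\<close> this shows that the flags forming the
  loop do not matter.\<close>

lemma composite_loop_graph_act:
  assumes "fresh_pair a b I" "fresh_pair a' b' (f ` I)" "stable_vertex (Suc 0, I)" "inj_on f I"
  shows "composite (loop_graph a' b' (f ` I)) = op_act M (1, I) f (composite (loop_graph a b I))"
proof -
  let ?f = "f(a := a', b := b')" and ?\<Gamma> = "loop_graph a b I"
  have I: "?f ` I = f ` I" "\<forall>i\<in>I. ?f i = f i"
    using assms(1) by (auto simp: fresh_pair_def)
  have inj: "inj_on ?f (flags ?\<Gamma>)"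
    using assms(1,2,4) by (auto simp: fresh_pair_def inj_on_def)
  have "relabel_graph ?f ?\<Gamma> = loop_graph a' b' (f ` I)"
    using I assms(1,2) by (intro graph_eqI) (auto simp: relabel_vertex_def fresh_pair_def)
  moreover have "op_act M (1, I) ?f (composite ?\<Gamma>) = op_act M (1, I) f (composite ?\<Gamma>)"
    using composite_space[OF genus_zero_verts_loop_graph[OF assms(1,3)]] assms(3)
      inj_on_subset[OF inj, of I] I loop_graph_total(2)[OF assms(1)]
    by (intro M.act_cong) auto
  ultimately show ?thesis
    using composite_relabel[OF genus_zero_verts_loop_graph[OF assms(1,3)] inj]
      loop_graph_total(2)[OF assms(1)] by simp
qed

lemma composite_loop_graph_eq:
  assumes "fresh_pair a b I" "fresh_pair a' b' I" "stable_vertex (Suc 0, I)"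
  shows "composite (loop_graph a' b' I) = composite (loop_graph a b I)"
proof -
  have "composite (loop_graph a' b' I) = op_act M (1, I) id (composite (loop_graph a b I))"
    using composite_loop_graph_act[OF assms(1) _ assms(3), of a' b' id] assms(2) by simp
  then show ?thesis
    using M.act_id[of "(1, I)" "composite (loop_graph a b I)"] assms(3)
      composite_space[OF genus_zero_verts_loop_graph[OF assms(1,3)]] loop_graph_total(2)[OF assms(1)]
    by simp
qed

text \<open>In genus one all composites agree: contracting a spanning tree leaves a single loop.\<close>

lemma composite_genus_one:
  assumes "genus_zero_verts \<Gamma>" "total_genus \<Gamma> = 1"
  obtains a b where "fresh_pair a b (legs \<Gamma>)" "composite \<Gamma> = composite (loop_graph a b (legs \<Gamma>))"
proof -
  have \<Gamma>: "stable_graph \<Gamma>" "\<And>v. v \<in> verts \<Gamma> \<Longrightarrow> fst v = 0"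
    using assms(1) unfolding genus_zero_verts_def by auto
  obtain F where F: "F \<subseteq> edges \<Gamma>" "card F + 1 = card (verts \<Gamma>)"
    and conn: "\<And>v w. v \<in> verts \<Gamma> \<Longrightarrow> w \<in> verts \<Gamma> \<Longrightarrow> (v, w) \<in> (joined \<Gamma> F)\<^sup>*"
    using spanning_tree[OF \<Gamma>(1)] by metis
  \<comment> \<open>All vertices have genus zero, so there is one independent cycle and the spanning
    tree misses exactly one edge.\<close>
  have "card (edges \<Gamma>) = card (verts \<Gamma>)"
    using total_genus_eq_iff[OF \<Gamma>(1), of 1] assms(2) \<Gamma>(2) by simp
  then have "card (edges \<Gamma> - F) = 1"
    using F card_Diff_subset[OF finite_subset[OF F(1) finite_edges[OF \<Gamma>(1)]] F(1)] by simp
  then obtain e where e: "edges \<Gamma> - F = {e}"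
    by (auto simp: card_1_singleton_iff)
  then have e_edge: "e \<in> edges \<Gamma>" "e \<notin> F" by blast+
  obtain a b where ab: "e = {a, b}" "a \<noteq> b"
    using stable_graphD(5)[OF \<Gamma>(1) e_edge(1)] by (auto simp: card_2_iff)
  define \<Delta> where "\<Delta> = subgraph \<Gamma> F (verts \<Gamma>)"
  have \<Delta>: "verts \<Delta> = verts \<Gamma>" "edges \<Delta> = F" "flags \<Delta> = flags \<Gamma>"
    using stable_graphD(6)[OF \<Gamma>(1)] F(1) by (auto simp: \<Delta>_def flags_def)
  have "joined \<Delta> F = joined \<Gamma> F"
    unfolding joined_def \<Delta> by simp
  then have \<Delta>_stable: "genus_zero_verts \<Delta>"
    unfolding genus_zero_verts_def stable_graph_def \<Delta>
    using stable_graphD[OF \<Gamma>(1)] \<Gamma>(2) F(1) conn by (auto simp: subset_iff)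
  have edges: "edges \<Gamma> = insert {a, b} F"
    using e e_edge F(1) ab by blast
  have disj: "e \<inter> \<Union> F = {}"
    using stable_graphD(7)[OF \<Gamma>(1) e_edge(1)] F(1) e_edge(2) by blast
  have \<Delta>_genus: "total_genus \<Delta> = 0"
    using total_genus_eq_iff[of \<Delta> 0] \<Delta>_stable F(2) unfolding genus_zero_verts_def by (simp add: \<Delta>)
  \<comment> \<open>Cutting the remaining edge turns its two flags into legs of the spanning tree;
    they form the loop of the contracted graph.\<close>
  have \<Delta>_legs: "legs \<Delta> = insert a (insert b (legs \<Gamma>))" and fresh: "fresh_pair a b (legs \<Gamma>)"
    using disj stable_graphD(6)[OF \<Gamma>(1) e_edge(1)] ab
    unfolding legs_def \<Delta> edges by (auto simp: fresh_pair_def)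
  obtain v0 where v0: "v0 \<in> verts \<Gamma>"
    using stable_graphD(2)[OF \<Gamma>(1)] by blast
  have cls: "(joined \<Gamma> F)\<^sup>* `` {v} = verts \<Gamma>" if "v \<in> verts \<Gamma>" for v
    using that by (metis Image_singleton_iff conn joined_rtrancl_verts set_eqI)
  have comps: "components \<Gamma> F = {verts \<Gamma>}"
    unfolding components_def quotient_def using cls v0 by auto
  have contract: "contract \<Gamma> F = loop_graph a b (legs \<Gamma>)"
    using e ab unfolding contract_def comps by (simp add: loop_graph_def total_vertex_def \<Delta>_genus
        \<Delta>_legs flip: \<Delta>_def)
  let ?x = "\<lambda>v\<in>verts \<Gamma>. eta v"
  have "contract_decoration M \<Gamma> F ?x = (\<lambda>w\<in>verts (loop_graph a b (legs \<Gamma>)). eta w)"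
  proof
    fix w
    show "contract_decoration M \<Gamma> F ?x w = (\<lambda>w\<in>verts (loop_graph a b (legs \<Gamma>)). eta w) w"
    proof (cases "w \<in> verts (contract \<Gamma> F)")
      case True
      then have w: "w = total_vertex \<Delta>"
        unfolding contract_def comps by (simp add: \<Delta>_def)
      have "component_over \<Gamma> F w = verts \<Gamma>"
        unfolding w \<Delta>_def by (rule component_over_total_vertex[OF \<Gamma>(1) F(1)]) (simp add: comps)
      then have "contract_decoration M \<Gamma> F ?x w = composite \<Delta>"
        using True by (simp add: contract_decoration_def composite_def \<Delta> flip: \<Delta>_def)
      also have "\<dots> = eta w"
        unfolding w by (rule composite_tree[OF \<Delta>_stable \<Delta>_genus])
      finally show ?thesis
        using True contract by simp
    next
      case False
      then show ?thesis
        unfolding contract[symmetric] by (simp add: contract_decoration_def)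
    qed
  qed
  then have "composite \<Gamma> = composite (loop_graph a b (legs \<Gamma>))"
    using M.comp_assoc[OF \<Gamma>(1) UNIV_I eta_decoration[OF assms(1)] F(1)]
    unfolding composite_def contract by metis
  then show ?thesis
    using that fresh by blast
qed

end

section \<open>Expanding a vertex of genus one into a vertex with a loop\<close>

definition attach_loop :: "nat \<Rightarrow> nat \<Rightarrow> vertex \<Rightarrow> vertex" where
  "attach_loop a b v = (if fst v = 1 then (0, insert a (insert b (snd v))) else v)"

lemma attach_loop_Int:
  assumes "fresh_pair a b I" "snd v \<subseteq> I"
  shows "snd (attach_loop a b v) \<inter> I = snd v"
  using assms by (auto simp: attach_loop_def fresh_pair_def)

lemma subset_Id_rtrancl:
  assumes "r \<subseteq> Id"
  shows "r\<^sup>* = Id"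
proof -
  have "r\<^sup>* \<subseteq> Id\<^sup>*"
    by (rule rtrancl_mono[OF assms])
  moreover have "Id\<^sup>* = (Id :: ('a \<times> 'a) set)"
    using rtrancl_reflcl[of "{}"] by simp
  ultimately show ?thesis
    by auto
qed

text \<open>A genus one graph with a vertex \<open>w\<close> of genus one is the contraction of a
  graph whose vertices all have genus zero: \<open>w\<close> trades its genus for a loop on the new
  flags \<open>a\<close> and \<open>b\<close>. Associativity then turns composites along
  \<open>\<Gamma>\<close> into composites of elements coming from Com.\<close>

locale loop_expansion =
  fixes \<Gamma> :: graph and w :: vertex and a b :: nat
  assumes stable_\<Gamma>: "stable_graph \<Gamma>"
    and tree: "w \<in> verts \<Gamma>" "fst w = 1" "\<And>v. v \<in> verts \<Gamma> \<Longrightarrow> v \<noteq> w \<Longrightarrow> fst v = 0"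
      "card (edges \<Gamma>) + 1 = card (verts \<Gamma>)"
    and ab: "fresh_pair a b (flags \<Gamma>)"
begin

lemma ab_fresh: "a \<noteq> b" "a \<notin> flags \<Gamma>" "b \<notin> flags \<Gamma>"
  using ab unfolding fresh_pair_def by auto

definition expand :: "vertex \<Rightarrow> vertex" where "expand = attach_loop a b"

definition expanded :: graph where
  "expanded = \<lparr>verts = expand ` verts \<Gamma>, edges = insert {a, b} (edges \<Gamma>)\<rparr>"

lemma expanded: "verts expanded = expand ` verts \<Gamma>" "edges expanded = insert {a, b} (edges \<Gamma>)"
  by (simp_all add: expanded_def)

lemma expand_w: "expand w = (0, insert a (insert b (snd w)))"
  using tree(2) by (simp add: expand_def attach_loop_def)

lemma expand_other: "expand v = v" if "v \<in> verts \<Gamma>" "v \<noteq> w" for v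
  using tree(3)[OF that] by (simp add: expand_def attach_loop_def)

lemma Int: "snd (expand v) \<inter> flags \<Gamma> = snd v" if "v \<in> verts \<Gamma>" for v
  unfolding expand_def by (rule attach_loop_Int[OF ab snd_subset_flags[OF that]])

lemma inj: "inj_on expand (verts \<Gamma>)"
proof (rule inj_onI)
  fix v v' assume *: "v \<in> verts \<Gamma>" "v' \<in> verts \<Gamma>" "expand v = expand v'"
  have "a \<in> snd (expand u) \<longleftrightarrow> u = w" if "u \<in> verts \<Gamma>" for u
    using expand_other[OF that] expand_w snd_subset_flags[OF that] ab_fresh by (cases "u = w") auto
  then have "v = w \<longleftrightarrow> v' = w"
    using * by metis
  then show "v = v'"
    using expand_other * by (cases "v = w") simp_all
qed

lemma edge_flags: "e \<subseteq> flags \<Gamma>" if "e \<in> edges \<Gamma>" for e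
  using stable_graphD(6)[OF stable_\<Gamma> that] .

lemma flags_expanded: "flags expanded = insert a (insert b (flags \<Gamma>))"
proof -
  have "flags expanded = (\<Union>v\<in>verts \<Gamma>. snd (expand v))"
    by (simp add: flags_def expanded)
  also have "\<dots> = snd (expand w) \<union> (\<Union>v\<in>verts \<Gamma> - {w}. snd (expand v))"
    using tree(1) by auto
  also have "\<dots> = insert a (insert b (snd w \<union> (\<Union>v\<in>verts \<Gamma> - {w}. snd v)))"
    using expand_other by (auto simp: expand_w)
  also have "snd w \<union> (\<Union>v\<in>verts \<Gamma> - {w}. snd v) = flags \<Gamma>"
    using tree(1) by (auto simp: flags_def)
  finally show ?thesis .
qed

lemma fst_expand: "fst (expand v) = 0" if "v \<in> verts \<Gamma>" for v
  using expand_w expand_other tree(3) that by (cases "v = w") auto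

lemma fst_zero: "v \<in> verts expanded \<Longrightarrow> fst v = 0"
  unfolding expanded by (erule imageE) (simp add: fst_expand)

lemma stable_w: "stable_vertex (Suc 0, snd w)"
  using stable_graphD(3)[OF stable_\<Gamma> tree(1)] tree(2) by (simp add: stable_vertex_def)

lemma stable: "stable_graph expanded"
  unfolding stable_graph_def
proof (intro conjI ballI impI)
  show "finite (verts expanded)" "verts expanded \<noteq> {}"
    using stable_graphD(1,2)[OF stable_\<Gamma>] by (auto simp: expanded)
  show "stable_vertex v" if v: "v \<in> verts expanded" for v
  proof -
    obtain u where u: "u \<in> verts \<Gamma>" "v = expand u"
      using v expanded(1) by blast
    show ?thesis
    proof (cases "u = w")
      case True
      have "insert a (insert b (snd w)) - snd w \<supseteq> {a, b}"
        using ab_fresh snd_subset_flags[OF tree(1)] by auto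
      moreover have "card {a, b} = 2"
        using ab_fresh by simp
      moreover have "finite (snd w)" "card (snd w) > 0"
        using stable_w by (auto simp: stable_vertex_one card_gt_0_iff)
      moreover have "a \<notin> snd w" "b \<notin> snd w"
        using ab_fresh snd_subset_flags[OF tree(1)] by auto
      ultimately show ?thesis
        using u True ab_fresh by (simp add: expand_w stable_vertex_def)
    next
      case False
      then show ?thesis
        using u expand_other stable_graphD(3)[OF stable_\<Gamma>] by simp
    qed
  qed
  show "snd v \<inter> snd v' = {}" if vv: "v \<in> verts expanded" "v' \<in> verts expanded" "v \<noteq> v'" for v v'
  proof -
    obtain u u' where u: "u \<in> verts \<Gamma>" "v = expand u" "u' \<in> verts \<Gamma>" "v' = expand u'"
      using vv expanded(1) by blast
    then have neq: "u \<noteq> u'"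
      using vv(3) by blast
    have "snd (expand x) = (if x = w then insert a (insert b (snd x)) else snd x)" if "x \<in> verts \<Gamma>" for x
      using expand_other[OF that] expand_w by simp
    moreover have "a \<notin> snd x" "b \<notin> snd x" if "x \<in> verts \<Gamma>" for x
      using snd_subset_flags[OF that] ab_fresh by blast+
    ultimately show ?thesis
      using u(1,3) neq stable_graphD(4)[OF stable_\<Gamma> u(1,3) neq]
      unfolding u(2,4) by auto
  qed
  show "card e = 2" "e \<subseteq> flags expanded" if "e \<in> edges expanded" for e
    using that stable_graphD(5)[OF stable_\<Gamma>] edge_flags ab_fresh unfolding expanded flags_expanded by auto
  show "e \<inter> e' = {}" if "e \<in> edges expanded" "e' \<in> edges expanded" "e \<noteq> e'" for e e'
    using that stable_graphD(7)[OF stable_\<Gamma>] edge_flags ab_fresh unfolding expanded by blast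
  show "(v, v') \<in> (joined expanded (edges expanded))\<^sup>*" if vv: "v \<in> verts expanded" "v' \<in> verts expanded" for v v'
  proof (rule connectedI[OF _ vv])
    fix T assume T: "T \<subseteq> verts expanded" "T \<noteq> {}"
      and closed: "\<And>v v'. v \<in> T \<Longrightarrow> (v, v') \<in> joined expanded (edges expanded) \<Longrightarrow> v' \<in> T"
    obtain u where u: "u \<in> verts \<Gamma>" "expand u \<in> T"
      using T unfolding expanded by blast
    \<comment> \<open>The preimage of \<open>T\<close> under \<open>expand\<close> is closed in
      \<open>\<Gamma>\<close>, because by \<open>Int\<close> an old edge still meets
      \<open>expand x\<close> where it met \<open>x\<close>.\<close>
    have step: "expand y \<in> T" if xy: "expand x \<in> T" "(x, y) \<in> joined \<Gamma> (edges \<Gamma>)" for x y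
    proof (rule closed[OF xy(1)])
      obtain e where e: "x \<in> verts \<Gamma>" "y \<in> verts \<Gamma>" "e \<in> edges \<Gamma>" "e \<inter> snd x \<noteq> {}" "e \<inter> snd y \<noteq> {}"
        using xy(2) unfolding joined_def by blast
      then have "e \<inter> snd (expand x) \<noteq> {}" "e \<inter> snd (expand y) \<noteq> {}"
        using Int by blast+
      then show "(expand x, expand y) \<in> joined expanded (edges expanded)"
        using e(1-3) unfolding joined_def expanded by blast
    qed
    have "expand y \<in> T" if "y \<in> verts \<Gamma>" for y
      using closed_rtrancl[OF stable_graphD(8)[OF stable_\<Gamma> u(1) that], of "{x. expand x \<in> T}"] u(2) step
      by simp
    then show "verts expanded \<subseteq> T"
      unfolding expanded by blast
  qed
qed

lemma new_edge: "{a, b} \<notin> edges \<Gamma>"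
  using edge_flags ab_fresh by blast

lemma genus_expanded: "total_genus expanded = 1"
proof -
  have "card (edges expanded) = card (verts expanded)"
    unfolding expanded using new_edge finite_edges[OF stable_\<Gamma>] tree(4) by (simp add: card_image[OF inj])
  then show ?thesis
    using total_genus_eq_iff[OF stable, of 1] fst_zero by simp
qed

lemma legs_expanded: "legs expanded = legs \<Gamma>"
  unfolding legs_def flags_expanded expanded using ab_fresh by auto

lemma sub: "{{a, b}} \<subseteq> edges expanded"
  by (simp add: expanded)

lemma only_w:
  assumes "v \<in> verts expanded" "{a, b} \<inter> snd v \<noteq> {}"
  shows "v = expand w"
proof -
  obtain u where u: "u \<in> verts \<Gamma>" "v = expand u"
    using assms(1) unfolding expanded by blast
  then show ?thesis
    using assms(2) expand_other[OF u(1)] snd_subset_flags[OF u(1)] ab_fresh by (cases "u = w") auto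
qed

text \<open>The loop meets no vertex but \<open>expand w\<close>, so contracting it merges no
  vertices.\<close>

lemma comps: "components expanded {{a, b}} = (\<lambda>v. {expand v}) ` verts \<Gamma>"
proof -
  have "joined expanded {{a, b}} \<subseteq> Id"
  proof (rule subsetI)
    fix p assume "p \<in> joined expanded {{a, b}}"
    then obtain v v' where "p = (v, v')" "v \<in> verts expanded" "v' \<in> verts expanded"
      "{a, b} \<inter> snd v \<noteq> {}" "{a, b} \<inter> snd v' \<noteq> {}"
      unfolding joined_def by blast
    then show "p \<in> Id"
      using only_w by blast
  qed
  then have "(joined expanded {{a, b}})\<^sup>* = Id"
    by (rule subset_Id_rtrancl)
  then show ?thesis
    unfolding components_def expanded quotient_def by auto
qed

lemma subgraph_w: "subgraph expanded {{a, b}} {expand w} = loop_graph a b (snd w)"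
  by (rule graph_eqI) (auto simp: expand_w)

lemma fresh_w: "fresh_pair a b (snd w)"
  using ab_fresh snd_subset_flags[OF tree(1)] by (auto simp: fresh_pair_def)

lemma subgraph_other: "verts (subgraph expanded {{a, b}} {expand v}) = {v}"
  "edges (subgraph expanded {{a, b}} {expand v}) = {}" if "v \<in> verts \<Gamma>" "v \<noteq> w" for v
  using expand_other[OF that] snd_subset_flags[OF that(1)] ab_fresh by auto

lemma total: "total_vertex (subgraph expanded {{a, b}} {expand v}) = v" if "v \<in> verts \<Gamma>" for v
proof (cases "v = w")
  case True
  show ?thesis
    unfolding True subgraph_w loop_graph_total(2)[OF fresh_w] using tree(2) by (simp add: prod_eq_iff)
next
  case False
  let ?s = "subgraph expanded {{a, b}} {expand v}"
  have "legs ?s = snd v"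
    unfolding legs_def flags_def subgraph_other[OF that False] by simp
  moreover have "total_genus ?s = 0"
    unfolding total_genus_def subgraph_other[OF that False] using tree(3)[OF that False] by simp
  ultimately show ?thesis
    using tree(3)[OF that False] by (simp add: total_vertex_def prod_eq_iff del: subgraph_simps)
qed

lemma contract: "contract expanded {{a, b}} = \<Gamma>"
  unfolding contract_def comps using total new_edge
  by (intro graph_eqI) (simp_all add: image_image expanded)

end

section \<open>Generators of the envelope in genus zero and one\<close>

context com_envelope begin

text \<open>The image of the unit of Com in genus zero and the loop composite in genus one. The
  choice of the loop flags is immaterial by \<open>composite_loop_graph_eq\<close>. In higher genus
  the value is a dummy.\<close>

definition generator :: "vertex \<Rightarrow> 'b \<Rightarrow> 'k" where
  "generator v = (if fst v = 0 then eta v else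
     let p = SOME p. fresh_pair (fst p) (snd p) (snd v) in composite (loop_graph (fst p) (snd p) (snd v)))"

lemma generator_zero: "fst v = 0 \<Longrightarrow> generator v = eta v"
  by (simp add: generator_def)

lemma generator_one:
  assumes "stable_vertex (Suc 0, I)" "fresh_pair a b I"
  shows "generator (Suc 0, I) = composite (loop_graph a b I)"
proof -
  have "fresh_pair (fst (a, b)) (snd (a, b)) I"
    using assms(2) by simp
  then have "fresh_pair (fst p) (snd p) I" if "p = (SOME p. fresh_pair (fst p) (snd p) I)" for p
    unfolding that by (rule someI)
  then show ?thesis
    using composite_loop_graph_eq[OF assms(2) _ assms(1)] unfolding generator_def by (simp add: Let_def)
qed

lemma genus_cases:
  assumes "fst (v :: vertex) \<le> 1"
  obtains "fst v = 0" | I where "v = (Suc 0, I)"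
proof (cases "fst v = 0")
  case False
  then have "v = (Suc 0, snd v)"
    using assms by (simp add: prod_eq_iff)
  then show ?thesis
    by (rule that(2))
qed (rule that(1))

lemma generator_space:
  assumes "stable_vertex v" "fst v \<le> 1"
  shows "generator v \<in> op_space M v"
  using assms(2)
proof (cases rule: genus_cases)
  case 1
  then show ?thesis
    using eta_space assms(1) by (simp add: generator_zero)
next
  case (2 I)
  then have I: "stable_vertex (Suc 0, I)" "finite I"
    using assms(1) by (auto simp: stable_vertex_def)
  obtain a b where ab: "fresh_pair a b I"
    by (rule fresh_pair_exists[OF I(2)])
  show ?thesis
    using composite_space[OF genus_zero_verts_loop_graph[OF ab I(1)]] loop_graph_total(2)[OF ab]
    unfolding 2 generator_one[OF I(1) ab] by simp
qed

lemma generator_act: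
  assumes "stable_vertex v" "fst v \<le> 1" "inj_on f (snd v)"
  shows "op_act M v f (generator v) = generator (relabel_vertex f v)"
  using assms(2)
proof (cases rule: genus_cases)
  case 1
  then show ?thesis
    using eta_act assms(1,3) by (simp add: generator_zero)
next
  case (2 I)
  then have I: "stable_vertex (Suc 0, I)" "finite I" "inj_on f I"
    using assms(1,3) by (auto simp: stable_vertex_def)
  obtain a b where ab: "fresh_pair a b I"
    by (rule fresh_pair_exists[OF I(2)])
  obtain a' b' where ab': "fresh_pair a' b' (f ` I)"
    by (rule fresh_pair_exists[OF finite_imageI[OF I(2)]])
  have "stable_vertex (Suc 0, f ` I)"
    using I(1) by (simp add: stable_vertex_one)
  then show ?thesis
    using composite_loop_graph_act[OF ab ab' I(1,3)]
    unfolding 2 generator_one[OF I(1) ab] by (simp add: relabel_vertex_def generator_one[OF _ ab'])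
qed

text \<open>Closure of the generators under composition. A tree is handled by \<open>\<eta>\<close>,
  a graph with a cycle by comparison with the loop graph. If there is a vertex of genus one, its
  generator is itself a composite along a loop, and associativity replaces \<open>\<Gamma>\<close>
  by the expanded graph, which falls under the cycle case.\<close>

lemma generator_comp:
  assumes "stable_graph \<Gamma>" "total_genus \<Gamma> \<le> 1"
  shows "op_comp M \<Gamma> (\<lambda>v\<in>verts \<Gamma>. generator v) = generator (total_vertex \<Gamma>)"
proof -
  have composite_eq: "op_comp M \<Gamma> (\<lambda>v\<in>verts \<Gamma>. generator v) = composite \<Gamma>"
    if "\<And>v. v \<in> verts \<Gamma> \<Longrightarrow> fst v = 0" for \<Gamma>
    unfolding composite_def
    by (rule arg_cong[of _ _ "op_comp M \<Gamma>"], rule restrict_ext) (simp add: generator_zero that)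
  have one: "composite \<Gamma> = generator (1, legs \<Gamma>)"
    if *: "genus_zero_verts \<Gamma>" "total_genus \<Gamma> = 1" for \<Gamma>
  proof -
    obtain a b where ab: "fresh_pair a b (legs \<Gamma>)" "composite \<Gamma> = composite (loop_graph a b (legs \<Gamma>))"
      by (rule composite_genus_one[OF *])
    have "stable_vertex (Suc 0, legs \<Gamma>)"
      using stable_total_vertex[of \<Gamma>] * by (simp add: genus_zero_verts_def total_vertex_def)
    then show ?thesis
      using generator_one[OF _ ab(1)] ab(2) by simp
  qed
  show ?thesis
  proof (cases "total_genus \<Gamma> = 0")
    case True
    then have zero: "\<And>v. v \<in> verts \<Gamma> \<Longrightarrow> fst v = 0"
      using genus_le_total_genus[OF assms(1)] by fastforce
    have "composite \<Gamma> = eta (total_vertex \<Gamma>)"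
      using zero assms(1) True by (intro composite_tree) (auto simp: genus_zero_verts_def)
    then show ?thesis
      using composite_eq[OF zero] True by (simp add: generator_zero total_vertex_def)
  next
    case False
    then have genus: "total_genus \<Gamma> = 1"
      using assms(2) by linarith
    from assms(1) genus show ?thesis
    proof (cases rule: genus_one_cases)
      case cycle
      then have "genus_zero_verts \<Gamma>"
        using assms(1) by (simp add: genus_zero_verts_def)
      then show ?thesis
        using composite_eq[OF cycle(1)] one genus by (simp add: total_vertex_def)
    next
      case (tree w)
      obtain a b where ab: "fresh_pair a b (flags \<Gamma>)"
        by (rule fresh_pair_exists[OF finite_flags[OF assms(1)]])
      interpret loop_expansion \<Gamma> w a b
        by (rule loop_expansion.intro[OF assms(1) tree ab])
      have zero_verts: "genus_zero_verts expanded"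
        using stable fst_zero unfolding genus_zero_verts_def by blast
      let ?x = "\<lambda>v\<in>verts expanded. eta v"
      \<comment> \<open>Every component of the contracted loop is a single vertex: at
        \<open>w\<close> it is a loop graph, elsewhere a corolla. In both cases its composite is the
        generator.\<close>
      have "contract_decoration M expanded {{a, b}} ?x = (\<lambda>v\<in>verts \<Gamma>. generator v)"
      proof
        fix v
        show "contract_decoration M expanded {{a, b}} ?x v = (\<lambda>v\<in>verts \<Gamma>. generator v) v"
        proof (cases "v \<in> verts \<Gamma>")
          case True
          have "component_over expanded {{a, b}} (total_vertex (subgraph expanded {{a, b}} {expand v})) = {expand v}"
            by (rule component_over_total_vertex[OF stable sub]) (use comps True in blast)
          then have over: "component_over expanded {{a, b}} v = {expand v}"
            by (simp add: total[OF True])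
          have "restrict ?x {expand v} = (\<lambda>u\<in>{expand v}. eta u)"
            using True by (auto simp: expanded fun_eq_iff)
          then have "contract_decoration M expanded {{a, b}} ?x v = composite (subgraph expanded {{a, b}} {expand v})"
            using True by (simp add: contract_decoration_def contract over composite_def Let_def)
          also have "\<dots> = generator v"
          proof (cases "v = w")
            case True
            have "w = (Suc 0, snd w)"
              using tree(2) by (simp add: prod_eq_iff)
            then show ?thesis
              using generator_one[OF stable_w fresh_w] subgraph_w True by metis
          next
            case False
            let ?s = "subgraph expanded {{a, b}} {expand v}"
            have "genus_zero_verts ?s"
              using subgraph_other[OF \<open>v \<in> verts \<Gamma>\<close> False] stable_graphD(3)[OF assms(1) \<open>v \<in> verts \<Gamma>\<close>]
                tree(3)[OF \<open>v \<in> verts \<Gamma>\<close> False]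
              by (simp add: genus_zero_verts_def stable_graph_def del: subgraph_simps)
            moreover have "total_genus ?s = 0"
              using total[OF \<open>v \<in> verts \<Gamma>\<close>] tree(3)[OF \<open>v \<in> verts \<Gamma>\<close> False]
              by (metis fst_conv total_vertex_def)
            ultimately show ?thesis
              using composite_tree total[OF \<open>v \<in> verts \<Gamma>\<close>] tree(3)[OF \<open>v \<in> verts \<Gamma>\<close> False]
              by (simp add: generator_zero del: subgraph_simps)
          qed
          finally show ?thesis
            using True by simp
        next
          case False
          then show ?thesis
            by (simp add: contract_decoration_def contract)
        qed
      qed
      then have "op_comp M \<Gamma> (\<lambda>v\<in>verts \<Gamma>. generator v) = composite expanded"
        using M.comp_assoc[OF stable UNIV_I eta_decoration[OF zero_verts] sub]
        unfolding composite_def contract by metis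
      also have "\<dots> = generator (total_vertex \<Gamma>)"
        using one[OF zero_verts genus_expanded] genus legs_expanded by (simp add: total_vertex_def)
      finally show ?thesis .
    qed
  qed
qed

end

section \<open>Dimension of the envelope in genus zero and one\<close>

context com_envelope begin

text \<open>
  By the universal property \<open>M\<close> maps to this suboperad, and composing with the inclusion gives the
  identity; hence \<open>M\<close> is at most one-dimensional in genus at most one. Nothing is claimed about higher
  genera, where the suboperad is all of \<open>M\<close>.
\<close>

definition generated :: "('k, 'b) operad_data" where
  "generated = M\<lparr>op_space := (\<lambda>v. if fst v \<le> 1 then range (\<lambda>c. fscale c (generator v)) else op_space M v)\<rparr>"

lemma generated_simps [simp]:
  "op_act generated = op_act M" "op_comp generated = op_comp M"
  "op_space generated v = (if fst v \<le> 1 then range (\<lambda>c. fscale c (generator v)) else op_space M v)"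
  by (simp_all add: generated_def)

lemma scale_generator_space:
  "stable_vertex v \<Longrightarrow> fst v \<le> 1 \<Longrightarrow> fscale c (generator v) \<in> op_space M v"
  using M.subspace_space[of v] generator_space by (simp add: fun_vs.subspace_scale)

lemma generated_subset: "stable_vertex v \<Longrightarrow> op_space generated v \<subseteq> op_space M v"
proof
  fix a assume v: "stable_vertex v" and a: "a \<in> op_space generated v"
  show "a \<in> op_space M v"
  proof (cases "fst v \<le> 1")
    case True
    then obtain c where "a = fscale c (generator v)"
      using a by auto
    then show ?thesis
      using scale_generator_space[OF v True] by simp
  qed (use a in simp)
qed

lemma generated_decorations: "stable_graph \<Gamma> \<Longrightarrow> decorations generated \<Gamma> \<subseteq> decorations M \<Gamma>"
  unfolding decorations_def using generated_subset stable_graphD(3) by (intro PiE_mono) blast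

text \<open>Multilinearity is available one vertex at a time, so the set \<open>S\<close> of
  vertices already scaled grows by induction while the others keep the factor one.\<close>

lemma op_comp_scale:
  assumes "stable_graph \<Gamma>" "y \<in> decorations M \<Gamma>" "S \<subseteq> verts \<Gamma>"
  shows "op_comp M \<Gamma> (\<lambda>v\<in>verts \<Gamma>. fscale (if v \<in> S then c v else 1) (y v))
           = fscale (\<Prod>v\<in>S. c v) (op_comp M \<Gamma> y)"
  using finite_subset[OF assms(3) stable_graphD(1)[OF assms(1)]] assms(3)
proof (induction S rule: finite_induct)
  case empty
  have "(\<lambda>v\<in>verts \<Gamma>. y v) = y"
    using assms(2) unfolding decorations_def by (simp add: PiE_restrict)
  then show ?case
    by (simp add: fscale_def)
next
  case (insert w S)
  let ?x = "\<lambda>v\<in>verts \<Gamma>. fscale (if v \<in> S then c v else 1) (y v)"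
  have y: "y v \<in> op_space M v" if "v \<in> verts \<Gamma>" for v
    using assms(2) that unfolding decorations_def by blast
  have "fscale d (y v) \<in> op_space M v" if "v \<in> verts \<Gamma>" for v d
    using M.subspace_space[OF stable_graphD(3)[OF assms(1) that] UNIV_I] y[OF that]
    by (simp add: fun_vs.subspace_scale)
  then have x: "?x \<in> decorations M \<Gamma>"
    unfolding decorations_def by auto
  have w: "w \<in> verts \<Gamma>"
    using insert by simp
  have lin: "linear_from (op_space M w) (\<lambda>a. op_comp M \<Gamma> (?x(w := a)))"
    by (rule M.comp_multilinear[OF assms(1) UNIV_I x w])
  have xw: "?x(w := y w) = ?x"
    using insert.hyps(2) w by (auto simp: fun_eq_iff fscale_def)
  have "(\<lambda>v\<in>verts \<Gamma>. fscale (if v \<in> insert w S then c v else 1) (y v)) = ?x(w := fscale (c w) (y w))"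
    using w by (auto simp: fun_eq_iff)
  then have "op_comp M \<Gamma> (\<lambda>v\<in>verts \<Gamma>. fscale (if v \<in> insert w S then c v else 1) (y v))
      = fscale (c w) (op_comp M \<Gamma> (?x(w := y w)))"
    using lin y[OF w] unfolding linear_from_def by simp
  also have "\<dots> = fscale (c w) (fscale (\<Prod>v\<in>S. c v) (op_comp M \<Gamma> y))"
    unfolding xw
    by (rule arg_cong[of _ _ "fscale (c w)"], rule insert.IH) (use insert.prems in blast)
  finally show ?case
    by (simp only: fun_vs.scale_scale prod.insert[OF insert.hyps])
qed

lemma generator_decoration:
  assumes "stable_graph \<Gamma>" "total_genus \<Gamma> \<le> 1"
  shows "(\<lambda>v\<in>verts \<Gamma>. generator v) \<in> decorations M \<Gamma>"
proof -
  have "generator v \<in> op_space M v" if "v \<in> verts \<Gamma>" for v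
    using generator_space[OF stable_graphD(3)[OF assms(1) that]] genus_le_total_genus[OF assms(1) that]
      assms(2) by linarith
  then show ?thesis
    unfolding decorations_def by (simp add: restrict_PiE_iff)
qed

lemma generated_comp_space:
  assumes "stable_graph \<Gamma>" "x \<in> decorations generated \<Gamma>"
  shows "op_comp M \<Gamma> x \<in> op_space generated (total_vertex \<Gamma>)"
proof (cases "total_genus \<Gamma> \<le> 1")
  case True
  have "\<exists>c. x v = fscale c (generator v)" if "v \<in> verts \<Gamma>" for v
  proof -
    have "fst v \<le> 1"
      using genus_le_total_genus[OF assms(1) that] True by simp
    then show ?thesis
      using assms(2) that unfolding decorations_def by (auto dest!: PiE_mem)
  qed
  then obtain c where c: "\<And>v. v \<in> verts \<Gamma> \<Longrightarrow> x v = fscale (c v) (generator v)"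
    by metis
  have x_eq: "x = (\<lambda>v\<in>verts \<Gamma>. fscale (if v \<in> verts \<Gamma> then c v else 1) ((\<lambda>v\<in>verts \<Gamma>. generator v) v))"
    using assms(2) c unfolding decorations_def by (auto simp: fun_eq_iff PiE_def extensional_def)
  have "op_comp M \<Gamma> x = fscale (\<Prod>v\<in>verts \<Gamma>. c v) (op_comp M \<Gamma> (\<lambda>v\<in>verts \<Gamma>. generator v))"
    by (rule trans[OF arg_cong[OF x_eq, of "op_comp M \<Gamma>"]
          op_comp_scale[OF assms(1) generator_decoration[OF assms(1) True] order.refl]])
  then show ?thesis
    using True unfolding generator_comp[OF assms(1) True] by (auto simp: total_vertex_def)
next
  case False
  then show ?thesis
    using M.comp_space[OF assms(1) UNIV_I] generated_decorations[OF assms(1)] assms(2)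
    by (auto simp: total_vertex_def)
qed

lemma generated_act_space:
  assumes "stable_vertex v" "inj_on f (snd v)" "a \<in> op_space generated v"
  shows "op_act M v f a \<in> op_space generated (relabel_vertex f v)"
proof (cases "fst v \<le> 1")
  case True
  then obtain c where c: "a = fscale c (generator v)"
    using assms(3) by auto
  have "op_act M v f a = fscale c (op_act M v f (generator v))"
    using M.act_linear[OF assms(1) UNIV_I assms(2)] generator_space[OF assms(1) True]
    unfolding linear_from_def c by blast
  then show ?thesis
    using generator_act[OF assms(1) True assms(2)] True by auto
next
  case False
  then show ?thesis
    using M.act_space[OF assms(1) UNIV_I assms(2)] assms(3) by simp
qed

lemma linear_from_mono: "linear_from V f \<Longrightarrow> W \<subseteq> V \<Longrightarrow> linear_from W f"
  unfolding linear_from_def by blast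

lemma generated_relabel_decoration: "relabel_decoration generated f \<Gamma> x = relabel_decoration M f \<Gamma> x"
  and generated_contract_decoration: "contract_decoration generated \<Gamma> F x = contract_decoration M \<Gamma> F x"
  by (simp_all add: relabel_decoration_def contract_decoration_def)

lemma modular_operad_generated: "modular_operad generated"
  unfolding modular_operad_def
proof (unfold_locales, goal_cases)
  case (1 v)
  then show ?case
    using M.subspace_space subspace_line[of "generator v"] by simp
next
  case (2 v f a)
  then show ?case using generated_act_space by simp
next
  case (3 v f)
  then show ?case
    using M.act_linear generated_subset linear_from_mono by (metis generated_simps(1))
next
  case (4 v f f' a)
  then show ?case
    using M.act_cong generated_subset by (metis generated_simps(1) subsetD)
next
  case (5 v a)
  then show ?case
    using M.act_id generated_subset by (metis generated_simps(1) subsetD)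
next
  case (6 v f f' a)
  then show ?case
    using M.act_compose generated_subset by (metis generated_simps(1) subsetD)
next
  case (7 \<Gamma> x)
  then show ?case using generated_comp_space by simp
next
  case (8 \<Gamma> x v)
  have "x \<in> decorations M \<Gamma>"
    using 8(1,3) generated_decorations by blast
  then show ?case
    unfolding generated_simps(2)
    by (intro linear_from_mono[OF M.comp_multilinear[OF 8(1) UNIV_I _ 8(4)]
          generated_subset[OF stable_graphD(3)[OF 8(1,4)]]])
next
  case (9 \<Gamma> x f)
  then show ?case
    unfolding generated_relabel_decoration
    using M.comp_relabel generated_decorations by (metis generated_simps(1,2) subsetD)
next
  case (10 v x)
  have "decorations generated (corolla v) \<subseteq> decorations M (corolla v)"
    using generated_subset 10(1) unfolding decorations_def corolla_def by (intro PiE_mono) auto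
  then show ?case
    using M.comp_corolla[OF 10(1) UNIV_I, of x] 10(3) by auto
next
  case (11 \<Gamma> x F)
  then show ?case
    unfolding generated_contract_decoration
    using M.comp_assoc generated_decorations by (metis generated_simps(2) subsetD)
qed

lemma cyclic_hom_generated: "cyclic_hom com_operad generated \<eta>"
proof -
  have "\<eta> v ` op_space com_operad v \<subseteq> op_space generated v" if "stable_vertex v" "fst v = 0" for v
    using eta_scale[OF that] that(2) by (auto simp: generator_zero)
  then show ?thesis
    using hom unfolding cyclic_hom_def graph_operad_hom_def by simp
qed

lemma modular_hom_identity: "modular_hom M M (\<lambda>v a. a)"
proof -
  have "(\<lambda>v\<in>verts \<Gamma>. x v) = x" if "x \<in> decorations M \<Gamma>" for \<Gamma> x
    using that unfolding decorations_def by (simp add: PiE_restrict)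
  then show ?thesis
    unfolding modular_hom_def graph_operad_hom_def by (simp add: linear_from_def)
qed

lemma modular_hom_generated:
  assumes "modular_hom M generated \<psi>"
  shows "modular_hom M M \<psi>"
proof -
  have "\<psi> v ` op_space M v \<subseteq> op_space M v" if "stable_vertex v" for v
    using assms generated_subset[OF that] that unfolding modular_hom_def graph_operad_hom_def by blast
  then show ?thesis
    using assms unfolding modular_hom_def graph_operad_hom_def by simp
qed

lemma universal:
  assumes "modular_operad (P :: ('k, 'b) operad_data)" "cyclic_hom com_operad P \<phi>"
  shows "\<exists>\<psi>. modular_hom M P \<psi> \<and>
    (\<forall>v a. stable_vertex v \<and> fst v = 0 \<longrightarrow> \<psi> v (\<eta> v a) = \<phi> v a) \<and>
    (\<forall>\<psi>'. modular_hom M P \<psi>' \<and> (\<forall>v a. stable_vertex v \<and> fst v = 0 \<longrightarrow> \<psi>' v (\<eta> v a) = \<phi> v a) \<longrightarrow>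
      (\<forall>v a. stable_vertex v \<and> a \<in> op_space M v \<longrightarrow> \<psi>' v a = \<psi> v a))"
proof -
  have "\<exists>\<psi>. modular_hom M P \<psi> \<and>
             (\<forall>v a. stable_vertex v \<and> fst v = 0 \<and> a \<in> op_space com_operad v \<longrightarrow> \<psi> v (\<eta> v a) = \<phi> v a) \<and>
             (\<forall>\<psi>'. modular_hom M P \<psi>' \<and>
                   (\<forall>v a. stable_vertex v \<and> fst v = 0 \<and> a \<in> op_space com_operad v \<longrightarrow>
                          \<psi>' v (\<eta> v a) = \<phi> v a) \<longrightarrow>
                   (\<forall>v a. stable_vertex v \<and> a \<in> op_space M v \<longrightarrow> \<psi>' v a = \<psi> v a))"
    using envelope assms unfolding modular_envelope_def by blast
  moreover have "(a \<in> op_space (com_operad :: ('k, unit) operad_data) v) = True" for a v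
    by (simp add: com_operad_def)
  ultimately show ?thesis
    by (simp only: simp_thms)
qed

lemma space_generator:
  assumes "stable_vertex v" "fst v \<le> 1"
  shows "op_space M v = range (\<lambda>c. fscale c (generator v))"
proof
  show "range (\<lambda>c. fscale c (generator v)) \<subseteq> op_space M v"
    using scale_generator_space[OF assms] by blast
  obtain \<psi> where \<psi>: "modular_hom M generated \<psi>"
    "\<forall>v a. stable_vertex v \<and> fst v = 0 \<longrightarrow> \<psi> v (\<eta> v a) = \<eta> v a"
    using universal[OF modular_operad_generated cyclic_hom_generated] by (elim exE conjE)
  have M: "modular_operad M" "cyclic_hom com_operad M \<eta>"
    using operad hom unfolding modular_operad_def cyclic_hom_def .
  \<comment> \<open>The map \<open>\<psi>'\<close> serves as a reference: uniqueness compares both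
    \<open>\<psi>\<close>, viewed as a map to \<open>M\<close>, and the identity with it.\<close>
  obtain \<psi>' where unique: "\<forall>\<psi>. modular_hom M M \<psi> \<and>
      (\<forall>v a. stable_vertex v \<and> fst v = 0 \<longrightarrow> \<psi> v (\<eta> v a) = \<eta> v a) \<longrightarrow>
      (\<forall>v a. stable_vertex v \<and> a \<in> op_space M v \<longrightarrow> \<psi> v a = \<psi>' v a)"
    using universal[OF M] by (elim exE conjE)
  show "op_space M v \<subseteq> range (\<lambda>c. fscale c (generator v))"
  proof
    fix a assume a: "a \<in> op_space M v"
    have "\<psi> v a = \<psi>' v a"
      using unique modular_hom_generated[OF \<psi>(1)] \<psi>(2) assms(1) a by blast
    moreover have "a = \<psi>' v a"
      using unique[THEN spec[of _ "\<lambda>v a. a"]] modular_hom_identity assms(1) a by blast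
    moreover have "\<psi> v a \<in> op_space generated v"
      using \<psi>(1) assms(1) a unfolding modular_hom_def graph_operad_hom_def by blast
    ultimately show "a \<in> range (\<lambda>c. fscale c (generator v))"
      using assms(2) by simp
  qed
qed

lemma coordinate:
  obtains \<kappa> :: "vertex \<Rightarrow> ('b \<Rightarrow> 'k) \<Rightarrow> 'k" where
    "\<And>v c. stable_vertex v \<Longrightarrow> fst v \<le> 1 \<Longrightarrow> \<kappa> v (fscale c (generator v)) = c"
    "\<And>v f a. stable_vertex v \<Longrightarrow> fst v \<le> 1 \<Longrightarrow> inj_on f (snd v) \<Longrightarrow> a \<in> op_space M v
       \<Longrightarrow> \<kappa> (relabel_vertex f v) (op_act M v f a) = \<kappa> v a"
proof -
  obtain \<psi> where \<psi>: "modular_hom M (modular_com :: ('k, 'b) operad_data) \<psi>"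
    "\<forall>v a. stable_vertex v \<and> fst v = 0 \<longrightarrow> \<psi> v (\<eta> v a) = line (a ())"
    using universal[OF modular_operad_modular_com cyclic_hom_modular_com] by (elim exE conjE)
  define \<kappa> where "\<kappa> v a = \<psi> v a undefined" for v a
  have gen: "\<kappa> v (generator v) = 1" if v: "stable_vertex v" "fst v \<le> 1" for v
    using v(2)
  proof (cases rule: genus_cases)
    case 1
    then show ?thesis
      using \<psi>(2)[rule_format, of v] v(1) by (simp add: generator_zero \<kappa>_def eta_def)
  next
    case (2 I)
    then have I: "stable_vertex (Suc 0, I)" "finite I"
      using v(1) by (auto simp: stable_vertex_def)
    obtain a b where ab: "fresh_pair a b I"
      by (rule fresh_pair_exists[OF I(2)])
    let ?\<Gamma> = "loop_graph a b I"
    have zero: "genus_zero_verts ?\<Gamma>"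
      by (rule genus_zero_verts_loop_graph[OF ab I(1)])
    have "\<psi> (total_vertex ?\<Gamma>) (op_comp M ?\<Gamma> (\<lambda>v\<in>verts ?\<Gamma>. eta v))
        = op_comp modular_com ?\<Gamma> (\<lambda>v\<in>verts ?\<Gamma>. \<psi> v ((\<lambda>v\<in>verts ?\<Gamma>. eta v) v))"
      using \<psi>(1) eta_decoration[OF zero] loop_graph_stable[OF ab I(1)]
      unfolding modular_hom_def graph_operad_hom_def by blast
    also have "\<dots> = line 1"
      using stable_graphD(3)[OF loop_graph_stable[OF ab I(1)]] \<psi>(2) by (simp add: eta_def)
    finally show ?thesis
      unfolding \<kappa>_def 2 generator_one[OF I(1) ab] composite_def
      using loop_graph_total(2)[OF ab] by simp
  qed
  have lin: "\<kappa> v (fscale c a) = c * \<kappa> v a" if "stable_vertex v" "a \<in> op_space M v" for v c a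
  proof -
    have "linear_from (op_space M v) (\<psi> v)"
      using \<psi>(1) that(1) unfolding modular_hom_def graph_operad_hom_def by blast
    then show ?thesis
      using that(2) unfolding linear_from_def \<kappa>_def by (simp add: fscale_def)
  qed
  show ?thesis
  proof
    show "\<kappa> v (fscale c (generator v)) = c" if "stable_vertex v" "fst v \<le> 1" for v c
      using lin[OF that(1) generator_space[OF that]] gen[OF that] by simp
    show "\<kappa> (relabel_vertex f v) (op_act M v f a) = \<kappa> v a"
      if "stable_vertex v" "fst v \<le> 1" "inj_on f (snd v)" "a \<in> op_space M v" for v f a
    proof -
      have "\<psi> (relabel_vertex f v) (op_act M v f a) = op_act modular_com v f (\<psi> v a)"
        using \<psi>(1) that unfolding modular_hom_def graph_operad_hom_def by blast
      then show ?thesis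
        by (simp add: \<kappa>_def)
    qed
  qed
qed

end

section \<open>Isomorphisms\<close>

definition isom :: "(nat \<Rightarrow> nat) \<Rightarrow> graph \<Rightarrow> graph \<Rightarrow> bool" where
  "isom f \<Gamma> \<Delta> \<longleftrightarrow> inj_on f (flags \<Gamma>) \<and> (\<forall>l\<in>legs \<Gamma>. f l = l) \<and> relabel_graph f \<Gamma> = \<Delta>"

lemma isom_legs:
  assumes "stable_graph \<Gamma>" "isom f \<Gamma> \<Delta>"
  shows "legs \<Delta> = legs \<Gamma>"
proof -
  have "f ` legs \<Gamma> = legs \<Gamma>"
    using assms(2) by (force simp: isom_def)
  then show ?thesis
    using legs_relabel[OF assms(1)] assms(2) by (auto simp: isom_def)
qed

lemma isom_refl: "stable_graph \<Gamma> \<Longrightarrow> isom id \<Gamma> \<Gamma>"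
  using relabel_graph_id[of \<Gamma> id] by (simp add: isom_def)

lemma isom_compose:
  assumes "stable_graph \<Gamma>" "isom f \<Gamma> \<Delta>" "isom g \<Delta> \<Theta>"
  shows "isom (g \<circ> f) \<Gamma> \<Theta>"
  using assms isom_legs[OF assms(1,2)]
  by (auto simp: isom_def flags_relabel comp_inj_on simp flip: relabel_graph_compose)

lemma isom_inverse:
  assumes "stable_graph \<Gamma>" "isom f \<Gamma> \<Delta>"
  shows "isom (inv_into (flags \<Gamma>) f) \<Delta> \<Gamma>"
proof -
  let ?g = "inv_into (flags \<Gamma>) f"
  have f: "inj_on f (flags \<Gamma>)" "relabel_graph f \<Gamma> = \<Delta>" "\<And>l. l \<in> legs \<Gamma> \<Longrightarrow> f l = l"
    using assms(2) by (auto simp: isom_def)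
  have inv: "?g (f i) = i" if "i \<in> flags \<Gamma>" for i
    using inv_into_f_f[OF f(1) that] .
  have "relabel_graph ?g \<Delta> = relabel_graph (?g \<circ> f) \<Gamma>"
    unfolding f(2)[symmetric] relabel_graph_compose ..
  also have "\<dots> = \<Gamma>"
    by (rule relabel_graph_id[OF _ assms(1)]) (simp add: inv)
  finally have "relabel_graph ?g \<Delta> = \<Gamma>" .
  moreover have "inj_on ?g (flags \<Delta>)"
    unfolding f(2)[symmetric] flags_relabel by (rule inj_on_inv_into) simp
  moreover have "?g l = l" if "l \<in> legs \<Delta>" for l
    using that isom_legs[OF assms] f(3) inv legs_subset_flags[of \<Gamma>] by (metis subsetD)
  ultimately show ?thesis
    by (simp add: isom_def)
qed

definition isomorphic :: "graph \<Rightarrow> graph \<Rightarrow> bool" where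
  "isomorphic \<Gamma> \<Delta> \<longleftrightarrow> (\<exists>f. isom f \<Gamma> \<Delta>)"

lemma isomorphic_refl: "stable_graph \<Gamma> \<Longrightarrow> isomorphic \<Gamma> \<Gamma>"
  using isom_refl by (auto simp: isomorphic_def)

lemma isomorphic_trans:
  "stable_graph \<Gamma> \<Longrightarrow> isomorphic \<Gamma> \<Delta> \<Longrightarrow> isomorphic \<Delta> \<Theta> \<Longrightarrow> isomorphic \<Gamma> \<Theta>"
  using isom_compose unfolding isomorphic_def by blast

lemma isomorphic_sym: "stable_graph \<Gamma> \<Longrightarrow> isomorphic \<Gamma> \<Delta> \<Longrightarrow> isomorphic \<Delta> \<Gamma>"
  using isom_inverse unfolding isomorphic_def by blast

lemma isomorphic_stable: "stable_graph \<Gamma> \<Longrightarrow> isomorphic \<Gamma> \<Delta> \<Longrightarrow> stable_graph \<Delta>"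
  using stable_graph_relabel unfolding isomorphic_def isom_def by blast

lemma isomorphic_card_edges:
  "stable_graph \<Gamma> \<Longrightarrow> isomorphic \<Gamma> \<Delta> \<Longrightarrow> card (edges \<Delta>) = card (edges \<Gamma>)"
  using card_edges_relabel unfolding isomorphic_def isom_def by blast

text \<open>Continued by the identity off the edges, so that it is a permutation of the whole type
  and has a \<open>sign\<close>.\<close>

definition edge_perm :: "(nat \<Rightarrow> nat) \<Rightarrow> graph \<Rightarrow> nat set \<Rightarrow> nat set" where
  "edge_perm f \<Gamma> e = (if e \<in> edges \<Gamma> then f ` e else e)"

text \<open>In characteristic zero no nonzero cochain is supported on such a graph.\<close>

definition odd_graph :: "graph \<Rightarrow> bool" where
  "odd_graph \<Gamma> \<longleftrightarrow> (\<exists>f. isom f \<Gamma> \<Gamma> \<and> sign (edge_perm f \<Gamma>) = - 1)"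

lemma edge_perm_permutes:
  assumes "stable_graph \<Gamma>" "isom f \<Gamma> \<Gamma>"
  shows "edge_perm f \<Gamma> permutes edges \<Gamma>"
proof (rule bij_imp_permutes)
  have "(`) f ` edges \<Gamma> = edges \<Gamma>"
    using assms(2) relabel_graph_simps(2)[of f \<Gamma>] by (simp add: isom_def)
  then have "bij_betw ((`) f) (edges \<Gamma>) (edges \<Gamma>)"
    using inj_on_image_edges[OF assms(1), of f] assms(2) by (simp add: bij_betw_def isom_def)
  then show "bij_betw (edge_perm f \<Gamma>) (edges \<Gamma>) (edges \<Gamma>)"
    by (rule bij_betw_cong[THEN iffD1, rotated]) (simp add: edge_perm_def)
qed (simp add: edge_perm_def)

text \<open>Conjugating an automorphism by \<open>g\<close> transports its edge permutation along
  the bijection of edges induced by \<open>g\<close>, which does not change the sign.\<close>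

lemma odd_graph_isomorphic:
  assumes "stable_graph \<Gamma>" "isomorphic \<Gamma> \<Delta>" "odd_graph \<Gamma>"
  shows "odd_graph \<Delta>"
proof -
  obtain g where g: "isom g \<Gamma> \<Delta>"
    using assms(2) by (auto simp: isomorphic_def)
  obtain f where f: "isom f \<Gamma> \<Gamma>" "sign (edge_perm f \<Gamma>) = - 1"
    using assms(3) by (auto simp: odd_graph_def)
  let ?g' = "inv_into (flags \<Gamma>) g"
  let ?f = "g \<circ> f \<circ> ?g'"
  have \<Delta>: "stable_graph \<Delta>"
    by (rule isomorphic_stable[OF assms(1,2)])
  have iso: "isom ?f \<Delta> \<Delta>"
    using isom_compose[OF \<Delta> isom_inverse[OF assms(1) g] isom_compose[OF assms(1) f(1) g]]
    by (simp add: comp_assoc)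
  have inj: "inj_on ((`) g) (edges \<Gamma>)"
    using inj_on_image_edges[OF assms(1), of g] g by (simp add: isom_def)
  have edges: "edges \<Delta> = (`) g ` edges \<Gamma>"
    using g by (auto simp: isom_def)
  have perm: "edge_perm f \<Gamma> permutes edges \<Gamma>"
    by (rule edge_perm_permutes[OF assms(1) f(1)])
  have "edge_perm ?f \<Delta> = map_permutation (edges \<Gamma>) ((`) g) (edge_perm f \<Gamma>)"
  proof
    fix e
    show "edge_perm ?f \<Delta> e = map_permutation (edges \<Gamma>) ((`) g) (edge_perm f \<Gamma>) e"
    proof (cases "e \<in> edges \<Delta>")
      case True
      then obtain d where d: "d \<in> edges \<Gamma>" "e = g ` d"
        using edges by blast
      have "?g' ` e = d"
        unfolding d(2) using g stable_graphD(6)[OF assms(1) d(1)]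
        by (simp add: isom_def)
      then have "?f ` e = g ` f ` d"
        unfolding image_comp[symmetric] by simp
      then have "edge_perm ?f \<Delta> e = g ` f ` d"
        using True by (simp add: edge_perm_def)
      also have "\<dots> = map_permutation (edges \<Gamma>) ((`) g) (edge_perm f \<Gamma>) (g ` d)"
        using map_permutation_apply[OF inj d(1), of "edge_perm f \<Gamma>"] d(1) by (simp add: edge_perm_def)
      finally show ?thesis
        using d(2) by simp
    next
      case False
      then show ?thesis
        by (simp add: edge_perm_def map_permutation_def edges)
    qed
  qed
  then have "sign (edge_perm ?f \<Delta>) = - 1"
    using sign_map_permutation[OF inj perm finite_edges[OF assms(1)]] f(2) by simp
  then show ?thesis
    using iso by (auto simp: odd_graph_def)
qed

section \<open>Representatives of the isomorphism classes\<close>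

definition rep :: "graph \<Rightarrow> graph" where
  "rep \<Gamma> = (SOME \<Delta>. isomorphic \<Gamma> \<Delta>)"

lemma isomorphic_rep: "stable_graph \<Gamma> \<Longrightarrow> isomorphic \<Gamma> (rep \<Gamma>)"
  unfolding rep_def by (rule someI[of _ \<Gamma>]) (rule isomorphic_refl)

text \<open>The predicates \<open>isomorphic \<Gamma>\<close> and \<open>isomorphic \<Delta>\<close>
  are equal, so the choice operator picks the same graph for both.\<close>

lemma rep_eq:
  assumes "stable_graph \<Gamma>" "isomorphic \<Gamma> \<Delta>"
  shows "rep \<Gamma> = rep \<Delta>"
proof -
  have "isomorphic \<Gamma> = isomorphic \<Delta>"
    using isomorphic_trans isomorphic_sym isomorphic_stable assms by blast
  then show ?thesis
    by (simp add: rep_def)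
qed

lemma rep_eqD:
  assumes "stable_graph \<Gamma>" "stable_graph \<Delta>" "rep \<Gamma> = rep \<Delta>"
  shows "isomorphic \<Gamma> \<Delta>"
  using isomorphic_rep[OF assms(1)] isomorphic_sym[OF assms(2) isomorphic_rep[OF assms(2)]]
    isomorphic_trans[OF assms(1)] assms(3) by simp

definition genus_one :: "nat \<Rightarrow> graph set" where
  "genus_one n = {\<Gamma>. stable_graph \<Gamma> \<and> total_genus \<Gamma> = 1 \<and> legs \<Gamma> = {1..n}}"

lemma genus_oneD:
  assumes "\<Gamma> \<in> genus_one n"
  shows "stable_graph \<Gamma>" "total_genus \<Gamma> = 1" "legs \<Gamma> = {1..n}"
  using assms by (auto simp: genus_one_def)

lemma isomorphic_genus_one:
  assumes "\<Gamma> \<in> genus_one n" "isomorphic \<Gamma> \<Delta>"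
  shows "\<Delta> \<in> genus_one n"
proof -
  note \<Gamma> = genus_oneD[OF assms(1)]
  obtain f where f: "isom f \<Gamma> \<Delta>"
    using assms(2) by (auto simp: isomorphic_def)
  then show ?thesis
    using isomorphic_stable[OF \<Gamma>(1) assms(2)] isom_legs[OF \<Gamma>(1) f] total_genus_relabel[OF \<Gamma>(1), of f] \<Gamma>
    by (auto simp: genus_one_def isom_def)
qed

lemma rep_genus_one: "\<Gamma> \<in> genus_one n \<Longrightarrow> rep \<Gamma> \<in> genus_one n"
  using isomorphic_genus_one isomorphic_rep genus_oneD(1) by blast

lemma rep_rep: "\<Gamma> \<in> genus_one n \<Longrightarrow> rep (rep \<Gamma>) = rep \<Gamma>"
  using rep_eq isomorphic_rep genus_oneD(1) by metis

text \<open>In genus one there are at most as many edges as vertices, and by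
  \<open>card_verts_legs\<close> at most \<open>n\<close> vertices.\<close>

lemma card_edges_genus_one:
  assumes "\<Gamma> \<in> genus_one n"
  shows "card (edges \<Gamma>) \<le> n"
  using genus_oneD[OF assms] card_verts_legs[of \<Gamma>] total_genus_eq_iff[of \<Gamma> 1] by auto

lemma finite_reps: "finite (rep ` genus_one n)"
proof -
  \<comment> \<open>Enough names for \<open>n\<close> legs and for two flags on each of at most
    \<open>n\<close> edges; every graph can be relabelled into this range.\<close>
  let ?X = "{1..3 * n}"
  let ?B = "{\<Delta>. verts \<Delta> \<subseteq> {..1} \<times> Pow ?X \<and> edges \<Delta> \<subseteq> Pow ?X} :: graph set"
  have "finite ((\<lambda>(V, E). \<lparr>verts = V, edges = E\<rparr>) ` (Pow ({..1::nat} \<times> Pow ?X) \<times> Pow (Pow ?X)))"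
    by (intro finite_imageI finite_cartesian_product finite_Pow_iff[THEN iffD2]) auto
  moreover have "?B \<subseteq> (\<lambda>(V, E). \<lparr>verts = V, edges = E\<rparr>) ` (Pow ({..1} \<times> Pow ?X) \<times> Pow (Pow ?X))"
  proof
    fix \<Delta> assume "\<Delta> \<in> ?B"
    then show "\<Delta> \<in> (\<lambda>(V, E). \<lparr>verts = V, edges = E\<rparr>) ` (Pow ({..1} \<times> Pow ?X) \<times> Pow (Pow ?X))"
      by (intro image_eqI[of _ _ "(verts \<Delta>, edges \<Delta>)"]) auto
  qed
  ultimately have fin: "finite ?B"
    by (rule finite_subset[rotated])
  have "rep ` genus_one n \<subseteq> rep ` ?B"
  proof
    fix \<Theta> assume "\<Theta> \<in> rep ` genus_one n"
    then obtain \<Gamma> where \<Gamma>: "\<Gamma> \<in> genus_one n" "\<Theta> = rep \<Gamma>"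
      by blast
    note \<Gamma>' = genus_oneD[OF \<Gamma>(1)]
    have "card (flags \<Gamma> - {1..n}) = 2 * card (edges \<Gamma>)"
      using card_flags_legs[OF \<Gamma>'(1)] \<Gamma>'(3) legs_subset_flags[of \<Gamma>] finite_flags[OF \<Gamma>'(1)]
      by (simp add: card_Diff_subset)
    also have "\<dots> \<le> card {Suc n..3 * n}"
      using card_edges_genus_one[OF \<Gamma>(1)] by simp
    finally obtain g where g: "inj_on g (flags \<Gamma> - {1..n})" "g ` (flags \<Gamma> - {1..n}) \<subseteq> {Suc n..3 * n}"
      using card_le_inj[of "flags \<Gamma> - {1..n}" "{Suc n..3 * n}"] finite_flags[OF \<Gamma>'(1)] by auto
    define f where "f i = (if i \<in> {1..n} then i else g i)" for i
    have inj: "inj_on f (flags \<Gamma>)"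
    proof (rule inj_onI)
      fix i j assume ij: "i \<in> flags \<Gamma>" "j \<in> flags \<Gamma>" "f i = f j"
      have "g l \<notin> {1..n}" if "l \<in> flags \<Gamma>" "l \<notin> {1..n}" for l
        using g(2) that by fastforce
      then show "i = j"
        using ij inj_onD[OF g(1), of i j] unfolding f_def by (metis Diff_iff)
    qed
    have img: "f ` flags \<Gamma> \<subseteq> ?X"
      using g(2) by (fastforce simp: f_def)
    define \<Delta> where "\<Delta> = relabel_graph f \<Gamma>"
    have iso: "isomorphic \<Gamma> \<Delta>"
      using inj \<Gamma>'(3) by (auto simp: isomorphic_def isom_def \<Delta>_def f_def)
    have "\<Delta> \<in> genus_one n"
      by (rule isomorphic_genus_one[OF \<Gamma>(1) iso])
    note \<Delta> = genus_oneD[OF this]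
    have fl: "flags \<Delta> \<subseteq> ?X"
      using img by (simp add: \<Delta>_def flags_relabel)
    have "v \<in> {..1} \<times> Pow ?X" if "v \<in> verts \<Delta>" for v
      using genus_le_total_genus[OF \<Delta>(1) that] \<Delta>(2) snd_subset_flags[OF that] fl
      by (auto simp: mem_Times_iff)
    then have "\<Delta> \<in> ?B"
      using stable_graphD(6)[OF \<Delta>(1)] fl by blast
    then show "\<Theta> \<in> rep ` ?B"
      using rep_eq[OF \<Gamma>'(1) iso] \<Gamma>(2) by blast
  qed
  then show ?thesis
    by (rule finite_subset[OF _ finite_imageI[OF fin]])
qed

section \<open>Grafting a set of legs onto a new vertex\<close>

lemma isolated_verts:
  assumes "stable_graph \<Gamma>" "v \<in> verts \<Gamma>" "snd v \<subseteq> legs \<Gamma>"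
  shows "verts \<Gamma> = {v}"
proof -
  have "w = v" if w: "w \<in> verts \<Gamma>" for w
  proof (rule ccontr)
    assume "w \<noteq> v"
    then have "w \<notin> {v}"
      by simp
    then obtain i j where "{i, j} \<in> edges \<Gamma>" "i \<in> snd v"
      using crossing_edge'[OF assms(1) _ assms(2) w, of "{v}"] by (metis singletonD singletonI)
    then show False
      using assms(3) by (auto simp: legs_def)
  qed
  then show ?thesis
    using assms(2) by blast
qed

text \<open>A vertex meeting no edge is the whole connected graph. In genus one this excludes a
  vertex of genus zero all of whose flags are legs, which is used both for the stability of a
  grafting and for finding the edge at a cherry.\<close>

lemma isolated_vertex:
  assumes "stable_graph \<Gamma>" "v \<in> verts \<Gamma>" "snd v \<subseteq> legs \<Gamma>"
  shows "total_genus \<Gamma> = fst v"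
proof -
  have V: "verts \<Gamma> = {v}"
    by (rule isolated_verts[OF assms])
  have "edges \<Gamma> = {}"
  proof (rule ccontr)
    assume "edges \<Gamma> \<noteq> {}"
    then obtain e where e: "e \<in> edges \<Gamma>"
      by blast
    then obtain i where i: "i \<in> e"
      using stable_graphD(5)[OF assms(1) e] by fastforce
    then have "i \<in> snd v"
      using stable_graphD(6)[OF assms(1) e] V by (auto simp: flags_def)
    then show False
      using assms(3) e i by (auto simp: legs_def)
  qed
  then show ?thesis
    by (simp add: total_genus_def V)
qed

definition graft_vertex :: "nat set \<Rightarrow> nat \<Rightarrow> vertex \<Rightarrow> vertex" where
  "graft_vertex S k v = (if S \<subseteq> snd v then (fst v, insert k (snd v - S)) else v)"

text \<open>\<open>h\<close> is the flag of the new edge at the new vertex, and \<open>k\<close> is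
  the flag that takes the place of \<open>S\<close> at the old one.\<close>

definition graft :: "nat set \<Rightarrow> nat \<Rightarrow> nat \<Rightarrow> graph \<Rightarrow> graph" where
  "graft S h k \<Gamma> =
     \<lparr>verts = insert (0, insert h S) (graft_vertex S k ` verts \<Gamma>), edges = insert {h, k} (edges \<Gamma>)\<rparr>"

definition prune_vertex :: "nat set \<Rightarrow> nat \<Rightarrow> vertex \<Rightarrow> vertex" where
  "prune_vertex S k v = (if k \<in> snd v then (fst v, snd v - {k} \<union> S) else v)"

definition prune :: "nat set \<Rightarrow> nat \<Rightarrow> nat \<Rightarrow> graph \<Rightarrow> graph" where
  "prune S h k \<Gamma> =
     \<lparr>verts = prune_vertex S k ` (verts \<Gamma> - {(0, insert h S)}), edges = edges \<Gamma> - {{h, k}}\<rparr>"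

lemma graft_simps [simp]:
  "verts (graft S h k \<Gamma>) = insert (0, insert h S) (graft_vertex S k ` verts \<Gamma>)"
  "edges (graft S h k \<Gamma>) = insert {h, k} (edges \<Gamma>)"
  by (simp_all add: graft_def)

lemma prune_simps [simp]:
  "verts (prune S h k \<Gamma>) = prune_vertex S k ` (verts \<Gamma> - {(0, insert h S)})"
  "edges (prune S h k \<Gamma>) = edges \<Gamma> - {{h, k}}"
  by (simp_all add: prune_def)

text \<open>The obstruction to grafting: a vertex of genus zero with only one flag besides
  \<open>S\<close> would keep valence two after \<open>S\<close> has been replaced by
  \<open>k\<close>. It is also the shape produced by grafting.\<close>

definition cherry :: "nat set \<Rightarrow> graph \<Rightarrow> bool" where
  "cherry S \<Gamma> \<longleftrightarrow> (\<exists>h. h \<notin> S \<and> (0, insert h S) \<in> verts \<Gamma>)"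

definition together :: "nat set \<Rightarrow> graph \<Rightarrow> bool" where
  "together S \<Gamma> \<longleftrightarrow> (\<exists>v\<in>verts \<Gamma>. S \<subseteq> snd v)"

section \<open>Grafting preserves stable graphs of genus one\<close>

locale grafting =
  fixes n :: nat and S :: "nat set" and h k :: nat and \<Gamma> :: graph and u :: vertex
  assumes genus_one: "\<Gamma> \<in> genus_one n"
    and S: "S \<subseteq> {1..n}" "2 \<le> card S"
    and u: "u \<in> verts \<Gamma>" "S \<subseteq> snd u"
    and no_cherry: "\<not> cherry S \<Gamma>"
    and fresh: "h \<noteq> k" "h \<notin> flags \<Gamma>" "k \<notin> flags \<Gamma>"
begin

lemmas \<Gamma> = genus_oneD[OF genus_one]

lemma S_nonempty: "S \<noteq> {}" and finite_S: "finite S"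
  using S finite_subset by auto

lemma S_legs: "S \<subseteq> legs \<Gamma>"
  using \<Gamma>(3) S by simp

lemma S_flags: "S \<subseteq> flags \<Gamma>"
  using S_legs legs_subset_flags by blast

lemma fresh_S: "h \<notin> S" "k \<notin> S"
  using fresh S_flags by blast+

lemma S_edge: "e \<in> edges \<Gamma> \<Longrightarrow> e \<inter> S = {}"
  using S_legs by (auto simp: legs_def)

lemma fresh_vertex: "v \<in> verts \<Gamma> \<Longrightarrow> h \<notin> snd v" "v \<in> verts \<Gamma> \<Longrightarrow> k \<notin> snd v"
  using fresh snd_subset_flags by blast+

lemma edge_flags: "e \<in> edges \<Gamma> \<Longrightarrow> e \<subseteq> flags \<Gamma>"
  using stable_graphD(6)[OF \<Gamma>(1)] .

lemma S_subset_iff: "v \<in> verts \<Gamma> \<Longrightarrow> S \<subseteq> snd v \<longleftrightarrow> v = u"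
  using vertex_unique[OF \<Gamma>(1)] u S_nonempty by blast

lemma graft_vertex_u: "graft_vertex S k u = (fst u, insert k (snd u - S))"
  using u(2) by (simp add: graft_vertex_def)

lemma graft_vertex_other: "v \<in> verts \<Gamma> \<Longrightarrow> v \<noteq> u \<Longrightarrow> graft_vertex S k v = v"
  using S_subset_iff by (simp add: graft_vertex_def)

lemma snd_graft_vertex:
  assumes "v \<in> verts \<Gamma>"
  shows "snd (graft_vertex S k v) = (if v = u then insert k (snd v - S) else snd v)"
  using graft_vertex_other[OF assms] graft_vertex_u by auto

lemma fst_graft_vertex [simp]: "fst (graft_vertex S k v) = fst v"
  by (simp add: graft_vertex_def)

lemma S_Int_other: "v \<in> verts \<Gamma> \<Longrightarrow> v \<noteq> u \<Longrightarrow> snd v \<inter> S = {}"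
  using stable_graphD(4)[OF \<Gamma>(1) _ u(1)] u(2) by blast

lemma edge_Int_graft_vertex:
  assumes "e \<in> edges \<Gamma>" "v \<in> verts \<Gamma>"
  shows "e \<inter> snd (graft_vertex S k v) = e \<inter> snd v"
  using assms S_edge[OF assms(1)] edge_flags[OF assms(1)] fresh(3)
  by (auto simp: snd_graft_vertex split: if_splits)

lemma disjoint_graft_vertex:
  assumes "v \<in> verts \<Gamma>" "w \<in> verts \<Gamma>" "v \<noteq> w"
  shows "snd (graft_vertex S k v) \<inter> snd (graft_vertex S k w) = {}"
  using stable_graphD(4)[OF \<Gamma>(1) assms] fresh_vertex(2)[OF assms(1)] fresh_vertex(2)[OF assms(2)] assms
  by (auto simp: snd_graft_vertex split: if_splits)

lemma cherry_Int_graft_vertex: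
  assumes "v \<in> verts \<Gamma>"
  shows "insert h S \<inter> snd (graft_vertex S k v) = {}"
  using fresh_vertex(1)[OF assms] S_Int_other[OF assms] fresh(1) fresh_S
  by (auto simp: snd_graft_vertex[OF assms] split: if_splits)

text \<open>A vertex without flags would be the whole graph and have genus one, which is unstable.
  Nonemptiness lets disjointness of the new flag sets imply that the vertices stay distinct.\<close>

lemma graft_vertex_nonempty: "v \<in> verts \<Gamma> \<Longrightarrow> v \<noteq> u \<Longrightarrow> snd v = {} \<Longrightarrow> False"
proof -
  assume v: "v \<in> verts \<Gamma>" "v \<noteq> u" "snd v = {}"
  then have "fst v = total_genus \<Gamma>"
    using isolated_vertex[OF \<Gamma>(1) v(1)] by simp
  then show False
    using stable_graphD(3)[OF \<Gamma>(1) v(1)] v(3) \<Gamma>(2) by (simp add: stable_vertex_def)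
qed

lemma inj_graft_vertex: "inj_on (graft_vertex S k) (verts \<Gamma>)"
proof (rule inj_onI, rule ccontr)
  fix v w assume *: "v \<in> verts \<Gamma>" "w \<in> verts \<Gamma>" "graft_vertex S k v = graft_vertex S k w" "v \<noteq> w"
  then have "snd (graft_vertex S k v) = {}"
    using disjoint_graft_vertex[OF *(1,2,4)] by simp
  then show False
    using * graft_vertex_nonempty snd_graft_vertex by (metis insert_not_empty)
qed

text \<open>Only genus zero with fewer than two flags outside \<open>S\<close> could fail. With
  none, the vertex would be the whole graph, of genus zero; with one, it would be a cherry.\<close>

lemma stable_graft_vertex_u: "stable_vertex (graft_vertex S k u)"
proof -
  have u_stable: "finite (snd u)" "2 * fst u + card (snd u) > 2"
    using stable_graphD(3)[OF \<Gamma>(1) u(1)] by (auto simp: stable_vertex_def)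
  have "fst u = 0 \<Longrightarrow> card (snd u - S) \<ge> 2"
  proof (rule ccontr)
    assume fst: "fst u = 0" and "\<not> card (snd u - S) \<ge> 2"
    then consider "card (snd u - S) = 0" | "card (snd u - S) = 1"
      by linarith
    then show False
    proof cases
      case 1
      then have "snd u \<subseteq> legs \<Gamma>"
        using u_stable(1) S_legs by auto
      then show False
        using isolated_vertex[OF \<Gamma>(1) u(1)] fst \<Gamma>(2) by simp
    next
      case 2
      then obtain x where x: "snd u - S = {x}"
        by (auto simp: card_1_singleton_iff)
      then have "u = (0, insert x S)" "x \<notin> S"
        using fst u(2) by (auto simp: prod_eq_iff)
      then show False
        using no_cherry u(1) by (auto simp: cherry_def)
    qed
  qed
  moreover have "k \<notin> snd u - S"
    using fresh_vertex(2)[OF u(1)] by simp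
  ultimately show ?thesis
    using u_stable(1) by (cases "fst u = 0") (auto simp: graft_vertex_u stable_vertex_def)
qed

lemma flags_graft: "flags (graft S h k \<Gamma>) = insert h (insert k (flags \<Gamma>))"
proof -
  have "flags (graft S h k \<Gamma>) = insert h S \<union> (\<Union>v\<in>verts \<Gamma>. snd (graft_vertex S k v))"
    by (simp add: flags_def)
  also have "\<dots> = insert h S \<union> (snd (graft_vertex S k u) \<union> (\<Union>v\<in>verts \<Gamma> - {u}. snd (graft_vertex S k v)))"
    using u(1) by auto
  also have "\<dots> = insert h (insert k (snd u \<union> (\<Union>v\<in>verts \<Gamma> - {u}. snd v)))"
    using u(2) by (auto simp: snd_graft_vertex graft_vertex_u)
  also have "snd u \<union> (\<Union>v\<in>verts \<Gamma> - {u}. snd v) = flags \<Gamma>"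
    using u(1) by (auto simp: flags_def)
  finally show ?thesis .
qed

lemma legs_graft: "legs (graft S h k \<Gamma>) = legs \<Gamma>"
  using fresh by (auto simp: legs_def flags_graft)

lemma new_edge: "{h, k} \<notin> edges \<Gamma>"
  using edge_flags fresh by blast

lemma card_edges_graft: "card (edges (graft S h k \<Gamma>)) = Suc (card (edges \<Gamma>))"
  using new_edge finite_edges[OF \<Gamma>(1)] by simp

lemma cherry_notin: "(0, insert h S) \<notin> graft_vertex S k ` verts \<Gamma>"
proof
  assume "(0, insert h S) \<in> graft_vertex S k ` verts \<Gamma>"
  then obtain v where "v \<in> verts \<Gamma>" "graft_vertex S k v = (0, insert h S)"
    by (metis imageE)
  then show False
    using cherry_Int_graft_vertex[of v] by simp
qed

text \<open>Old edges contain no element of \<open>S\<close>, so moving \<open>S\<close> does not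
  change what they join, and the new edge ties the new vertex to the one that carried
  \<open>S\<close>.\<close>

lemma graft_connected:
  assumes "T \<subseteq> verts (graft S h k \<Gamma>)" "T \<noteq> {}"
    and closed: "\<And>v w. v \<in> T \<Longrightarrow> (v, w) \<in> joined (graft S h k \<Gamma>) (edges (graft S h k \<Gamma>)) \<Longrightarrow> w \<in> T"
  shows "verts (graft S h k \<Gamma>) \<subseteq> T"
proof -
  let ?J = "joined (graft S h k \<Gamma>) (edges (graft S h k \<Gamma>))"
  have ends: "{h, k} \<inter> snd (0 :: nat, insert h S) \<noteq> {}" "{h, k} \<inter> snd (graft_vertex S k u) \<noteq> {}"
    by (auto simp: graft_vertex_u)
  have "((0, insert h S), graft_vertex S k u) \<in> ?J" "(graft_vertex S k u, (0, insert h S)) \<in> ?J"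
    unfolding joined_def using u(1) ends by auto
  then have cherry_iff: "(0, insert h S) \<in> T \<longleftrightarrow> graft_vertex S k u \<in> T"
    using closed by blast
  have "\<exists>v\<in>verts \<Gamma>. graft_vertex S k v \<in> T"
  proof -
    obtain t where t: "t \<in> T" using assms(2) by blast
    then consider "t = (0, insert h S)" | "t \<in> graft_vertex S k ` verts \<Gamma>"
      using assms(1) by auto
    then show ?thesis
      using t cherry_iff u(1) by cases auto
  qed
  then obtain v where v: "v \<in> verts \<Gamma>" "graft_vertex S k v \<in> T"
    by blast
  have step: "graft_vertex S k y \<in> T" if xy: "graft_vertex S k x \<in> T" "(x, y) \<in> joined \<Gamma> (edges \<Gamma>)" for x y
  proof (rule closed[OF xy(1)])
    obtain e where e: "x \<in> verts \<Gamma>" "y \<in> verts \<Gamma>" "e \<in> edges \<Gamma>" "e \<inter> snd x \<noteq> {}" "e \<inter> snd y \<noteq> {}"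
      using xy(2) unfolding joined_def by blast
    then have "e \<inter> snd (graft_vertex S k x) \<noteq> {}" "e \<inter> snd (graft_vertex S k y) \<noteq> {}"
      using edge_Int_graft_vertex by simp_all
    then show "(graft_vertex S k x, graft_vertex S k y) \<in> ?J"
      using e(1-3) unfolding joined_def by auto
  qed
  have all: "graft_vertex S k y \<in> T" if "y \<in> verts \<Gamma>" for y
    using closed_rtrancl[OF stable_graphD(8)[OF \<Gamma>(1) v(1) that], of "{x. graft_vertex S k x \<in> T}"]
      v(2) step by simp
  then show ?thesis
    using cherry_iff u(1) by auto
qed

lemma stable_graft: "stable_graph (graft S h k \<Gamma>)"
  unfolding stable_graph_def
proof (intro conjI ballI impI)
  show "finite (verts (graft S h k \<Gamma>))" "verts (graft S h k \<Gamma>) \<noteq> {}"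
    using stable_graphD(1)[OF \<Gamma>(1)] by auto
  show "stable_vertex v" if v: "v \<in> verts (graft S h k \<Gamma>)" for v
  proof -
    have "graft_vertex S k x = graft_vertex S k u \<or> graft_vertex S k x \<in> verts \<Gamma>" if "x \<in> verts \<Gamma>" for x
      using graft_vertex_other[OF that] that by (cases "x = u") simp_all
    then consider "v = (0, insert h S)" | "v = graft_vertex S k u" | "v \<in> verts \<Gamma>"
      using v unfolding graft_simps by blast
    then show ?thesis
    proof cases
      case 1
      have "h \<notin> S"
        using fresh(2) S_flags by blast
      then show ?thesis
        using 1 S(2) finite_S by (simp add: stable_vertex_def)
    qed (use stable_graft_vertex_u stable_graphD(3)[OF \<Gamma>(1)] in auto)
  qed
  show "snd v \<inter> snd w = {}"
    if vw: "v \<in> verts (graft S h k \<Gamma>)" "w \<in> verts (graft S h k \<Gamma>)" "v \<noteq> w" for v w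
  proof -
    have "v = (0, insert h S) \<or> (\<exists>x\<in>verts \<Gamma>. v = graft_vertex S k x)"
      "w = (0, insert h S) \<or> (\<exists>x\<in>verts \<Gamma>. w = graft_vertex S k x)"
      using vw by auto
    then show ?thesis
      using vw(3) disjoint_graft_vertex cherry_Int_graft_vertex by (metis inf_commute snd_conv)
  qed
  show "card e = 2" "e \<subseteq> flags (graft S h k \<Gamma>)" if "e \<in> edges (graft S h k \<Gamma>)" for e
    using that stable_graphD(5)[OF \<Gamma>(1)] edge_flags fresh unfolding flags_graft by auto
  show "e \<inter> e' = {}"
    if "e \<in> edges (graft S h k \<Gamma>)" "e' \<in> edges (graft S h k \<Gamma>)" "e \<noteq> e'" for e e'
  proof -
    have "d \<inter> {h, k} = {}" if "d \<in> edges \<Gamma>" for d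
      using edge_flags[OF that] fresh by blast
    then show ?thesis
      using that stable_graphD(7)[OF \<Gamma>(1)] by auto
  qed
  show "(v, w) \<in> (joined (graft S h k \<Gamma>) (edges (graft S h k \<Gamma>)))\<^sup>*"
    if vw: "v \<in> verts (graft S h k \<Gamma>)" "w \<in> verts (graft S h k \<Gamma>)" for v w
    by (rule connectedI[OF graft_connected vw])
qed

lemma genus_one_graft: "graft S h k \<Gamma> \<in> genus_one n"
proof -
  have card_verts: "card (verts (graft S h k \<Gamma>)) = Suc (card (verts \<Gamma>))"
    using cherry_notin stable_graphD(1)[OF \<Gamma>(1)] by (simp add: card_image[OF inj_graft_vertex])
  have "(\<Sum>v\<in>verts (graft S h k \<Gamma>). fst v) = (\<Sum>v\<in>verts \<Gamma>. fst v)"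
    using cherry_notin stable_graphD(1)[OF \<Gamma>(1)] by (simp add: sum.reindex[OF inj_graft_vertex])
  then have "total_genus (graft S h k \<Gamma>) = 1"
    using total_genus_eq_iff[OF stable_graft, of 1] total_genus_eq_iff[OF \<Gamma>(1), of 1] \<Gamma>(2)
      card_verts card_edges_graft by (simp del: graft_simps)
  then show ?thesis
    using stable_graft legs_graft \<Gamma>(3) by (simp add: genus_one_def)
qed

lemma cherry_graft: "cherry S (graft S h k \<Gamma>)"
  using fresh(2) S_flags by (auto simp: cherry_def)

lemma prune_graft: "prune S h k (graft S h k \<Gamma>) = \<Gamma>"
proof (rule graph_eqI)
  have "prune_vertex S k (graft_vertex S k v) = v" if "v \<in> verts \<Gamma>" for v
  proof (cases "v = u")
    case True
    have "snd u - S - {k} \<union> S = snd u"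
      using fresh_vertex(2)[OF u(1)] u(2) by blast
    then show ?thesis
      by (simp add: True graft_vertex_u prune_vertex_def)
  next
    case False
    then show ?thesis
      using fresh_vertex(2)[OF that] graft_vertex_other[OF that] by (simp add: prune_vertex_def)
  qed
  then show "verts (prune S h k (graft S h k \<Gamma>)) = verts \<Gamma>"
    using cherry_notin by (simp add: image_image insert_Diff_if)
  show "edges (prune S h k (graft S h k \<Gamma>)) = edges \<Gamma>"
    using new_edge by simp
qed

lemma same_vertex_graft:
  assumes "i \<in> flags \<Gamma> - S" "j \<in> flags \<Gamma> - S"
  shows "(\<exists>v\<in>verts (graft S h k \<Gamma>). i \<in> snd v \<and> j \<in> snd v) \<longleftrightarrow> (\<exists>v\<in>verts \<Gamma>. i \<in> snd v \<and> j \<in> snd v)"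
proof -
  have "i \<noteq> h" "i \<noteq> k" "j \<noteq> k" "i \<notin> S" "j \<notin> S"
    using assms fresh by auto
  then have "i \<in> snd (graft_vertex S k v) \<longleftrightarrow> i \<in> snd v" "j \<in> snd (graft_vertex S k v) \<longleftrightarrow> j \<in> snd v"
    if "v \<in> verts \<Gamma>" for v
    using snd_graft_vertex[OF that] by simp_all
  then show ?thesis
    using \<open>i \<noteq> h\<close> \<open>i \<notin> S\<close> by auto
qed

end

section \<open>Pruning a cherry, the inverse of grafting\<close>

locale pruning =
  fixes n :: nat and S :: "nat set" and h k :: nat and \<Gamma> :: graph and w :: vertex
  assumes genus_one: "\<Gamma> \<in> genus_one n"
    and S: "S \<subseteq> {1..n}" "2 \<le> card S"
    and tip: "(0, insert h S) \<in> verts \<Gamma>" "h \<notin> S"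
    and edge: "{h, k} \<in> edges \<Gamma>" "h \<noteq> k"
    and w: "w \<in> verts \<Gamma>" "k \<in> snd w"
begin

lemmas \<Gamma> = genus_oneD[OF genus_one]

lemma S_nonempty: "S \<noteq> {}" and finite_S: "finite S"
  using S finite_subset by auto

lemma S_legs: "S \<subseteq> legs \<Gamma>"
  using \<Gamma>(3) S by simp

lemma S_edge: "e \<in> edges \<Gamma> \<Longrightarrow> e \<inter> S = {}"
  using S_legs by (auto simp: legs_def)

lemma k_notin: "k \<notin> S"
  using S_edge[OF edge(1)] by blast

lemma w_tip: "w \<noteq> (0, insert h S)"
  using w(2) edge(2) k_notin by auto

lemma tip_Int: "v \<in> verts \<Gamma> \<Longrightarrow> v \<noteq> (0, insert h S) \<Longrightarrow> insert h S \<inter> snd v = {}"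
  using stable_graphD(4)[OF \<Gamma>(1) tip(1), of v] by auto

lemma prune_vertex_w: "prune_vertex S k w = (fst w, snd w - {k} \<union> S)"
  using w(2) by (simp add: prune_vertex_def)

lemma k_other: "v \<in> verts \<Gamma> \<Longrightarrow> v \<noteq> w \<Longrightarrow> k \<notin> snd v"
  using vertex_unique[OF \<Gamma>(1) _ w(1) _ w(2), of v] by blast

lemma prune_vertex_other: "v \<in> verts \<Gamma> \<Longrightarrow> v \<noteq> w \<Longrightarrow> prune_vertex S k v = v"
  using k_other[of v] by (simp add: prune_vertex_def)

lemma fst_prune_vertex [simp]: "fst (prune_vertex S k v) = fst v"
  by (simp add: prune_vertex_def)

lemma snd_prune_vertex:
  assumes "v \<in> verts \<Gamma>"
  shows "snd (prune_vertex S k v) = (if v = w then snd v - {k} \<union> S else snd v)"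
  using prune_vertex_other[OF assms] prune_vertex_w by auto

lemma graft_prune_vertex:
  assumes "v \<in> verts \<Gamma> - {(0, insert h S)}"
  shows "graft_vertex S k (prune_vertex S k v) = v"
proof -
  have v: "v \<in> verts \<Gamma>" "S \<inter> snd v = {}"
    using assms tip_Int[of v] by auto
  show ?thesis
  proof (cases "v = w")
    case True
    then have "insert k (snd w - {k} \<union> S - S) = snd w"
      using v(2) w(2) k_notin by blast
    then show ?thesis
      by (simp add: True prune_vertex_w graft_vertex_def)
  next
    case False
    then show ?thesis
      using v S_nonempty by (auto simp: prune_vertex_other graft_vertex_def)
  qed
qed

lemma graft_prune: "graft S h k (prune S h k \<Gamma>) = \<Gamma>"
proof (rule graph_eqI)
  show "verts (graft S h k (prune S h k \<Gamma>)) = verts \<Gamma>"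
    using tip(1) graft_prune_vertex by (simp add: image_image insert_absorb)
  show "edges (graft S h k (prune S h k \<Gamma>)) = edges \<Gamma>"
    using edge(1) by auto
qed

lemma inj_prune_vertex: "inj_on (prune_vertex S k) (verts \<Gamma> - {(0, insert h S)})"
  by (rule inj_on_inverseI[where g = "graft_vertex S k"]) (rule graft_prune_vertex)

lemma disjoint_prune_vertex:
  assumes "x \<in> verts \<Gamma>" "y \<in> verts \<Gamma>" "x \<noteq> y" "x \<noteq> (0, insert h S)" "y \<noteq> (0, insert h S)"
  shows "snd (prune_vertex S k x) \<inter> snd (prune_vertex S k y) = {}"
  using stable_graphD(4)[OF \<Gamma>(1) assms(1-3)] tip_Int[OF assms(1,4)] tip_Int[OF assms(2,5)] assms(3)
  by (auto simp: snd_prune_vertex[OF assms(1)] snd_prune_vertex[OF assms(2)])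

lemma flags_prune: "flags (prune S h k \<Gamma>) = flags \<Gamma> - {h, k}"
proof -
  have "flags (prune S h k \<Gamma>) = (\<Union>v\<in>verts \<Gamma> - {(0, insert h S)}. snd (prune_vertex S k v))"
    by (simp add: flags_def)
  also have "\<dots> = snd (prune_vertex S k w) \<union>
      (\<Union>v\<in>verts \<Gamma> - {(0, insert h S)} - {w}. snd (prune_vertex S k v))"
    using w(1) w_tip by auto
  also have "\<dots> = snd w - {k} \<union> S \<union> (\<Union>v\<in>verts \<Gamma> - {(0, insert h S)} - {w}. snd v)"
    using prune_vertex_other by (simp add: prune_vertex_w)
  also have "\<dots> = flags \<Gamma> - {h, k}"
  proof -
    have "flags \<Gamma> = snd w \<union> insert h S \<union> (\<Union>v\<in>verts \<Gamma> - {(0, insert h S)} - {w}. snd v)"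
      using w(1) tip(1) by (auto simp: flags_def)
    moreover have "h \<notin> snd v" if "v \<in> verts \<Gamma> - {(0, insert h S)}" for v
      using tip_Int[of v] that by auto
    moreover have "k \<notin> snd v" if "v \<in> verts \<Gamma> - {w}" for v
      using k_other[of v] that by blast
    ultimately show ?thesis
      using w(1) w_tip tip(2) k_notin by auto
  qed
  finally show ?thesis .
qed

lemma other_edge: "e \<in> edges \<Gamma> - {{h, k}} \<Longrightarrow> e \<inter> {h, k} = {}"
  using stable_graphD(7)[OF \<Gamma>(1) _ edge(1)] by blast

lemma legs_prune: "legs (prune S h k \<Gamma>) = legs \<Gamma>"
proof -
  have "\<Union> (edges \<Gamma>) = {h, k} \<union> \<Union> (edges \<Gamma> - {{h, k}})"
    using edge(1) by blast
  then show ?thesis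
    unfolding legs_def flags_prune by auto
qed

lemma other_edge_Int:
  assumes "e \<in> edges \<Gamma> - {{h, k}}" "v \<in> verts \<Gamma>"
  shows "e \<inter> snd (prune_vertex S k v) = e \<inter> snd v"
  using assms S_edge[of e] other_edge[OF assms(1)] by (auto simp: snd_prune_vertex split: if_splits)

lemma other_edge_tip: "e \<in> edges \<Gamma> - {{h, k}} \<Longrightarrow> e \<inter> insert h S = {}"
  using other_edge[of e] S_edge[of e] by blast

text \<open>The contracted edge identifies the tip with \<open>w\<close>. The map \<open>?r\<close>
  performs this identification on vertices of \<open>\<Gamma>\<close>, and the preimage
  \<open>?T\<close> of a closed set is closed in the connected graph
  \<open>\<Gamma>\<close>.\<close>

lemma prune_connected:
  assumes "T \<subseteq> verts (prune S h k \<Gamma>)" "T \<noteq> {}"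
    and closed: "\<And>x y. x \<in> T \<Longrightarrow> (x, y) \<in> joined (prune S h k \<Gamma>) (edges (prune S h k \<Gamma>)) \<Longrightarrow> y \<in> T"
  shows "verts (prune S h k \<Gamma>) \<subseteq> T"
proof -
  let ?t = "(0, insert h S)"
  let ?r = "\<lambda>v. if v = ?t then w else v"
  let ?T = "{v. prune_vertex S k (?r v) \<in> T}"
  obtain x where "x \<in> T"
    using assms(2) by blast
  then obtain v where v: "v \<in> verts \<Gamma>" "v \<noteq> ?t" "prune_vertex S k v \<in> T"
    using assms(1) unfolding prune_simps by blast
  have step: "y \<in> ?T" if xT: "x \<in> ?T" and xy: "(x, y) \<in> joined \<Gamma> (edges \<Gamma>)" for x y
  proof -
    obtain e where e: "x \<in> verts \<Gamma>" "y \<in> verts \<Gamma>" "e \<in> edges \<Gamma>" "e \<inter> snd x \<noteq> {}" "e \<inter> snd y \<noteq> {}"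
      using xy unfolding joined_def by blast
    show ?thesis
    proof (cases "e = {h, k}")
      case True
      have "?r u = w" if "u \<in> verts \<Gamma>" "{h, k} \<inter> snd u \<noteq> {}" for u
        using that tip_Int[of u] k_other[of u] by (cases "u = ?t"; cases "u = w") auto
      then have "?r x = w" "?r y = w"
        using e unfolding True by blast+
      then show ?thesis
        using xT by simp
    next
      case False
      then have e': "e \<in> edges \<Gamma> - {{h, k}}"
        using e(3) by blast
      then have xy': "x \<noteq> ?t" "y \<noteq> ?t"
        using other_edge_tip[OF e'] e(4,5) by auto
      have "e \<inter> snd (prune_vertex S k x) \<noteq> {}" "e \<inter> snd (prune_vertex S k y) \<noteq> {}"
        using other_edge_Int[OF e'] e by simp_all
      then have "(prune_vertex S k x, prune_vertex S k y)
          \<in> joined (prune S h k \<Gamma>) (edges (prune S h k \<Gamma>))"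
        using e(1,2) xy' e' unfolding joined_def by auto
      then show ?thesis
        using closed[of "prune_vertex S k x"] xT xy' by simp
    qed
  qed
  have "y \<in> ?T" if "y \<in> verts \<Gamma>" for y
    by (rule closed_rtrancl[OF stable_graphD(8)[OF \<Gamma>(1) v(1) that]]) (use v step in auto)
  then have "prune_vertex S k y \<in> T" if "y \<in> verts \<Gamma>" "y \<noteq> ?t" for y
    using that by fastforce
  then show ?thesis
    unfolding prune_simps by blast
qed

text \<open>One flag is replaced by at least two, so the valence grows.\<close>

lemma stable_prune_vertex:
  assumes "v \<in> verts \<Gamma>"
  shows "stable_vertex (prune_vertex S k v)"
proof (cases "v = w")
  case True
  have w_stable: "finite (snd w)" "2 * fst w + card (snd w) > 2"
    using stable_graphD(3)[OF \<Gamma>(1) w(1)] by (auto simp: stable_vertex_def)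
  have "card (snd w - {k} \<union> S) = card (snd w - {k}) + card S"
    using tip_Int[OF w(1) w_tip] w_stable(1) finite_S by (intro card_Un_disjoint) auto
  moreover have "card (snd w - {k}) = card (snd w) - 1"
    using w(2) by simp
  ultimately show ?thesis
    using w_stable S(2) finite_S by (simp add: True prune_vertex_w stable_vertex_def)
qed (use assms prune_vertex_other stable_graphD(3)[OF \<Gamma>(1)] in simp)

lemma stable_prune: "stable_graph (prune S h k \<Gamma>)"
  unfolding stable_graph_def
proof (intro conjI ballI impI)
  show "finite (verts (prune S h k \<Gamma>))"
    using stable_graphD(1)[OF \<Gamma>(1)] by simp
  have "prune_vertex S k w \<in> verts (prune S h k \<Gamma>)"
    using w(1) w_tip by simp
  then show "verts (prune S h k \<Gamma>) \<noteq> {}"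
    by (metis empty_iff)
  show "stable_vertex v" if "v \<in> verts (prune S h k \<Gamma>)" for v
    using that stable_prune_vertex by (metis DiffD1 imageE prune_simps(1))
  show "snd v \<inter> snd v' = {}"
    if vv: "v \<in> verts (prune S h k \<Gamma>)" "v' \<in> verts (prune S h k \<Gamma>)" "v \<noteq> v'" for v v'
  proof -
    obtain x y where "x \<in> verts \<Gamma>" "x \<noteq> (0, insert h S)" "v = prune_vertex S k x"
      "y \<in> verts \<Gamma>" "y \<noteq> (0, insert h S)" "v' = prune_vertex S k y"
      using vv(1,2) unfolding prune_simps by blast
    then show ?thesis
      using disjoint_prune_vertex vv(3) by metis
  qed
  show "card e = 2" if "e \<in> edges (prune S h k \<Gamma>)" for e
    using that stable_graphD(5)[OF \<Gamma>(1)] by simp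
  show "e \<subseteq> flags (prune S h k \<Gamma>)" if "e \<in> edges (prune S h k \<Gamma>)" for e
  proof -
    have "e \<inter> {h, k} = {}" "e \<subseteq> flags \<Gamma>"
      using that other_edge[of e] stable_graphD(6)[OF \<Gamma>(1), of e] by auto
    then show ?thesis
      unfolding flags_prune by blast
  qed
  show "e \<inter> e' = {}"
    if "e \<in> edges (prune S h k \<Gamma>)" "e' \<in> edges (prune S h k \<Gamma>)" "e \<noteq> e'" for e e'
    using that stable_graphD(7)[OF \<Gamma>(1)] by simp
  show "(v, v') \<in> (joined (prune S h k \<Gamma>) (edges (prune S h k \<Gamma>)))\<^sup>*"
    if vv: "v \<in> verts (prune S h k \<Gamma>)" "v' \<in> verts (prune S h k \<Gamma>)" for v v'
    by (rule connectedI[OF prune_connected vv])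
qed

lemma genus_one_prune: "prune S h k \<Gamma> \<in> genus_one n"
proof -
  have fin: "finite (verts \<Gamma>)" "finite (edges \<Gamma>)"
    using stable_graphD(1)[OF \<Gamma>(1)] finite_edges[OF \<Gamma>(1)] .
  have "Suc (card (edges (prune S h k \<Gamma>))) = card (edges \<Gamma>)"
    "Suc (card (verts (prune S h k \<Gamma>))) = card (verts \<Gamma>)"
    using card.remove[OF fin(2) edge(1)] card.remove[OF fin(1) tip(1)]
    by (simp_all add: card_image[OF inj_prune_vertex])
  moreover have "(\<Sum>v\<in>verts (prune S h k \<Gamma>). fst v) = (\<Sum>v\<in>verts \<Gamma>. fst v)"
    using sum.remove[OF fin(1) tip(1), of fst] by (simp add: sum.reindex[OF inj_prune_vertex])
  ultimately have "total_genus (prune S h k \<Gamma>) = 1"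
    using total_genus_eq_iff[OF stable_prune, of 1] total_genus_eq_iff[OF \<Gamma>(1), of 1] \<Gamma>(2)
    by (simp del: prune_simps)
  then show ?thesis
    using stable_prune legs_prune \<Gamma>(3) by (simp add: genus_one_def)
qed

lemma prune_vertex_w_mem: "prune_vertex S k w \<in> verts (prune S h k \<Gamma>)"
  using w(1) w_tip by simp

text \<open>If \<open>w\<close> became a cherry on receiving \<open>S\<close>, it would have had
  genus zero and at most the flags \<open>x\<close> and \<open>k\<close>, and so would have been
  unstable. Hence pruning lands exactly where grafting is allowed.\<close>

lemma no_cherry_prune: "\<not> cherry S (prune S h k \<Gamma>)"
proof
  assume "cherry S (prune S h k \<Gamma>)"
  then obtain x where x: "x \<notin> S" "(0, insert x S) \<in> verts (prune S h k \<Gamma>)"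
    by (auto simp: cherry_def)
  obtain s where "s \<in> S"
    using S_nonempty by blast
  then have eq: "(0, insert x S) = prune_vertex S k w"
    using vertex_unique[OF stable_prune x(2) prune_vertex_w_mem, of s] by (simp add: prune_vertex_w)
  then have "fst w = 0" "insert x S = snd w - {k} \<union> S"
    by (simp_all add: prune_vertex_w)
  moreover have "S \<inter> snd w = {}"
    using tip_Int[OF w(1) w_tip] by blast
  ultimately have "snd w \<subseteq> {x, k}"
    by blast
  then have "card (snd w) \<le> card {x, k}"
    by (intro card_mono) auto
  also have "\<dots> \<le> 2"
    by (simp add: card_insert_if)
  finally show False
    using stable_graphD(3)[OF \<Gamma>(1) w(1)] \<open>fst w = 0\<close> by (simp add: stable_vertex_def)
qed

lemma grafting_prune: "grafting n S h k (prune S h k \<Gamma>) (prune_vertex S k w)"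
  by unfold_locales
    (use genus_one_prune S prune_vertex_w_mem no_cherry_prune edge(2)
      in \<open>auto simp: prune_vertex_w flags_prune simp del: prune_simps\<close>)

end

text \<open>If \<open>h\<close> were a leg, the cherry would be the whole graph and the total genus
  would be zero. So \<open>h\<close> lies on an edge, which is the one to be contracted.\<close>

lemma cherry_pruning:
  assumes "\<Gamma> \<in> genus_one n" "S \<subseteq> {1..n}" "2 \<le> card S" "cherry S \<Gamma>"
  obtains h k w where "pruning n S h k \<Gamma> w"
proof -
  note \<Gamma> = genus_oneD[OF assms(1)]
  obtain h where h: "h \<notin> S" "(0, insert h S) \<in> verts \<Gamma>"
    using assms(4) by (auto simp: cherry_def)
  have "\<not> insert h S \<subseteq> legs \<Gamma>"
    using isolated_vertex[OF \<Gamma>(1) h(2)] \<Gamma>(2) by auto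
  then have "h \<notin> legs \<Gamma>"
    using assms(2) unfolding \<Gamma>(3) by blast
  moreover have "h \<in> flags \<Gamma>"
    using h(2) by (force simp: flags_def)
  ultimately obtain e where e: "e \<in> edges \<Gamma>" "h \<in> e"
    by (auto simp: legs_def)
  obtain k where k: "k \<noteq> h" "e = {h, k}"
    by (rule edge_partner[OF \<Gamma>(1) e])
  then have "k \<in> flags \<Gamma>"
    using stable_graphD(6)[OF \<Gamma>(1) e(1)] by blast
  then obtain w where "w \<in> verts \<Gamma>" "k \<in> snd w"
    by (rule flag_vertexE)
  then have "pruning n S h k \<Gamma> w"
    using assms h e k by unfold_locales auto
  then show ?thesis
    by (rule that)
qed

section \<open>Grafting and isomorphisms\<close>

lemma relabel_graft:
  assumes "inj_on f (flags \<Gamma>)" "S \<subseteq> flags \<Gamma>"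
  shows "relabel_graph f (graft S h k \<Gamma>) = graft (f ` S) (f h) (f k) (relabel_graph f \<Gamma>)"
proof (rule graph_eqI)
  have "relabel_vertex f (graft_vertex S k v) = graft_vertex (f ` S) (f k) (relabel_vertex f v)"
    if "v \<in> verts \<Gamma>" for v
  proof -
    have "S \<subseteq> snd v \<longleftrightarrow> f ` S \<subseteq> f ` snd v"
      using inj_on_image_mem_iff[OF assms(1) _ snd_subset_flags[OF that]] assms(2) by blast
    moreover have "f ` (snd v - S) = f ` snd v - f ` S"
      using inj_on_image_set_diff[OF assms(1) _ assms(2), of "snd v"] snd_subset_flags[OF that] by auto
    ultimately show ?thesis
      by (simp add: graft_vertex_def relabel_vertex_def)
  qed
  moreover have "relabel_vertex f (0, insert h S) = (0, insert (f h) (f ` S))"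
    by (simp add: relabel_vertex_def)
  ultimately show "verts (relabel_graph f (graft S h k \<Gamma>)) = verts (graft (f ` S) (f h) (f k) (relabel_graph f \<Gamma>))"
    by (simp add: image_image)
qed simp

text \<open>Pruning removes a vertex and an edge that are present in the graph; injectivity of the
  relabelling on vertices and edges lets the removal commute with taking images.\<close>

lemma relabel_prune:
  assumes "stable_graph \<Gamma>" "inj_on f (flags \<Gamma>)" "(0, insert h S) \<in> verts \<Gamma>" "{h, k} \<in> edges \<Gamma>"
  shows "relabel_graph f (prune S h k \<Gamma>) = prune (f ` S) (f h) (f k) (relabel_graph f \<Gamma>)"
proof (rule graph_eqI)
  have k: "k \<in> flags \<Gamma>"
    using stable_graphD(6)[OF assms(1,4)] by blast
  have "relabel_vertex f (prune_vertex S k v) = prune_vertex (f ` S) (f k) (relabel_vertex f v)"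
    if "v \<in> verts \<Gamma>" for v
  proof -
    have "k \<in> snd v \<longleftrightarrow> f k \<in> f ` snd v" "f ` (snd v - {k}) = f ` snd v - {f k}"
      using inj_on_image_mem_iff[OF assms(2) k snd_subset_flags[OF that]]
        inj_on_image_set_diff[OF assms(2), of "snd v" "{k}"] snd_subset_flags[OF that] k by auto
    then show ?thesis
      by (simp add: prune_vertex_def relabel_vertex_def image_Un)
  qed
  then have "relabel_vertex f ` prune_vertex S k ` (verts \<Gamma> - {(0, insert h S)})
      = prune_vertex (f ` S) (f k) ` relabel_vertex f ` (verts \<Gamma> - {(0, insert h S)})"
    unfolding image_image by (intro image_cong) auto
  moreover have "relabel_vertex f ` (verts \<Gamma> - {(0, insert h S)})
      = relabel_vertex f ` verts \<Gamma> - {(0, insert (f h) (f ` S))}"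
    using inj_on_image_set_diff[OF inj_on_relabel_vertex[OF assms(2)], of "verts \<Gamma>" "{(0, insert h S)}"] assms(3)
    by (simp add: relabel_vertex_def)
  ultimately show "verts (relabel_graph f (prune S h k \<Gamma>)) = verts (prune (f ` S) (f h) (f k) (relabel_graph f \<Gamma>))"
    unfolding relabel_graph_simps prune_simps by simp
  have "(`) f ` (edges \<Gamma> - {{h, k}}) = (`) f ` edges \<Gamma> - {{f h, f k}}"
    using inj_on_image_set_diff[OF inj_on_image_edges[OF assms(1,2)], of "edges \<Gamma>" "{{h, k}}"] assms(4)
    by simp
  then show "edges (relabel_graph f (prune S h k \<Gamma>)) = edges (prune (f ` S) (f h) (f k) (relabel_graph f \<Gamma>))"
    by simp
qed

context
  fixes n S h1 k1 \<Gamma>1 u1 h2 k2 \<Gamma>2 u2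
  assumes grafting1: "grafting n S h1 k1 \<Gamma>1 u1" and grafting2: "grafting n S h2 k2 \<Gamma>2 u2"
begin

interpretation g1: grafting n S h1 k1 \<Gamma>1 u1 by (rule grafting1)
interpretation g2: grafting n S h2 k2 \<Gamma>2 u2 by (rule grafting2)

lemma isom_image_S: "isom f \<Gamma>1 \<Gamma>2 \<or> isom f (graft S h1 k1 \<Gamma>1) (graft S h2 k2 \<Gamma>2) \<Longrightarrow> i \<in> S \<Longrightarrow> f i = i"
  using g1.S_legs g1.legs_graft by (auto simp: isom_def)

text \<open>The map is extended to the new edge flag by flag; freshness on both sides keeps it
  injective.\<close>

lemma isom_graft:
  assumes "isom f \<Gamma>1 \<Gamma>2"
  shows "isom (f(h1 := h2, k1 := k2)) (graft S h1 k1 \<Gamma>1) (graft S h2 k2 \<Gamma>2)"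
proof -
  let ?f = "f(h1 := h2, k1 := k2)"
  have f: "inj_on f (flags \<Gamma>1)" "\<forall>l\<in>legs \<Gamma>1. f l = l" "relabel_graph f \<Gamma>1 = \<Gamma>2"
    using assms by (auto simp: isom_def)
  have eq: "?f i = f i" if "i \<in> flags \<Gamma>1" for i
    using that g1.fresh by auto
  have inj1: "inj_on ?f (flags \<Gamma>1)"
    using f(1) inj_on_cong[of "flags \<Gamma>1" ?f f] eq by blast
  have "?f ` flags \<Gamma>1 = f ` flags \<Gamma>1"
    using eq by (intro image_cong) auto
  then have img: "?f ` flags \<Gamma>1 = flags \<Gamma>2"
    using f(3) flags_relabel by metis
  have ends: "?f h1 = h2" "?f k1 = k2"
    using g1.fresh(1) by simp_all
  have "h2 \<notin> ?f ` (insert k1 (flags \<Gamma>1))" "k2 \<notin> ?f ` flags \<Gamma>1"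
    unfolding image_insert img ends using g2.fresh by auto
  then have inj: "inj_on ?f (flags (graft S h1 k1 \<Gamma>1))"
    unfolding g1.flags_graft inj_on_insert ends using inj1 by blast
  have "?f ` S = id ` S"
    using g1.fresh_S isom_image_S[of f] assms by (intro image_cong) auto
  then have S: "?f ` S = S"
    by simp
  have "relabel_graph ?f \<Gamma>1 = \<Gamma>2"
    unfolding f(3)[symmetric] by (rule relabel_graph_cong[OF eq g1.\<Gamma>(1)])
  then have "relabel_graph ?f (graft S h1 k1 \<Gamma>1) = graft S h2 k2 \<Gamma>2"
    using relabel_graft[OF inj1 g1.S_flags, of h1 k1] unfolding S ends by simp
  moreover have "\<forall>l\<in>legs (graft S h1 k1 \<Gamma>1). ?f l = l"
    using f(2) g1.fresh legs_subset_flags[of \<Gamma>1] unfolding g1.legs_graft by auto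
  ultimately show ?thesis
    using inj by (simp add: isom_def)
qed

text \<open>The legs in \<open>S\<close> are fixed, so the vertex carrying them goes to the vertex
  carrying them. This determines the image of its remaining flag \<open>h1\<close>, then of the edge
  at \<open>h1\<close>, and then of \<open>k1\<close>. Removing the new vertices leaves an
  isomorphism of the original graphs.\<close>

lemma isom_graftD:
  assumes "isom f (graft S h1 k1 \<Gamma>1) (graft S h2 k2 \<Gamma>2)"
  shows "f h1 = h2" "f k1 = k2" "isom f \<Gamma>1 \<Gamma>2"
proof -
  have f: "inj_on f (flags (graft S h1 k1 \<Gamma>1))" "\<forall>l\<in>legs \<Gamma>1. f l = l"
    "relabel_graph f (graft S h1 k1 \<Gamma>1) = graft S h2 k2 \<Gamma>2"
    using assms by (auto simp: isom_def g1.legs_graft)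
  have "f ` S = id ` S"
    using isom_image_S[of f] assms by (intro image_cong) auto
  then have fS: "f ` S = S"
    by simp
  have tip1: "(0, insert h1 S) \<in> verts (graft S h1 k1 \<Gamma>1)" and edge1: "{h1, k1} \<in> edges (graft S h1 k1 \<Gamma>1)"
    and tip2: "(0, insert h2 S) \<in> verts (graft S h2 k2 \<Gamma>2)" and edge2: "{h2, k2} \<in> edges (graft S h2 k2 \<Gamma>2)"
    by simp_all
  have flags1: "h1 \<in> flags (graft S h1 k1 \<Gamma>1)" "k1 \<in> flags (graft S h1 k1 \<Gamma>1)"
    "S \<subseteq> flags (graft S h1 k1 \<Gamma>1)"
    using g1.S_flags by (auto simp: g1.flags_graft)
  have "relabel_vertex f (0, insert h1 S) \<in> verts (graft S h2 k2 \<Gamma>2)"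
    using tip1 f(3) relabel_graph_simps(1) by (metis imageI)
  then have "(0, insert (f h1) S) \<in> verts (graft S h2 k2 \<Gamma>2)"
    using fS by (simp add: relabel_vertex_def)
  then have "(0 :: nat, insert (f h1) S) = (0, insert h2 S)"
    using vertex_unique[OF g2.stable_graft _ tip2] g1.S_nonempty by fastforce
  moreover have "f h1 \<notin> S"
    using inj_on_image_mem_iff[OF f(1) flags1(1,3)] fS g1.fresh_S by simp
  ultimately show h: "f h1 = h2"
    by auto
  have "f ` {h1, k1} \<in> edges (graft S h2 k2 \<Gamma>2)"
    using edge1 f(3) relabel_graph_simps(2) by (metis imageI)
  then have "{h2, f k1} = {h2, k2}"
    using edge_unique[OF g2.stable_graft _ edge2, of _ h2] h by simp
  moreover have "f k1 \<noteq> h2"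
    using inj_onD[OF f(1) _ flags1(2,1)] h g1.fresh(1) by auto
  ultimately show k: "f k1 = k2"
    by (auto simp: doubleton_eq_iff)
  have "relabel_graph f \<Gamma>1 = relabel_graph f (prune S h1 k1 (graft S h1 k1 \<Gamma>1))"
    by (simp only: g1.prune_graft)
  also have "\<dots> = \<Gamma>2"
    unfolding relabel_prune[OF g1.stable_graft f(1) tip1 edge1] f(3) h k fS by (rule g2.prune_graft)
  finally show "isom f \<Gamma>1 \<Gamma>2"
    using inj_on_subset[OF f(1), of "flags \<Gamma>1"] f(2) by (auto simp: isom_def g1.flags_graft)
qed

lemma isomorphic_graft_iff:
  "isomorphic (graft S h1 k1 \<Gamma>1) (graft S h2 k2 \<Gamma>2) \<longleftrightarrow> isomorphic \<Gamma>1 \<Gamma>2"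
  using isom_graft isom_graftD(3) by (auto simp: isomorphic_def)

end

text \<open>Every automorphism of the grafting fixes the new edge, so passing between the two graphs
  only adds or removes a fixed point of the edge permutation.\<close>

lemma odd_graft_iff:
  assumes "grafting n S h k \<Gamma> u"
  shows "odd_graph (graft S h k \<Gamma>) \<longleftrightarrow> odd_graph \<Gamma>"
proof -
  interpret grafting n S h k \<Gamma> u by (rule assms)
  have eq: "edge_perm g (graft S h k \<Gamma>) = edge_perm f \<Gamma>"
    if "\<And>i. i \<in> flags \<Gamma> \<Longrightarrow> g i = f i" "g h = h" "g k = k" for f g
  proof
    fix e
    have "g ` e = f ` e" if "e \<in> edges \<Gamma>"
      using edge_flags[OF that] \<open>\<And>i. i \<in> flags \<Gamma> \<Longrightarrow> g i = f i\<close> by (intro image_cong) auto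
    then show "edge_perm g (graft S h k \<Gamma>) e = edge_perm f \<Gamma> e"
      using that(2,3) new_edge by (auto simp: edge_perm_def)
  qed
  show ?thesis
  proof
    assume "odd_graph (graft S h k \<Gamma>)"
    then obtain f where f: "isom f (graft S h k \<Gamma>) (graft S h k \<Gamma>)" "sign (edge_perm f (graft S h k \<Gamma>)) = - 1"
      by (auto simp: odd_graph_def)
    note * = isom_graftD[OF assms assms f(1)]
    show "odd_graph \<Gamma>"
      using *(3) f(2) eq[of f f, OF refl *(1,2)] by (auto simp: odd_graph_def)
  next
    assume "odd_graph \<Gamma>"
    then obtain f where f: "isom f \<Gamma> \<Gamma>" "sign (edge_perm f \<Gamma>) = - 1"
      by (auto simp: odd_graph_def)
    let ?g = "f(h := h, k := k)"
    have "edge_perm ?g (graft S h k \<Gamma>) = edge_perm f \<Gamma>"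
      using fresh by (intro eq) auto
    then show "odd_graph (graft S h k \<Gamma>)"
      using isom_graft[OF assms assms f(1)] f(2) unfolding odd_graph_def by metis
  qed
qed

section \<open>The signed count\<close>

definition same_vertex :: "graph \<Rightarrow> (nat \<times> nat) set" where
  "same_vertex \<Gamma> = {(i, j). i \<in> legs \<Gamma> \<and> j \<in> legs \<Gamma> \<and> (\<exists>v\<in>verts \<Gamma>. i \<in> snd v \<and> j \<in> snd v)}"

lemma same_vertex_iff:
  "(i, j) \<in> same_vertex \<Gamma> \<longleftrightarrow> i \<in> legs \<Gamma> \<and> j \<in> legs \<Gamma> \<and> (\<exists>v\<in>verts \<Gamma>. i \<in> snd v \<and> j \<in> snd v)"
  by (simp add: same_vertex_def)

lemma same_vertex_isomorphic:
  assumes "stable_graph \<Gamma>" "isomorphic \<Gamma> \<Delta>"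
  shows "same_vertex \<Delta> = same_vertex \<Gamma>"
proof -
  have sub: "same_vertex \<Gamma> \<subseteq> same_vertex \<Delta>" if "stable_graph \<Gamma>" "isom f \<Gamma> \<Delta>" for f \<Gamma> \<Delta>
  proof (rule subrelI)
    fix i j assume "(i, j) \<in> same_vertex \<Gamma>"
    then obtain v where v: "i \<in> legs \<Gamma>" "j \<in> legs \<Gamma>" "v \<in> verts \<Gamma>" "i \<in> snd v" "j \<in> snd v"
      by (auto simp: same_vertex_iff)
    have "f i = i" "f j = j" "relabel_vertex f v \<in> verts \<Delta>"
      using that(2) v(1-3) by (auto simp: isom_def)
    moreover have "f i \<in> snd (relabel_vertex f v)" "f j \<in> snd (relabel_vertex f v)"
      using v(4,5) by simp_all
    ultimately show "(i, j) \<in> same_vertex \<Delta>"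
      using v(1,2) isom_legs[OF that] unfolding same_vertex_iff by metis
  qed
  obtain f where f: "isom f \<Gamma> \<Delta>"
    using assms(2) by (auto simp: isomorphic_def)
  show ?thesis
    using sub[OF assms(1) f] sub[OF isomorphic_stable[OF assms] isom_inverse[OF assms(1) f]] by blast
qed

lemma equiv_same_vertex:
  assumes "stable_graph \<Gamma>"
  shows "equiv (legs \<Gamma>) (same_vertex \<Gamma>)"
proof (rule equivI)
  show "same_vertex \<Gamma> \<subseteq> legs \<Gamma> \<times> legs \<Gamma>"
    by (auto simp: same_vertex_iff)
  show "refl_on (legs \<Gamma>) (same_vertex \<Gamma>)"
    using legs_subset_flags[of \<Gamma>] by (auto simp: refl_on_def same_vertex_iff flags_def)
  show "sym (same_vertex \<Gamma>)"
    unfolding sym_def same_vertex_iff by blast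
  show "trans (same_vertex \<Gamma>)"
    unfolding trans_def same_vertex_iff using vertex_unique[OF assms] by metis
qed

lemma cherry_isomorphic:
  assumes "stable_graph \<Gamma>" "isomorphic \<Gamma> \<Delta>" "S \<subseteq> legs \<Gamma>" "cherry S \<Gamma>"
  shows "cherry S \<Delta>"
proof -
  obtain f where f: "inj_on f (flags \<Gamma>)" "\<And>l. l \<in> legs \<Gamma> \<Longrightarrow> f l = l" "relabel_graph f \<Gamma> = \<Delta>"
    using assms(2) by (auto simp: isomorphic_def isom_def)
  obtain h where h: "h \<notin> S" "(0, insert h S) \<in> verts \<Gamma>"
    using assms(4) by (auto simp: cherry_def)
  have "f ` S = id ` S"
    using f(2) assms(3) by (intro image_cong) auto
  then have fS: "f ` S = S"
    by simp
  have "relabel_vertex f (0, insert h S) \<in> verts \<Delta>"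
    using h(2) f(3) by (metis imageI relabel_graph_simps(1))
  moreover have "h \<in> flags \<Gamma>" "S \<subseteq> flags \<Gamma>"
    using h(2) assms(3) legs_subset_flags by (force simp: flags_def)+
  then have "f h \<notin> S"
    using inj_on_image_mem_iff[OF f(1), of h S] fS h(1) by simp
  ultimately show ?thesis
    using fS by (auto simp: cherry_def relabel_vertex_def)
qed

text \<open>One graph for each isomorphism class that can support a nonzero cochain; this is the
  index set of a basis.\<close>

definition reps :: "nat \<Rightarrow> graph set" where
  "reps n = {\<Gamma> \<in> rep ` genus_one n. \<not> odd_graph \<Gamma>}"

lemma finite_even_reps: "finite (reps n)"
  unfolding reps_def using finite_reps by simp

lemma repsD:
  assumes "\<Gamma> \<in> reps n"
  shows "\<Gamma> \<in> genus_one n" "rep \<Gamma> = \<Gamma>" "\<not> odd_graph \<Gamma>"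
  using assms rep_genus_one rep_rep by (auto simp: reps_def)

lemma rep_mem_reps:
  assumes "\<Gamma> \<in> genus_one n" "\<not> odd_graph \<Gamma>"
  shows "rep \<Gamma> \<in> reps n"
proof -
  note s = genus_oneD(1)[OF assms(1)]
  have "\<not> odd_graph (rep \<Gamma>)"
    using odd_graph_isomorphic[OF isomorphic_stable[OF s isomorphic_rep[OF s]]
        isomorphic_sym[OF s isomorphic_rep[OF s]]] assms(2) by blast
  then show ?thesis
    using assms(1) by (simp add: reps_def)
qed

definition weight :: "graph \<Rightarrow> int" where
  "weight \<Gamma> = (- 1) ^ card (edges \<Gamma>)"

lemma grafting_exists:
  assumes "\<Gamma> \<in> genus_one n" "equiv {1..n} Q" "S \<in> {1..n} // Q" "2 \<le> card S"
    "Q \<subseteq> same_vertex \<Gamma>" "\<not> cherry S \<Gamma>" "fresh_pair h k (flags \<Gamma>)"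
  obtains u where "grafting n S h k \<Gamma> u"
proof -
  note \<Gamma> = genus_oneD[OF assms(1)]
  obtain i where i: "i \<in> {1..n}" "S = Q `` {i}"
    using assms(3) by (auto elim: quotientE)
  have "i \<in> flags \<Gamma>"
    using i(1) \<Gamma>(3) legs_subset_flags by blast
  then obtain u where u: "u \<in> verts \<Gamma>" "i \<in> snd u"
    by (rule flag_vertexE)
  have "j \<in> snd u" if j: "j \<in> S" for j
  proof -
    have "(i, j) \<in> same_vertex \<Gamma>"
      using j i(2) assms(5) by blast
    then obtain v where "v \<in> verts \<Gamma>" "i \<in> snd v" "j \<in> snd v"
      by (auto simp: same_vertex_iff)
    then show ?thesis
      using vertex_unique[OF \<Gamma>(1) _ u(1) _ u(2)] by blast
  qed
  moreover have "S \<subseteq> {1..n}"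
    using in_quotient_imp_subset[OF assms(2,3)] .
  ultimately have "grafting n S h k \<Gamma> u"
    using assms u by unfold_locales (auto simp: fresh_pair_def)
  then show ?thesis
    by (rule that)
qed

text \<open>Since \<open>S\<close> is a class, \<open>Q\<close> relates legs that are both in
  \<open>S\<close> or both outside. The former share a vertex before and after grafting, and the
  latter are not moved.\<close>

lemma same_vertex_grafting_iff:
  assumes "grafting n S h k \<Gamma> u" "equiv {1..n} Q" "S \<in> {1..n} // Q"
  shows "Q \<subseteq> same_vertex (graft S h k \<Gamma>) \<longleftrightarrow> Q \<subseteq> same_vertex \<Gamma>"
proof -
  interpret grafting n S h k \<Gamma> u by (rule assms)
  have Q: "i \<in> legs \<Gamma>" "j \<in> legs \<Gamma>" "i \<in> S \<longleftrightarrow> j \<in> S" if "(i, j) \<in> Q" for i j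
  proof -
    have "Q \<subseteq> {1..n} \<times> {1..n}" "sym Q" "trans Q"
      using assms(2) by (auto simp: equiv_def refl_on_def)
    then show "i \<in> legs \<Gamma>" "j \<in> legs \<Gamma>"
      using that \<Gamma>(3) by auto
    obtain l where "S = Q `` {l}"
      using assms(3) by (auto elim: quotientE)
    then show "i \<in> S \<longleftrightarrow> j \<in> S"
      using that \<open>sym Q\<close> \<open>trans Q\<close> by (auto dest: symD transD)
  qed
  have "(i, j) \<in> same_vertex (graft S h k \<Gamma>) \<longleftrightarrow> (i, j) \<in> same_vertex \<Gamma>" if ij: "(i, j) \<in> Q" for i j
  proof (cases "i \<in> S")
    case True
    then have "i \<in> S" "j \<in> S"
      using Q(3)[OF ij] by simp_all
    then have "(i, j) \<in> same_vertex \<Gamma>" "(i, j) \<in> same_vertex (graft S h k \<Gamma>)"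
      using Q(1,2)[OF ij] u by (auto simp: same_vertex_iff legs_graft)
    then show ?thesis
      by simp
  next
    case False
    then have "i \<in> flags \<Gamma> - S" "j \<in> flags \<Gamma> - S"
      using Q[OF ij] legs_subset_flags by auto
    then show ?thesis
      using same_vertex_graft by (simp add: same_vertex_iff legs_graft del: graft_simps)
  qed
  then show ?thesis
    by auto
qed

text \<open>Moving \<open>S\<close> to a new vertex, or back, matches the graphs with \<open>S\<close> on one vertex in pairs of opposite sign.\<close>

lemma sum_weight_coarse:
  assumes "equiv {1..n} Q" "S \<in> {1..n} // Q" "2 \<le> card S"
  shows "(\<Sum>\<Gamma> | \<Gamma> \<in> reps n \<and> Q \<subseteq> same_vertex \<Gamma>. weight \<Gamma>) = 0"
proof -
  define C where "C b = {\<Gamma> \<in> reps n. Q \<subseteq> same_vertex \<Gamma> \<and> cherry S \<Gamma> = b}" for b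
  have S: "S \<subseteq> {1..n}"
    using in_quotient_imp_subset[OF assms(1,2)] .
  have "\<exists>p. fresh_pair (fst p) (snd p) (flags \<Gamma>)" if "stable_graph \<Gamma>" for \<Gamma>
    using fresh_pair_exists[OF finite_flags[OF that]] by (metis fst_conv snd_conv)
  then obtain p where p: "\<And>\<Gamma>. stable_graph \<Gamma> \<Longrightarrow> fresh_pair (fst (p \<Gamma>)) (snd (p \<Gamma>)) (flags \<Gamma>)"
    by metis
  define F where "F \<Gamma> = graft S (fst (p \<Gamma>)) (snd (p \<Gamma>)) \<Gamma>" for \<Gamma>
  have graftingE: "\<exists>u. grafting n S (fst (p \<Gamma>)) (snd (p \<Gamma>)) \<Gamma> u" if "\<Gamma> \<in> C False" for \<Gamma>
  proof -
    have "\<Gamma> \<in> genus_one n" "Q \<subseteq> same_vertex \<Gamma>" "\<not> cherry S \<Gamma>"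
      using that repsD by (auto simp: C_def)
    then show ?thesis
      using grafting_exists[OF _ assms _ _ p] genus_oneD(1) by metis
  qed
  have mem: "rep (F \<Gamma>) \<in> C True" "card (edges (rep (F \<Gamma>))) = Suc (card (edges \<Gamma>))" "stable_graph (F \<Gamma>)"
    if in_C: "\<Gamma> \<in> C False" for \<Gamma>
  proof -
    obtain u where gr: "grafting n S (fst (p \<Gamma>)) (snd (p \<Gamma>)) \<Gamma> u"
      using graftingE[OF in_C] by blast
    interpret grafting n S "fst (p \<Gamma>)" "snd (p \<Gamma>)" \<Gamma> u by (rule gr)
    have iso: "isomorphic (F \<Gamma>) (rep (F \<Gamma>))"
      unfolding F_def by (rule isomorphic_rep[OF stable_graft])
    have "rep (F \<Gamma>) \<in> reps n"
      unfolding F_def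
      by (rule rep_mem_reps[OF genus_one_graft]) (use in_C odd_graft_iff[OF gr] repsD(3) in \<open>auto simp: C_def\<close>)
    moreover have "Q \<subseteq> same_vertex (rep (F \<Gamma>))"
      using same_vertex_isomorphic[OF stable_graft] iso same_vertex_grafting_iff[OF gr assms(1,2)] in_C
      by (simp add: F_def C_def)
    moreover have "cherry S (rep (F \<Gamma>))"
      by (rule cherry_isomorphic[OF stable_graft iso[unfolded F_def] _ cherry_graft, folded F_def])
        (simp add: F_def legs_graft S_legs)
    ultimately show "rep (F \<Gamma>) \<in> C True"
      by (simp add: C_def)
    show "card (edges (rep (F \<Gamma>))) = Suc (card (edges \<Gamma>))"
      using isomorphic_card_edges[OF stable_graft iso[unfolded F_def]] card_edges_graft
      by (simp add: F_def del: graft_simps)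
    show "stable_graph (F \<Gamma>)"
      unfolding F_def by (rule stable_graft)
  qed
  have "bij_betw (\<lambda>\<Gamma>. rep (F \<Gamma>)) (C False) (C True)"
  proof (rule bij_betwI')
    fix \<Gamma> \<Delta> assume *: "\<Gamma> \<in> C False" "\<Delta> \<in> C False"
    obtain u u' where u: "grafting n S (fst (p \<Gamma>)) (snd (p \<Gamma>)) \<Gamma> u"
      "grafting n S (fst (p \<Delta>)) (snd (p \<Delta>)) \<Delta> u'"
      using graftingE * by blast
    have **: "\<Gamma> \<in> reps n" "\<Delta> \<in> reps n"
      using * by (auto simp: C_def)
    \<comment> \<open>Injectivity on classes: an isomorphism of graftings restricts to one of the
      graphs, and both graphs are chosen representatives.\<close>
    have "\<Gamma> = \<Delta>" if "rep (F \<Gamma>) = rep (F \<Delta>)"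
    proof -
      have "isomorphic \<Gamma> \<Delta>"
        using rep_eqD[OF mem(3) mem(3) that] * isomorphic_graft_iff[OF u] by (simp add: F_def)
      then show ?thesis
        using rep_eq genus_oneD(1)[OF repsD(1)] repsD(2) ** by metis
    qed
    then show "rep (F \<Gamma>) = rep (F \<Delta>) \<longleftrightarrow> \<Gamma> = \<Delta>"
      by blast
  next
    show "rep (F \<Gamma>) \<in> C True" if "\<Gamma> \<in> C False" for \<Gamma>
      by (rule mem(1)[OF that])
  next
    fix \<Delta> assume \<Delta>: "\<Delta> \<in> C True"
    then have \<Delta>': "\<Delta> \<in> genus_one n" "rep \<Delta> = \<Delta>" "\<not> odd_graph \<Delta>" "cherry S \<Delta>" "Q \<subseteq> same_vertex \<Delta>"
      using repsD by (auto simp: C_def)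
    obtain h k w where "pruning n S h k \<Delta> w"
      by (rule cherry_pruning[OF \<Delta>'(1) S assms(3) \<Delta>'(4)])
    then interpret pruning n S h k \<Delta> w .
    let ?\<Theta> = "prune S h k \<Delta>"
    have iso: "isomorphic ?\<Theta> (rep ?\<Theta>)"
      by (rule isomorphic_rep[OF stable_prune])
    have iso': "isomorphic (rep ?\<Theta>) ?\<Theta>"
      by (rule isomorphic_sym[OF stable_prune iso])
    have stable_rep: "stable_graph (rep ?\<Theta>)"
      by (rule isomorphic_stable[OF stable_prune iso])
    have "\<not> odd_graph ?\<Theta>"
      using odd_graft_iff[OF grafting_prune] \<Delta>'(3) graft_prune by simp
    then have "rep ?\<Theta> \<in> reps n"
      by (rule rep_mem_reps[OF genus_one_prune])
    moreover have "Q \<subseteq> same_vertex (rep ?\<Theta>)"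
      using same_vertex_isomorphic[OF stable_prune iso]
        same_vertex_grafting_iff[OF grafting_prune assms(1,2)] \<Delta>'(5) graft_prune by simp
    moreover have "\<not> cherry S (rep ?\<Theta>)"
      using cherry_isomorphic[OF stable_rep iso'] no_cherry_prune isom_legs[OF stable_prune] iso S_legs
        legs_prune by (auto simp: isomorphic_def)
    ultimately have C: "rep ?\<Theta> \<in> C False"
      by (simp add: C_def)
    then obtain u where u: "grafting n S (fst (p (rep ?\<Theta>))) (snd (p (rep ?\<Theta>))) (rep ?\<Theta>) u"
      using graftingE by blast
    \<comment> \<open>The flags chosen for grafting the representative need not be the ones that
      were pruned, but by \<open>isomorphic_graft_iff\<close> the isomorphism class does not depend
      on them.\<close>
    have "isomorphic (F (rep ?\<Theta>)) \<Delta>"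
      using isomorphic_graft_iff[OF u grafting_prune] iso' graft_prune by (simp add: F_def)
    then have "\<Delta> = rep (F (rep ?\<Theta>))"
      using rep_eq[OF mem(3)[OF C]] \<Delta>'(2) by simp
    then show "\<exists>\<Gamma>\<in>C False. \<Delta> = rep (F \<Gamma>)"
      using C by blast
  qed
  then have "(\<Sum>\<Gamma>\<in>C True. weight \<Gamma>) = (\<Sum>\<Gamma>\<in>C False. weight (rep (F \<Gamma>)))"
    by (rule sum.reindex_bij_betw[symmetric])
  also have "\<dots> = (\<Sum>\<Gamma>\<in>C False. - weight \<Gamma>)"
    by (rule sum.cong) (simp_all add: weight_def mem(2))
  finally have "(\<Sum>\<Gamma>\<in>C True. weight \<Gamma>) + (\<Sum>\<Gamma>\<in>C False. weight \<Gamma>) = 0"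
    by (simp add: sum_negf)
  moreover have "{\<Gamma>. \<Gamma> \<in> reps n \<and> Q \<subseteq> same_vertex \<Gamma>} = C True \<union> C False" "C True \<inter> C False = {}"
    by (auto simp: C_def)
  moreover have "finite (C b)" for b
    using finite_even_reps by (simp add: C_def)
  ultimately show ?thesis
    by (simp add: sum.union_disjoint)
qed

text \<open>The graphs counted by \<open>sum_weight_coarse\<close> are sorted by their exact
  relation \<open>R\<close>, which contains \<open>Q\<close>. Strictly larger relations contribute
  zero by induction, from coarse to fine, so the part with \<open>R = Q\<close> vanishes too. As
  \<open>Q\<close> is not the identity, it has a class with two elements to which the pairing
  applies.\<close>

lemma sum_weight_class:
  assumes "equiv {1..n} Q" "Q \<noteq> Id_on {1..n}"
  shows "(\<Sum>\<Gamma> | \<Gamma> \<in> reps n \<and> same_vertex \<Gamma> = Q. weight \<Gamma>) = 0"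
  using assms
proof (induction "card ({1..n} \<times> {1..n} - Q)" arbitrary: Q rule: less_induct)
  case less
  have Q: "Q \<subseteq> {1..n} \<times> {1..n}" "refl_on {1..n} Q"
    using less.prems(1) by (auto simp: equiv_def refl_on_def)
  then have "Id_on {1..n} \<subseteq> Q"
    by (auto simp: refl_on_def)
  moreover have "Q \<subseteq> Id_on {1..n}" if "\<forall>i j. (i, j) \<in> Q \<longrightarrow> i = j"
    using Q(1) that by (intro subrelI) (metis Id_onI SigmaD1 subsetD)
  ultimately obtain i j where ij: "(i, j) \<in> Q" "i \<noteq> j"
    using less.prems(2) by blast
  let ?S = "Q `` {i}"
  have S: "?S \<in> {1..n} // Q"
    using ij Q(1) by (auto intro: quotientI)
  have "{i, j} \<subseteq> ?S" "finite ?S"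
    using ij Q finite_subset[of ?S "{1..n}"] by (auto simp: refl_on_def)
  then have "2 \<le> card ?S"
    using card_mono[of ?S "{i, j}"] ij(2) by simp
  then have "0 = (\<Sum>\<Gamma> | \<Gamma> \<in> reps n \<and> Q \<subseteq> same_vertex \<Gamma>. weight \<Gamma>)"
    using sum_weight_coarse[OF less.prems(1) S] by simp
  also have "\<dots> = (\<Sum>R\<in>{R \<in> same_vertex ` reps n. Q \<subseteq> R}. \<Sum>\<Gamma> | \<Gamma> \<in> reps n \<and> same_vertex \<Gamma> = R. weight \<Gamma>)"
  proof -
    have "(\<Sum>R\<in>{R \<in> same_vertex ` reps n. Q \<subseteq> R}.
        \<Sum>\<Gamma> | \<Gamma> \<in> {\<Gamma> \<in> reps n. Q \<subseteq> same_vertex \<Gamma>} \<and> same_vertex \<Gamma> = R. weight \<Gamma>)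
      = (\<Sum>\<Gamma>\<in>{\<Gamma> \<in> reps n. Q \<subseteq> same_vertex \<Gamma>}. weight \<Gamma>)"
      by (rule sum.group) (use finite_even_reps in auto)
    moreover have "{\<Gamma>. \<Gamma> \<in> {\<Gamma> \<in> reps n. Q \<subseteq> same_vertex \<Gamma>} \<and> same_vertex \<Gamma> = R}
        = {\<Gamma>. \<Gamma> \<in> reps n \<and> same_vertex \<Gamma> = R}" if "Q \<subseteq> R" for R
      using that by auto
    ultimately show ?thesis
      by simp
  qed
  also have "\<dots> = (\<Sum>R\<in>{R \<in> same_vertex ` reps n. Q \<subseteq> R}.
      if R = Q then \<Sum>\<Gamma> | \<Gamma> \<in> reps n \<and> same_vertex \<Gamma> = Q. weight \<Gamma> else 0)"
  proof (rule sum.cong[OF refl])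
    fix R assume R: "R \<in> {R \<in> same_vertex ` reps n. Q \<subseteq> R}"
    then obtain \<Gamma> where \<Gamma>: "\<Gamma> \<in> reps n" "R = same_vertex \<Gamma>"
      by blast
    have eqv: "equiv {1..n} R"
      using equiv_same_vertex[OF genus_oneD(1)[OF repsD(1)[OF \<Gamma>(1)]]] genus_oneD(3)[OF repsD(1)[OF \<Gamma>(1)]] \<Gamma>(2)
      by simp
    have "(\<Sum>\<Gamma> | \<Gamma> \<in> reps n \<and> same_vertex \<Gamma> = R. weight \<Gamma>) = 0" if "R \<noteq> Q"
    proof (rule less.hyps[OF _ eqv])
      have "R \<subseteq> {1..n} \<times> {1..n}"
        using eqv by (auto simp: equiv_def refl_on_def)
      then have "{1..n} \<times> {1..n} - R \<subset> {1..n} \<times> {1..n} - Q"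
        using R that by blast
      then show "card ({1..n} \<times> {1..n} - R) < card ({1..n} \<times> {1..n} - Q)"
        by (intro psubset_card_mono) auto
      show "R \<noteq> Id_on {1..n}"
        using R ij by auto
    qed
    then show "(\<Sum>\<Gamma> | \<Gamma> \<in> reps n \<and> same_vertex \<Gamma> = R. weight \<Gamma>)
        = (if R = Q then \<Sum>\<Gamma> | \<Gamma> \<in> reps n \<and> same_vertex \<Gamma> = Q. weight \<Gamma> else 0)"
      by simp
  qed
  also have "\<dots> = (\<Sum>\<Gamma> | \<Gamma> \<in> reps n \<and> same_vertex \<Gamma> = Q. weight \<Gamma>)"
  proof (cases "Q \<in> same_vertex ` reps n")
    case False
    then have "{\<Gamma>. \<Gamma> \<in> reps n \<and> same_vertex \<Gamma> = Q} = {}"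
      by blast
    then show ?thesis
      by (simp only: sum.empty if_cancel sum.neutral_const)
  qed (use finite_even_reps in simp)
  finally show ?case ..
qed

lemma sum_weight_reps:
  "(\<Sum>\<Gamma>\<in>reps n. weight \<Gamma>) = (\<Sum>\<Gamma> | \<Gamma> \<in> reps n \<and> same_vertex \<Gamma> = Id_on {1..n}. weight \<Gamma>)"
proof -
  have "(\<Sum>\<Gamma>\<in>reps n. weight \<Gamma>)
      = (\<Sum>R\<in>insert (Id_on {1..n}) (same_vertex ` reps n). \<Sum>\<Gamma> | \<Gamma> \<in> reps n \<and> same_vertex \<Gamma> = R. weight \<Gamma>)"
    by (rule sum.group[symmetric]) (use finite_even_reps in auto)
  also have "\<dots> = (\<Sum>R\<in>{Id_on {1..n}}. \<Sum>\<Gamma> | \<Gamma> \<in> reps n \<and> same_vertex \<Gamma> = R. weight \<Gamma>)"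
  proof (rule sum.mono_neutral_right)
    show "\<forall>R\<in>insert (Id_on {1..n}) (same_vertex ` reps n) - {Id_on {1..n}}.
        (\<Sum>\<Gamma> | \<Gamma> \<in> reps n \<and> same_vertex \<Gamma> = R. weight \<Gamma>) = 0"
    proof
      fix R assume "R \<in> insert (Id_on {1..n}) (same_vertex ` reps n) - {Id_on {1..n}}"
      then obtain \<Gamma> where \<Gamma>: "\<Gamma> \<in> reps n" "R = same_vertex \<Gamma>" "R \<noteq> Id_on {1..n}"
        by blast
      have "equiv {1..n} R"
        using equiv_same_vertex[OF genus_oneD(1)[OF repsD(1)[OF \<Gamma>(1)]]] genus_oneD(3)[OF repsD(1)[OF \<Gamma>(1)]] \<Gamma>(2)
        by simp
      then show "(\<Sum>\<Gamma> | \<Gamma> \<in> reps n \<and> same_vertex \<Gamma> = R. weight \<Gamma>) = 0"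
        using \<Gamma>(3) by (rule sum_weight_class)
    qed
  qed (use finite_even_reps in auto)
  finally show ?thesis
    by simp
qed

section \<open>Cycles with one leg at each vertex\<close>

text \<open>Positions are taken modulo \<open>n\<close>: \<open>a p\<close> is the flag through
  which the cycle enters position \<open>p\<close>, and \<open>b p\<close> the flag through which it
  leaves.\<close>

definition cyc :: "nat \<Rightarrow> (nat \<Rightarrow> nat) \<Rightarrow> (nat \<Rightarrow> nat) \<Rightarrow> (nat \<Rightarrow> nat) \<Rightarrow> graph" where
  "cyc n l a b = \<lparr>verts = (\<lambda>p. (0, {l p, a p, b p})) ` {..<n},
     edges = (\<lambda>p. {b p, a (Suc p mod n)}) ` {..<n}\<rparr>"

lemma cyc_simps [simp]:
  "verts (cyc n l a b) = (\<lambda>p. (0, {l p, a p, b p})) ` {..<n}"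
  "edges (cyc n l a b) = (\<lambda>p. {b p, a (Suc p mod n)}) ` {..<n}"
  by (simp_all add: cyc_def)

lemma cyc_cong:
  assumes "\<And>p. p < n \<Longrightarrow> l p = l' p" "\<And>p. p < n \<Longrightarrow> a p = a' p" "\<And>p. p < n \<Longrightarrow> b p = b' p"
  shows "cyc n l a b = cyc n l' a' b'"
proof (rule graph_eqI)
  show "verts (cyc n l a b) = verts (cyc n l' a' b')"
    unfolding cyc_simps by (rule image_cong) (use assms in auto)
  show "edges (cyc n l a b) = edges (cyc n l' a' b')"
    unfolding cyc_simps by (rule image_cong) (use assms in auto)
qed

lemma relabel_cyc: "relabel_graph f (cyc n l a b) = cyc n (f \<circ> l) (f \<circ> a) (f \<circ> b)"
  by (rule graph_eqI) (simp_all add: image_image relabel_vertex_def)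

lemma inj_on_Suc_mod: "inj_on (\<lambda>p. Suc p mod n) {..<n}"
  by (auto simp: inj_on_def mod_Suc split: if_splits)

lemma Suc_mod_image: "(\<lambda>p. Suc p mod n) ` {..<n} = {..<n}"
  by (rule endo_inj_surj[OF finite_lessThan _ inj_on_Suc_mod]) auto

text \<open>The reflection of the positions modulo \<open>n\<close> that fixes position 0.\<close>

definition turn :: "nat \<Rightarrow> nat \<Rightarrow> nat" where
  "turn n p = (n - p) mod n"

lemma turn_less: "p < n \<Longrightarrow> turn n p < n"
  by (simp add: turn_def)

lemma turn_turn: "p < n \<Longrightarrow> turn n (turn n p) = p"
  by (cases "p = 0") (simp_all add: turn_def)

lemma turn_image: "turn n ` {..<n} = {..<n}"
  using turn_less turn_turn by (auto simp: image_iff) (metis lessThan_iff)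

lemma turn_Suc_mod: "p < n \<Longrightarrow> Suc (turn n (Suc p mod n)) mod n = turn n p"
  by (cases "Suc p = n"; cases "p = 0") (auto simp: turn_def Suc_diff_Suc)

text \<open>Traversing the cycle backwards exchanges the entering and the leaving flags.\<close>

lemma cyc_turn: "cyc n (l \<circ> turn n) (b \<circ> turn n) (a \<circ> turn n) = cyc n l a b"
proof (rule graph_eqI)
  have "(\<lambda>p. (0 :: nat, {l (turn n p), b (turn n p), a (turn n p)})) ` {..<n}
      = (\<lambda>p. (0, {l p, a p, b p})) ` turn n ` {..<n}"
    by (auto simp: image_image insert_commute)
  then show "verts (cyc n (l \<circ> turn n) (b \<circ> turn n) (a \<circ> turn n)) = verts (cyc n l a b)"
    by (simp add: turn_image)
  have "{a (turn n p), b (turn n (Suc p mod n))}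
      = (\<lambda>q. {b q, a (Suc q mod n)}) (turn n (Suc p mod n))" if "p < n" for p
    using turn_Suc_mod[OF that] by auto
  then have "(\<lambda>p. {a (turn n p), b (turn n (Suc p mod n))}) ` {..<n}
      = (\<lambda>q. {b q, a (Suc q mod n)}) ` turn n ` (\<lambda>p. Suc p mod n) ` {..<n}"
    unfolding image_image by (intro image_cong) auto
  then show "edges (cyc n (l \<circ> turn n) (b \<circ> turn n) (a \<circ> turn n)) = edges (cyc n l a b)"
    by (simp add: Suc_mod_image turn_image)
qed

locale cycle_data =
  fixes n :: nat and l a b :: "nat \<Rightarrow> nat"
  assumes n: "3 \<le> n"
    and inj: "inj_on l {..<n}" "inj_on a {..<n}" "inj_on b {..<n}"
    and labels: "l ` {..<n} = {1..n}"
    and distinct: "\<And>p q. p < n \<Longrightarrow> q < n \<Longrightarrow> l p \<noteq> a q" "\<And>p q. p < n \<Longrightarrow> q < n \<Longrightarrow> l p \<noteq> b q"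
      "\<And>p q. p < n \<Longrightarrow> q < n \<Longrightarrow> a p \<noteq> b q"
begin

lemma l_eq_iff: "p < n \<Longrightarrow> q < n \<Longrightarrow> l p = l q \<longleftrightarrow> p = q"
  and a_eq_iff: "p < n \<Longrightarrow> q < n \<Longrightarrow> a p = a q \<longleftrightarrow> p = q"
  and b_eq_iff: "p < n \<Longrightarrow> q < n \<Longrightarrow> b p = b q \<longleftrightarrow> p = q"
  using inj by (simp_all add: inj_on_eq_iff)

lemma next_less: "p < n \<Longrightarrow> Suc p mod n < n"
  by simp

lemma next_eq_iff: "p < n \<Longrightarrow> q < n \<Longrightarrow> Suc p mod n = Suc q mod n \<longleftrightarrow> p = q"
  using inj_on_eq_iff[OF inj_on_Suc_mod[of n], of p q] by simp

lemma flags_cyc: "flags (cyc n l a b) = l ` {..<n} \<union> a ` {..<n} \<union> b ` {..<n}"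
  by (auto simp: flags_def)

lemma Union_edges_cyc: "\<Union> (edges (cyc n l a b)) = a ` {..<n} \<union> b ` {..<n}"
proof -
  have "\<Union> (edges (cyc n l a b)) = b ` {..<n} \<union> a ` (\<lambda>p. Suc p mod n) ` {..<n}"
    by auto
  then show ?thesis
    unfolding Suc_mod_image by blast
qed

lemma legs_cyc: "legs (cyc n l a b) = {1..n}"
proof -
  have "l ` {..<n} \<inter> (a ` {..<n} \<union> b ` {..<n}) = {}"
    using distinct by auto
  then show ?thesis
    unfolding legs_def flags_cyc Union_edges_cyc labels[symmetric] by blast
qed

lemma stable_cyc: "stable_graph (cyc n l a b)"
  unfolding stable_graph_def
proof (intro conjI ballI impI)
  show "finite (verts (cyc n l a b))" "verts (cyc n l a b) \<noteq> {}"
    using n by (simp_all add: lessThan_empty_iff)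
  show "stable_vertex v" if v: "v \<in> verts (cyc n l a b)" for v
  proof -
    obtain p where "p < n" "v = (0, {l p, a p, b p})"
      using v unfolding cyc_simps by blast
    then show ?thesis
      using distinct[of p p] by (simp add: stable_vertex_def)
  qed
  show "snd v \<inter> snd w = {}"
    if vw: "v \<in> verts (cyc n l a b)" "w \<in> verts (cyc n l a b)" "v \<noteq> w" for v w
  proof -
    obtain p q where pq: "p < n" "v = (0, {l p, a p, b p})" "q < n" "w = (0, {l q, a q, b q})"
      using vw(1,2) unfolding cyc_simps by blast
    then have "p \<noteq> q"
      using vw(3) by blast
    then have "l p \<noteq> l q" "a p \<noteq> a q" "b p \<noteq> b q"
      using l_eq_iff a_eq_iff b_eq_iff pq(1,3) by simp_all
    then show ?thesis
      unfolding pq(2,4) using distinct[OF pq(1,3)] distinct[OF pq(3,1)] by auto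
  qed
  show "card e = 2" "e \<subseteq> flags (cyc n l a b)" if e: "e \<in> edges (cyc n l a b)" for e
  proof -
    obtain p where p: "p < n" "e = {b p, a (Suc p mod n)}"
      using e unfolding cyc_simps by blast
    then show "card e = 2"
      using distinct(3)[OF next_less[OF p(1)] p(1)] by (simp add: card_insert_if)
    show "e \<subseteq> flags (cyc n l a b)"
      unfolding flags_cyc p(2) using p(1) next_less[OF p(1)] by blast
  qed
  show "e \<inter> e' = {}"
    if ee: "e \<in> edges (cyc n l a b)" "e' \<in> edges (cyc n l a b)" "e \<noteq> e'" for e e'
  proof -
    obtain p q where pq: "p < n" "e = {b p, a (Suc p mod n)}" "q < n" "e' = {b q, a (Suc q mod n)}"
      using ee(1,2) unfolding cyc_simps by blast
    then have "p \<noteq> q"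
      using ee(3) by blast
    then have "b p \<noteq> b q" "a (Suc p mod n) \<noteq> a (Suc q mod n)"
      using b_eq_iff a_eq_iff next_eq_iff next_less pq(1,3) by simp_all
    moreover have "a (Suc p mod n) \<noteq> b q" "a (Suc q mod n) \<noteq> b p"
      using distinct(3) next_less pq(1,3) by simp_all
    ultimately show ?thesis
      unfolding pq(2,4) by auto
  qed
  show "(v, w) \<in> (joined (cyc n l a b) (edges (cyc n l a b)))\<^sup>*"
    if vw: "v \<in> verts (cyc n l a b)" "w \<in> verts (cyc n l a b)" for v w
  proof (rule connectedI[OF _ vw])
    fix T assume T: "T \<subseteq> verts (cyc n l a b)" "T \<noteq> {}"
      and closed: "\<And>v w. v \<in> T \<Longrightarrow> (v, w) \<in> joined (cyc n l a b) (edges (cyc n l a b)) \<Longrightarrow> w \<in> T"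
    let ?v = "\<lambda>p. (0 :: nat, {l p, a p, b p})"
    have step: "?v (Suc p mod n) \<in> T" if "p < n" "?v p \<in> T" for p
    proof (rule closed[OF that(2)])
      have "{b p, a (Suc p mod n)} \<in> edges (cyc n l a b)" "?v p \<in> verts (cyc n l a b)"
        "?v (Suc p mod n) \<in> verts (cyc n l a b)"
        using that(1) next_less[OF that(1)] unfolding cyc_simps by blast+
      then show "(?v p, ?v (Suc p mod n)) \<in> joined (cyc n l a b) (edges (cyc n l a b))"
        by (intro joinedI[where e = "{b p, a (Suc p mod n)}" and i = "b p" and j = "a (Suc p mod n)"])
          (simp_all del: cyc_simps)
    qed
    obtain v where "v \<in> T"
      using T(2) by blast
    then obtain p where p: "p < n" "?v p \<in> T"
      using T(1) unfolding cyc_simps by blast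
    have all: "?v ((p + i) mod n) \<in> T" for i
    proof (induction i)
      case (Suc i)
      have "(p + i) mod n < n"
        using n by simp
      then have "?v (Suc ((p + i) mod n) mod n) \<in> T"
        using step Suc by blast
      then show ?case
        by (simp add: mod_Suc_eq)
    qed (use p in simp)
    show "verts (cyc n l a b) \<subseteq> T"
    proof
      fix w assume "w \<in> verts (cyc n l a b)"
      then obtain q where q: "q < n" "w = ?v q"
        unfolding cyc_simps by blast
      \<comment> \<open>Going once around from \<open>p\<close> back to position 0 and then
        \<open>q\<close> steps further reaches \<open>q\<close>, without subtracting below
        zero.\<close>
      have "(p + (n - p + q)) mod n = q"
        using p(1) q(1) by simp
      then show "w \<in> T"
        using all[of "n - p + q"] q(2) by simp
    qed
  qed
qed

lemma inj_vertex: "inj_on (\<lambda>p. (0 :: nat, {l p, a p, b p})) {..<n}"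
proof (rule inj_onI)
  fix p q assume pq: "p \<in> {..<n}" "q \<in> {..<n}" "(0 :: nat, {l p, a p, b p}) = (0, {l q, a q, b q})"
  then have "l p \<in> {l q, a q, b q}"
    by auto
  then show "p = q"
    using pq(1,2) distinct(1,2)[of p q] l_eq_iff by auto
qed

lemma card_edges_cyc: "card (edges (cyc n l a b)) = n"
proof -
  have "inj_on (\<lambda>p. {b p, a (Suc p mod n)}) {..<n}"
  proof (rule inj_onI)
    fix p q assume pq: "p \<in> {..<n}" "q \<in> {..<n}" "{b p, a (Suc p mod n)} = {b q, a (Suc q mod n)}"
    then have "b p \<in> {b q, a (Suc q mod n)}"
      by auto
    then show "p = q"
      using pq(1,2) distinct(3)[of "Suc q mod n" p] b_eq_iff next_less[of q] by auto
  qed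
  then show ?thesis
    by (simp add: card_image)
qed

lemma genus_one_cyc: "cyc n l a b \<in> genus_one n"
proof -
  have "card (verts (cyc n l a b)) = n"
    by (simp add: card_image[OF inj_vertex])
  moreover have "(\<Sum>v\<in>verts (cyc n l a b). fst v) = 0"
    by (auto intro: sum.neutral)
  ultimately have "total_genus (cyc n l a b) = 1"
    using total_genus_eq_iff[OF stable_cyc, of 1] card_edges_cyc by simp
  then show ?thesis
    using stable_cyc legs_cyc by (simp add: genus_one_def)
qed

lemma turned: "cycle_data n (l \<circ> turn n) (b \<circ> turn n) (a \<circ> turn n)"
proof -
  have t: "inj_on (turn n) {..<n}"
    by (rule inj_on_inverseI[where g = "turn n"]) (simp add: turn_turn)
  show ?thesis
  proof
    show "inj_on (l \<circ> turn n) {..<n}" "inj_on (b \<circ> turn n) {..<n}" "inj_on (a \<circ> turn n) {..<n}"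
      using inj by (auto intro!: comp_inj_on t simp: turn_image)
    show "(l \<circ> turn n) ` {..<n} = {1..n}"
      by (simp only: image_comp[symmetric] turn_image labels)
    show "3 \<le> n" by (rule n)
    fix p q assume pq: "p < n" "q < n"
    show "(l \<circ> turn n) p \<noteq> (b \<circ> turn n) q" "(l \<circ> turn n) p \<noteq> (a \<circ> turn n) q"
      "(b \<circ> turn n) p \<noteq> (a \<circ> turn n) q"
      using distinct(1,2)[OF turn_less[OF pq(1)] turn_less[OF pq(2)]]
        distinct(3)[OF turn_less[OF pq(2)] turn_less[OF pq(1)]] by auto
  qed
qed

lemma relabelled:
  assumes "inj_on f (flags (cyc n l a b))" "\<And>i. i \<in> {1..n} \<Longrightarrow> f i = i"
  shows "cycle_data n (f \<circ> l) (f \<circ> a) (f \<circ> b)"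
proof
  have mem: "l p \<in> flags (cyc n l a b)" "a p \<in> flags (cyc n l a b)" "b p \<in> flags (cyc n l a b)"
    if "p < n" for p
    using that unfolding flags_cyc by auto
  show "3 \<le> n" by (rule n)
  show "inj_on (f \<circ> l) {..<n}" "inj_on (f \<circ> a) {..<n}" "inj_on (f \<circ> b) {..<n}"
    using inj assms(1) by (auto intro!: comp_inj_on intro: inj_on_subset simp: flags_cyc)
  have "f ` {1..n} = id ` {1..n}"
    using assms(2) by (intro image_cong) auto
  then show "(f \<circ> l) ` {..<n} = {1..n}"
    unfolding image_comp[symmetric] labels by simp
  fix p q assume pq: "p < n" "q < n"
  show "(f \<circ> l) p \<noteq> (f \<circ> a) q" "(f \<circ> l) p \<noteq> (f \<circ> b) q" "(f \<circ> a) p \<noteq> (f \<circ> b) q"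
    using distinct[OF pq] inj_onD[OF assms(1)] mem[OF pq(1)] mem[OF pq(2)] by auto
qed

end

section \<open>A labelled cycle determines its presentation up to direction\<close>

lemma cyc_eq_aligned:
  assumes "cycle_data n l a b" "cycle_data n l' a' b'" "cyc n l a b = cyc n l' a' b'"
    and "l 0 = l' 0" "a 0 = a' 0" "b 0 = b' 0" "p < n"
  shows "l p = l' p \<and> a p = a' p \<and> b p = b' p"
  using assms(7)
proof (induction p)
  case 0
  then show ?case
    using assms(4-6) by simp
next
  case (Suc p)
  interpret c: cycle_data n l a b by (rule assms(1))
  interpret c': cycle_data n l' a' b' by (rule assms(2))
  let ?q = "Suc p"
  have q: "Suc p mod n = ?q" "p < n"
    using Suc.prems by simp_all
  have IH: "b p = b' p"
    using Suc q by simp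
  \<comment> \<open>The flag \<open>b p\<close> lies on one edge only, which fixes the next entering
    flag. That flag lies on one vertex only, whose label and leaving flag are then told apart
    because labels never coincide with edge flags.\<close>
  have "{b p, a ?q} \<in> edges (cyc n l a b)"
    unfolding cyc_simps using q by (intro image_eqI[of _ _ p]) auto
  moreover have "{b' p, a' ?q} \<in> edges (cyc n l a b)"
    unfolding assms(3) cyc_simps using q by (intro image_eqI[of _ _ p]) auto
  ultimately have "{b p, a ?q} = {b' p, a' ?q}"
    using edge_unique[OF c.stable_cyc, of _ _ "b p"] IH by simp
  moreover have "a ?q \<noteq> b p"
    using c.distinct(3) Suc.prems q by simp
  ultimately have a: "a ?q = a' ?q"
    using IH by (auto simp: doubleton_eq_iff)
  have "(0, {l ?q, a ?q, b ?q}) \<in> verts (cyc n l a b)"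
    using Suc.prems unfolding cyc_simps by blast
  moreover have "(0, {l' ?q, a' ?q, b' ?q}) \<in> verts (cyc n l a b)"
    using Suc.prems unfolding assms(3) cyc_simps by blast
  ultimately have "(0 :: nat, {l ?q, a ?q, b ?q}) = (0, {l' ?q, a' ?q, b' ?q})"
    by (rule vertex_unique[OF c.stable_cyc, where i = "a ?q"]) (simp_all add: a)
  then have eq: "{l ?q, a ?q, b ?q} = {l' ?q, a' ?q, b' ?q}"
    by simp
  have "l ?q \<in> {1..n}"
    using c.labels Suc.prems by blast
  then have "l ?q \<in> l' ` {..<n}"
    using c'.labels by simp
  then obtain x where "x < n" "l ?q = l' x"
    by blast
  then have "l ?q \<noteq> a' ?q" "l ?q \<noteq> b' ?q"
    using c'.distinct(1,2)[of x ?q] Suc.prems by simp_all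
  then have l: "l ?q = l' ?q"
    using eq by blast
  have "b ?q \<noteq> l ?q" "b ?q \<noteq> a ?q"
    using c.distinct(2,3)[OF Suc.prems Suc.prems] by auto
  moreover have "b ?q \<in> {l' ?q, a' ?q, b' ?q}"
    using eq by blast
  ultimately have "b ?q = b' ?q"
    using l a by simp
  then show ?case
    using l a by simp
qed

text \<open>Leg \<open>l 0\<close> lies on one vertex, so the two other flags at position 0 agree or
  are exchanged. In the second case reversing one of the presentations aligns them.\<close>

lemma cyc_eq_cases:
  assumes "cycle_data n l a b" "cycle_data n l' a' b'" "cyc n l a b = cyc n l' a' b'" "l 0 = l' 0"
  obtains (same) "\<And>p. p < n \<Longrightarrow> l p = l' p \<and> a p = a' p \<and> b p = b' p"
  | (turned) "\<And>p. p < n \<Longrightarrow> l' p = l (turn n p)"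
proof -
  interpret c: cycle_data n l a b by (rule assms(1))
  interpret c': cycle_data n l' a' b' by (rule assms(2))
  have n: "0 < n"
    using c.n by simp
  have "(0, {l 0, a 0, b 0}) \<in> verts (cyc n l a b)"
    using n unfolding cyc_simps by blast
  moreover have "(0, {l' 0, a' 0, b' 0}) \<in> verts (cyc n l a b)"
    using n unfolding assms(3) cyc_simps by blast
  ultimately have "(0 :: nat, {l 0, a 0, b 0}) = (0, {l' 0, a' 0, b' 0})"
    by (rule vertex_unique[OF c.stable_cyc, where i = "l 0"]) (simp_all add: assms(4))
  then have eq: "{l 0, a 0, b 0} = {l 0, a' 0, b' 0}"
    using assms(4) by simp
  have "l 0 \<noteq> a 0" "l 0 \<noteq> b 0" "l 0 \<noteq> a' 0" "l 0 \<noteq> b' 0"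
    using c.distinct(1,2)[OF n n] c'.distinct(1,2)[OF n n] assms(4) by simp_all
  then have "{a 0, b 0} = {a' 0, b' 0}"
    using eq insert_ident[of "l 0" "{a 0, b 0}" "{a' 0, b' 0}"] by auto
  then consider "a 0 = a' 0" "b 0 = b' 0" | "a 0 = b' 0" "b 0 = a' 0"
    by (auto simp: doubleton_eq_iff)
  then show ?thesis
  proof cases
    case 1
    then show ?thesis
      using same cyc_eq_aligned[OF assms] by blast
  next
    case 2
    have t0: "turn n 0 = 0"
      by (simp add: turn_def)
    have "(l \<circ> turn n) p = l' p" if "p < n" for p
      using cyc_eq_aligned[OF c.turned assms(2) _ _ _ _ that] assms(3,4) 2 t0
      by (simp add: cyc_turn del: cyc_simps)
    then show ?thesis
      using turned by simp
  qed
qed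

text \<open>The order of the labels determines the cycle up to isomorphism: the half-edges are
  matched position by position, whatever their names.\<close>

lemma isomorphic_cyc:
  assumes "cycle_data n l a b" "cycle_data n l a' b'"
  shows "isomorphic (cyc n l a b) (cyc n l a' b')"
proof -
  interpret c: cycle_data n l a b by (rule assms(1))
  interpret c': cycle_data n l a' b' by (rule assms(2))
  define f where "f i = (if i \<in> l ` {..<n} then i else if i \<in> a ` {..<n} then a' (inv_into {..<n} a i)
    else b' (inv_into {..<n} b i))" for i
  have f: "f (l p) = l p" "f (a p) = a' p" "f (b p) = b' p" if "p < n" for p
  proof -
    have "a p \<notin> l ` {..<n}" "b p \<notin> l ` {..<n}" "b p \<notin> a ` {..<n}"
      using c.distinct that by (metis imageE lessThan_iff)+
    then show "f (l p) = l p" "f (a p) = a' p" "f (b p) = b' p"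
      using that by (simp_all add: f_def inv_into_f_f c.inj)
  qed
  have "inj_on f (flags (cyc n l a b))"
  proof (rule inj_onI)
    fix i j assume ij: "i \<in> flags (cyc n l a b)" "j \<in> flags (cyc n l a b)" "f i = f j"
    have "\<exists>p<n. i = l p \<or> i = a p \<or> i = b p" "\<exists>p<n. j = l p \<or> j = a p \<or> j = b p"
      using ij(1,2) unfolding c.flags_cyc by auto
    then obtain p q where "p < n" "i = l p \<or> i = a p \<or> i = b p" "q < n" "j = l q \<or> j = a q \<or> j = b q"
      by blast
    then show "i = j"
      using ij(3) f[of p] f[of q] c'.distinct[of p q] c'.distinct[of q p] c'.l_eq_iff[of p q]
        c'.a_eq_iff[of p q] c'.b_eq_iff[of p q] by (elim disjE) auto
  qed
  moreover have "relabel_graph f (cyc n l a b) = cyc n l a' b'"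
    unfolding relabel_cyc by (rule cyc_cong) (simp_all add: f)
  moreover have "f i = i" if "i \<in> legs (cyc n l a b)" for i
    using that f(1) unfolding c.legs_cyc c.labels[symmetric] by auto
  ultimately show ?thesis
    by (auto simp: isomorphic_def isom_def)
qed

lemma isom_cycD:
  assumes "cycle_data n l a b" "cycle_data n l' a' b'" "l 0 = l' 0"
    and "isom f (cyc n l a b) (cyc n l' a' b')"
  obtains (same) "\<And>p. p < n \<Longrightarrow> l p = l' p \<and> f (a p) = a' p \<and> f (b p) = b' p"
  | (turned) "\<And>p. p < n \<Longrightarrow> l' p = l (turn n p)"
proof -
  interpret c: cycle_data n l a b by (rule assms(1))
  have f: "inj_on f (flags (cyc n l a b))" "\<And>i. i \<in> {1..n} \<Longrightarrow> f i = i"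
    "cyc n (f \<circ> l) (f \<circ> a) (f \<circ> b) = cyc n l' a' b'"
    using assms(4) c.legs_cyc relabel_cyc[of f n l a b] by (auto simp: isom_def simp del: cyc_simps)
  have fl: "f (l p) = l p" if "p < n" for p
    using f(2)[of "l p"] c.labels that by blast
  have l0: "(f \<circ> l) 0 = l' 0"
    using fl[of 0] c.n assms(3) by simp
  have data: "cycle_data n (f \<circ> l) (f \<circ> a) (f \<circ> b)"
    by (rule c.relabelled[OF f(1)]) (rule f(2))
  from data assms(2) f(3) l0 show ?thesis
  proof (cases rule: cyc_eq_cases)
    case same
    then show ?thesis
      using that(1) fl by simp
  next
    case turned
    then show ?thesis
      using that(2) fl turn_less by simp
  qed
qed

text \<open>An automorphism fixes the labels. If it keeps the direction, it fixes all half-edges and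
  hence all edges. If it reverses the direction, positions 1 and \<open>n - 1\<close> carry the same
  label, which is impossible for \<open>3 \<le> n\<close>.\<close>

lemma not_odd_cyc:
  assumes "cycle_data n l a b"
  shows "\<not> odd_graph (cyc n l a b)"
proof
  interpret c: cycle_data n l a b by (rule assms)
  assume "odd_graph (cyc n l a b)"
  then obtain f where f: "isom f (cyc n l a b) (cyc n l a b)" "sign (edge_perm f (cyc n l a b)) = - 1"
    by (auto simp: odd_graph_def)
  from assms assms refl f(1) show False
  proof (cases rule: isom_cycD)
    case same
    have "f ` e = e" if e: "e \<in> edges (cyc n l a b)" for e
    proof -
      obtain p where "p < n" "e = {b p, a (Suc p mod n)}"
        using e unfolding cyc_simps by blast
      then show ?thesis
        using same[of p] same[of "Suc p mod n"] by simp
    qed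
    then have "edge_perm f (cyc n l a b) = id"
      by (auto simp: edge_perm_def fun_eq_iff)
    then show False
      using f(2) by simp
  next
    case turned
    have "l 1 = l (n - 1)"
      using turned[of 1] c.n by (simp add: turn_def)
    then show False
      using c.l_eq_iff[of 1 "n - 1"] c.n by simp
  qed
qed

section \<open>Graphs with all legs on different vertices\<close>

lemma discrete_card_legs:
  assumes "same_vertex \<Gamma> = Id_on {1..n}" "v \<in> verts \<Gamma>"
  shows "card (snd v \<inter> legs \<Gamma>) \<le> 1"
proof -
  have "i = j" if "i \<in> snd v \<inter> legs \<Gamma>" "j \<in> snd v \<inter> legs \<Gamma>" for i j
  proof -
    have "(i, j) \<in> same_vertex \<Gamma>"
      using that assms(2) by (auto simp: same_vertex_iff)
    then show ?thesis
      using assms(1) by auto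
  qed
  then show ?thesis
    by (metis card_le_Suc0_iff_eq One_nat_def card.infinite le0)
qed

lemma card_half_edges:
  assumes "stable_graph \<Gamma>"
  shows "(\<Sum>v\<in>verts \<Gamma>. card (snd v - legs \<Gamma>)) = 2 * card (edges \<Gamma>)"
proof -
  have fin: "finite (snd v)" if "v \<in> verts \<Gamma>" for v
    using stable_graphD(3)[OF assms that] by (simp add: stable_vertex_def)
  have "\<Union> (edges \<Gamma>) = (\<Union>v\<in>verts \<Gamma>. snd v - legs \<Gamma>)"
    using stable_graphD(6)[OF assms] by (fastforce simp: legs_def flags_def)
  then have "2 * card (edges \<Gamma>) = card (\<Union>v\<in>verts \<Gamma>. snd v - legs \<Gamma>)"
    using card_Union_edges[OF assms] by simp
  also have "\<dots> = (\<Sum>v\<in>verts \<Gamma>. card (snd v - legs \<Gamma>))"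
    using stable_graphD(1,4)[OF assms] fin by (intro card_UN_disjoint) blast+
  finally show ?thesis ..
qed

text \<open>A vertex of genus zero has at most one leg and hence at least two half-edges. If some
  vertex has genus one, there are one fewer edges than vertices and no half-edge remains for it, so
  it is the whole graph and carries at least two legs, a contradiction. Otherwise there are as many
  edges as vertices, so each vertex has exactly two half-edges and, by stability, one leg.\<close>

lemma discrete_vertex_forms:
  assumes "\<Gamma> \<in> genus_one n" "2 \<le> n" "same_vertex \<Gamma> = Id_on {1..n}"
  shows "card (verts \<Gamma>) = n"
    and "\<And>v. v \<in> verts \<Gamma> \<Longrightarrow> \<exists>i x y. v = (0, {i, x, y}) \<and> i \<in> {1..n} \<and> x \<notin> legs \<Gamma> \<and> y \<notin> legs \<Gamma> \<and> x \<noteq> y"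
proof -
  note \<Gamma> = genus_oneD[OF assms(1)]
  note fin = stable_graphD(1)[OF \<Gamma>(1)]
  have split: "card (snd v) = card (snd v \<inter> legs \<Gamma>) + card (snd v - legs \<Gamma>)" "finite (snd v)"
    if "v \<in> verts \<Gamma>" for v
  proof -
    show "finite (snd v)"
      using stable_graphD(3)[OF \<Gamma>(1) that] by (simp add: stable_vertex_def)
    then show "card (snd v) = card (snd v \<inter> legs \<Gamma>) + card (snd v - legs \<Gamma>)"
      by (metis card_Int_Diff)
  qed
  have two: "2 \<le> card (snd v - legs \<Gamma>)" if "v \<in> verts \<Gamma>" "fst v = 0" for v
    using split(1)[OF that(1)] discrete_card_legs[OF assms(3) that(1)] stable_graphD(3)[OF \<Gamma>(1) that(1)] that(2)
    by (simp add: stable_vertex_def)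
  have cycle: "(\<forall>v\<in>verts \<Gamma>. fst v = 0) \<and> card (edges \<Gamma>) = card (verts \<Gamma>)"
    using \<Gamma>(1,2)
  proof (cases rule: genus_one_cases)
    case (tree w)
    have "2 * (card (verts \<Gamma>) - 1) = (\<Sum>v\<in>verts \<Gamma> - {w}. 2)"
      using tree(1) by simp
    also have "\<dots> \<le> (\<Sum>v\<in>verts \<Gamma> - {w}. card (snd v - legs \<Gamma>))"
      using two tree(3) by (intro sum_mono) auto
    finally have "card (snd w - legs \<Gamma>) = 0"
      using sum.remove[OF fin tree(1), of "\<lambda>v. card (snd v - legs \<Gamma>)"] card_half_edges[OF \<Gamma>(1)] tree(4)
      by linarith
    then have w: "snd w \<subseteq> legs \<Gamma>"
      using split(2)[OF tree(1)] by auto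
    then have "flags \<Gamma> = snd w"
      using isolated_verts[OF \<Gamma>(1) tree(1)] by (simp add: flags_def)
    then have "legs \<Gamma> \<subseteq> snd w \<inter> legs \<Gamma>"
      using legs_subset_flags[of \<Gamma>] by blast
    then have "card (legs \<Gamma>) \<le> 1"
      using discrete_card_legs[OF assms(3) tree(1)] finite_legs[OF \<Gamma>(1)]
      by (meson card_mono finite_Int le_trans)
    then show ?thesis
      using \<Gamma>(3) assms(2) by simp
  qed blast
  have two_eq: "card (snd v - legs \<Gamma>) = 2" if v: "v \<in> verts \<Gamma>" for v
  proof -
    have "2 * (card (verts \<Gamma>) - 1) = (\<Sum>v\<in>verts \<Gamma> - {v}. 2)"
      using v by simp
    also have "\<dots> \<le> (\<Sum>v\<in>verts \<Gamma> - {v}. card (snd v - legs \<Gamma>))"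
      using two cycle by (intro sum_mono) auto
    finally have "card (snd v - legs \<Gamma>) + 2 * (card (verts \<Gamma>) - 1) \<le> 2 * card (verts \<Gamma>)"
      using sum.remove[OF fin v, of "\<lambda>v. card (snd v - legs \<Gamma>)"] card_half_edges[OF \<Gamma>(1)] cycle
      by linarith
    moreover have "0 < card (verts \<Gamma>)"
      using v fin by (auto simp: card_gt_0_iff)
    ultimately show ?thesis
      using two[OF v] cycle v by simp
  qed
  have one_eq: "card (snd v \<inter> legs \<Gamma>) = 1" if v: "v \<in> verts \<Gamma>" for v
    using split(1)[OF v] two_eq[OF v] discrete_card_legs[OF assms(3) v] stable_graphD(3)[OF \<Gamma>(1) v] cycle v
    by (simp add: stable_vertex_def)
  show "\<exists>i x y. v = (0, {i, x, y}) \<and> i \<in> {1..n} \<and> x \<notin> legs \<Gamma> \<and> y \<notin> legs \<Gamma> \<and> x \<noteq> y"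
    if v: "v \<in> verts \<Gamma>" for v
  proof -
    obtain i where i: "snd v \<inter> legs \<Gamma> = {i}"
      using one_eq[OF v] by (auto simp: card_1_singleton_iff)
    obtain x y where xy: "snd v - legs \<Gamma> = {x, y}" "x \<noteq> y"
      using two_eq[OF v] by (auto simp: card_2_iff)
    have "v = (0, {i, x, y})"
      using i xy cycle v by (auto simp: prod_eq_iff)
    then show ?thesis
      using i xy \<Gamma>(3) by blast
  qed
  have "flags \<Gamma> = (\<Union>v\<in>verts \<Gamma>. snd v)"
    by (simp add: flags_def)
  have "card (flags \<Gamma>) = (\<Sum>v\<in>verts \<Gamma>. 3)"
    unfolding card_flags[OF \<Gamma>(1)] using split(1) one_eq two_eq by (intro sum.cong) auto
  then show "card (verts \<Gamma>) = n"
    using card_flags_legs[OF \<Gamma>(1)] cycle \<Gamma>(3) by simp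
qed

text \<open>The start at leg 1 anticipates the enumeration of cycles, where this leg occupies
  position 0.\<close>

definition chain :: "graph \<Rightarrow> nat \<Rightarrow> nat \<Rightarrow> (nat \<Rightarrow> nat) \<Rightarrow> (nat \<Rightarrow> nat) \<Rightarrow> (nat \<Rightarrow> nat) \<Rightarrow> bool" where
  "chain \<Gamma> n m l a b \<longleftrightarrow> 0 < m \<and> l 0 = 1 \<and> inj_on l {..<m} \<and>
     (\<forall>p<m. (0, {l p, a p, b p}) \<in> verts \<Gamma> \<and> l p \<in> {1..n} \<and> a p \<notin> legs \<Gamma> \<and> b p \<notin> legs \<Gamma> \<and> a p \<noteq> b p) \<and>
     (\<forall>p. Suc p < m \<longrightarrow> {b p, a (Suc p)} \<in> edges \<Gamma>)"

text \<open>A longest chain of adjacent vertices starting at leg \<open>1\<close> closes up and exhausts the graph.\<close>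

lemma discrete_cyc:
  assumes "\<Gamma> \<in> genus_one n" "3 \<le> n" "same_vertex \<Gamma> = Id_on {1..n}"
  obtains l a b where "cycle_data n l a b" "\<Gamma> = cyc n l a b" "l 0 = 1"
proof -
  note \<Gamma> = genus_oneD[OF assms(1)]
  have "2 \<le> n"
    using assms(2) by simp
  note forms = discrete_vertex_forms[OF assms(1) this assms(3)]
  have one_leg: "i = j" if "v \<in> verts \<Gamma>" "i \<in> snd v" "j \<in> snd v" "i \<in> {1..n}" "j \<in> {1..n}" for v i j
  proof -
    have "(i, j) \<in> same_vertex \<Gamma>"
      using that \<Gamma>(3) by (auto simp: same_vertex_iff)
    then show ?thesis
      using assms(3) by auto
  qed
  define P where "P m \<longleftrightarrow> (\<exists>l a b. chain \<Gamma> n m l a b)" for m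
  have P1: "P 1"
  proof -
    have "1 \<in> flags \<Gamma>"
      using \<Gamma>(3) assms(2) legs_subset_flags[of \<Gamma>] by auto
    then obtain v where v: "v \<in> verts \<Gamma>" "1 \<in> snd v"
      by (rule flag_vertexE)
    obtain i x y where *: "v = (0, {i, x, y})" "i \<in> {1..n}" "x \<notin> legs \<Gamma>" "y \<notin> legs \<Gamma>" "x \<noteq> y"
      using forms(2)[OF v(1)] by blast
    have "i = 1"
      using one_leg[OF v(1) _ v(2), of i] * assms(2) by simp
    then have "chain \<Gamma> n 1 (\<lambda>_. 1) (\<lambda>_. x) (\<lambda>_. y)"
      using * v(1) by (simp add: chain_def inj_on_def)
    then show ?thesis
      unfolding P_def by blast
  qed
  have "\<forall>m. P m \<longrightarrow> id m < Suc n"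
  proof (intro allI impI)
    fix m assume "P m"
    then obtain l a b where "chain \<Gamma> n m l a b"
      unfolding P_def by blast
    then have "inj_on l {..<m}" "l ` {..<m} \<subseteq> {1..n}"
      unfolding chain_def by auto
    then show "id m < Suc n"
      using card_inj_on_le[of l "{..<m}" "{1..n}"] by simp
  qed
  from ex_has_greatest_nat[of P, OF P1 this]
  obtain m where m: "P m" "\<forall>m'. P m' \<longrightarrow> id m' \<le> id m"
    by blast
  obtain l a b where chain: "chain \<Gamma> n m l a b"
    using m(1) unfolding P_def by blast
  let ?v = "\<lambda>p. (0 :: nat, {l p, a p, b p})"
  have c: "0 < m" "l 0 = 1" "inj_on l {..<m}"
    "\<And>p. Suc p < m \<Longrightarrow> {b p, a (Suc p)} \<in> edges \<Gamma>"
    and v: "\<And>p. p < m \<Longrightarrow> ?v p \<in> verts \<Gamma>" "\<And>p. p < m \<Longrightarrow> l p \<in> {1..n}"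
      "\<And>p. p < m \<Longrightarrow> a p \<notin> legs \<Gamma>" "\<And>p. p < m \<Longrightarrow> b p \<notin> legs \<Gamma>" "\<And>p. p < m \<Longrightarrow> a p \<noteq> b p"
    using chain unfolding chain_def by simp_all
  \<comment> \<open>A shared flag means a shared vertex; a vertex has only one leg, and the legs
    along the chain are distinct.\<close>
  have same: "p = q" if "p < m" "q < m" "i \<in> {l p, a p, b p}" "i \<in> {l q, a q, b q}" for p q i
  proof -
    have "?v p = ?v q"
      using vertex_unique[OF \<Gamma>(1) v(1)[OF that(1)] v(1)[OF that(2)], of i] that(3,4) by simp
    then have "{l p, a p, b p} = {l q, a q, b q}"
      by simp
    then have "l q \<in> {l p, a p, b p}"
      by blast
    then have "l p = l q"
      using one_leg[OF v(1)[OF that(1)], of "l p" "l q"] v(2) that(1,2) by simp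
    then show ?thesis
      using c(3) that(1,2) by (simp add: inj_on_eq_iff)
  qed
  define z where "z = m - 1"
  have z: "z < m" "Suc z = m"
    using c(1) by (simp_all add: z_def)
  have bz: "b z \<in> flags \<Gamma>" "b z \<notin> legs \<Gamma>"
    using snd_subset_flags[OF v(1)[OF z(1)]] v(4)[OF z(1)] by auto
  then obtain e where e: "e \<in> edges \<Gamma>" "b z \<in> e"
    by (auto simp: legs_def)
  obtain d where d: "d \<noteq> b z" "e = {b z, d}"
    by (rule edge_partner[OF \<Gamma>(1) e])
  have d_flag: "d \<in> flags \<Gamma>" "d \<notin> legs \<Gamma>"
    using stable_graphD(6)[OF \<Gamma>(1) e(1)] e(1) d(2) by (auto simp: legs_def)
  obtain w where w: "w \<in> verts \<Gamma>" "d \<in> snd w"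
    by (rule flag_vertexE[OF d_flag(1)])
  obtain i x y where xy: "w = (0, {i, x, y})" "i \<in> {1..n}" "x \<notin> legs \<Gamma>" "y \<notin> legs \<Gamma>" "x \<noteq> y" "d = x"
  proof -
    obtain i x y where *: "w = (0, {i, x, y})" "i \<in> {1..n}" "x \<notin> legs \<Gamma>" "y \<notin> legs \<Gamma>" "x \<noteq> y"
      using forms(2)[OF w(1)] by blast
    then have "d = x \<or> d = y"
      using w(2) d_flag(2) \<Gamma>(3) by auto
    then show ?thesis
      using that[of i x y] that[of i y x] * by (auto simp: insert_commute)
  qed
  \<comment> \<open>The edge leaving the last vertex leads back into the chain, since otherwise its
    other end would prolong it.\<close>
  have "i \<in> l ` {..<m}"
  proof (rule ccontr)
    assume i: "i \<notin> l ` {..<m}"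
    let ?l = "l(m := i)" and ?a = "a(m := x)" and ?b = "b(m := y)"
    have "chain \<Gamma> n (Suc m) ?l ?a ?b"
      unfolding chain_def
    proof (intro conjI allI impI)
      show "?l 0 = 1"
        using c(1,2) by simp
      show "inj_on ?l {..<Suc m}"
        unfolding lessThan_Suc inj_on_insert
        using c(3) i inj_on_cong[of "{..<m}" ?l l] by (auto simp: image_iff)
      fix p
      show "(0, {?l p, ?a p, ?b p}) \<in> verts \<Gamma>" "?l p \<in> {1..n}" "?a p \<notin> legs \<Gamma>" "?b p \<notin> legs \<Gamma>"
        "?a p \<noteq> ?b p" if "p < Suc m"
        using that v[of p] w(1) xy by (cases "p = m"; simp add: less_Suc_eq)+
      show "{?b p, ?a (Suc p)} \<in> edges \<Gamma>" if "Suc p < Suc m"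
      proof (cases "Suc p = m")
        case True
        then have "p = z"
          using z by simp
        then show ?thesis
          using True e(1) d(2) xy(6) z(1) by simp
      next
        case False
        then show ?thesis
          using that c(4)[of p] by simp
      qed
    qed simp
    then have "P (Suc m)"
      unfolding P_def by blast
    then show False
      using m(2) by auto
  qed
  then obtain q where q: "q < m" "i = l q"
    by auto
  have w_q: "w = ?v q"
    using vertex_unique[OF \<Gamma>(1) w(1) v(1)[OF q(1)], of i] xy(1) q(2) by simp
  then have d_q: "d = a q \<or> d = b q"
    using w(2) d_flag(2) v(2)[OF q(1)] \<Gamma>(3) by auto
  have edge_b: "e = {b p, a (Suc p)}" if "Suc p < m" "b p \<in> e \<or> a (Suc p) \<in> e" for p
    using edge_unique[OF \<Gamma>(1) e(1) c(4)[OF that(1)]] that(2) by blast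
  \<comment> \<open>The edge at \<open>b q\<close> already leads on to \<open>a (Suc q)\<close>
    unless \<open>q\<close> is last. So \<open>b z\<close> would be \<open>a (Suc q)\<close>, which
    forces \<open>z = Suc q\<close> and makes the two flags of the last vertex equal.\<close>
  have "d \<noteq> b q"
  proof
    assume db: "d = b q"
    then have "q \<noteq> z"
      using d(1) by auto
    then have "Suc q < m"
      using q(1) z by linarith
    then have "e = {b q, a (Suc q)}"
      using edge_b d(2) db by blast
    then have bz: "b z = a (Suc q)"
      using d db by (auto simp: doubleton_eq_iff)
    then have "z = Suc q"
      using same[OF z(1) \<open>Suc q < m\<close>, of "b z"] by simp
    then show False
      using bz v(5)[OF z(1)] by simp
  qed
  then have da: "d = a q"
    using d_q by blast
  \<comment> \<open>For \<open>q = Suc p\<close> the flag \<open>a q\<close> is already joined to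
    \<open>b p\<close>, which would make \<open>p\<close> the last position.\<close>
  have "q = 0"
  proof (rule ccontr)
    assume "q \<noteq> 0"
    then obtain p where p: "q = Suc p"
      by (cases q) auto
    then have "e = {b p, a q}"
      using edge_b[of p] q(1) d(2) da by blast
    then have "b z = b p"
      using d da by (auto simp: doubleton_eq_iff)
    then have "z = p"
      using same[OF z(1), of p "b z"] p q(1) by simp
    then show False
      using p q(1) z by simp
  qed
  then have closing: "{b z, a 0} \<in> edges \<Gamma>"
    using e(1) d(2) da by simp
  have edge: "{b p, a (Suc p mod m)} \<in> edges \<Gamma>" if "p < m" for p
  proof (cases "Suc p = m")
    case True
    then have "p = z"
      using z by simp
    then show ?thesis
      using True closing by simp
  next
    case False
    then show ?thesis
      using that c(4)[of p] by simp
  qed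
  have prev: "\<exists>q<m. p = Suc q mod m" if "p < m" for p
  proof -
    have "p \<in> (\<lambda>q. Suc q mod m) ` {..<m}"
      unfolding Suc_mod_image using that by simp
    then show ?thesis
      by blast
  qed
  have edge_cases: "\<exists>q<m. f = {b q, a (Suc q mod m)}"
    if f: "f \<in> edges \<Gamma>" "p < m" "j \<in> f" "j \<in> {l p, a p, b p}" for f p j
  proof -
    have "j \<notin> legs \<Gamma>"
      using f(1,3) by (auto simp: legs_def)
    then have "j = a p \<or> j = b p"
      using f(4) v(2)[OF f(2)] \<Gamma>(3) by auto
    then show ?thesis
    proof
      assume "j = b p"
      then have "f = {b p, a (Suc p mod m)}"
        using edge_unique[OF \<Gamma>(1) f(1) edge[OF f(2)]] f(3) by simp
      then show ?thesis
        using f(2) by blast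
    next
      assume j: "j = a p"
      obtain q where q: "q < m" "p = Suc q mod m"
        using prev[OF f(2)] by blast
      then have "f = {b q, a (Suc q mod m)}"
        using edge_unique[OF \<Gamma>(1) f(1) edge[OF q(1)], of j] f(3) j by simp
      then show ?thesis
        using q(1) by blast
    qed
  qed
  \<comment> \<open>Both half-edges of every vertex in the closed chain are used up by its own
    edges, so the chain is closed under adjacency and, by connectedness, contains all
    vertices.\<close>
  have verts_eq: "verts \<Gamma> = ?v ` {..<m}"
  proof
    show "?v ` {..<m} \<subseteq> verts \<Gamma>"
      using v(1) by blast
    show "verts \<Gamma> \<subseteq> ?v ` {..<m}"
    proof
      fix w assume "w \<in> verts \<Gamma>"
      then have path: "(?v 0, w) \<in> (joined \<Gamma> (edges \<Gamma>))\<^sup>*"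
        by (rule stable_graphD(8)[OF \<Gamma>(1) v(1)[OF c(1)]])
      show "w \<in> ?v ` {..<m}"
      proof (rule closed_rtrancl[OF path])
        show "?v 0 \<in> ?v ` {..<m}"
          using c(1) by blast
        fix s t assume "s \<in> ?v ` {..<m}" and st: "(s, t) \<in> joined \<Gamma> (edges \<Gamma>)"
        then obtain p where p: "p < m" "s = ?v p"
          by blast
        obtain f i j where f: "t \<in> verts \<Gamma>" "f \<in> edges \<Gamma>" "i \<in> f" "i \<in> snd s" "j \<in> f" "j \<in> snd t"
          using st unfolding joined_def by (elim CollectE case_prodE conjE bexE) blast
        then obtain q where q: "q < m" "f = {b q, a (Suc q mod m)}"
          using edge_cases[OF f(2) p(1) f(3)] p(2) by auto
        have q': "Suc q mod m < m"
          using q(1) by simp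
        have "j \<in> snd (?v q) \<or> j \<in> snd (?v (Suc q mod m))"
          using f(5) q(2) by auto
        then have "t = ?v q \<or> t = ?v (Suc q mod m)"
          using vertex_unique[OF \<Gamma>(1) f(1) _ f(6)] v(1)[OF q(1)] v(1)[OF q'] by blast
        then show "t \<in> ?v ` {..<m}"
          using q(1) q' by blast
      qed
    qed
  qed
  have inj_v: "inj_on ?v {..<m}"
  proof (rule inj_onI)
    fix p q assume pq: "p \<in> {..<m}" "q \<in> {..<m}" "?v p = ?v q"
    then have "l p \<in> {l q, a q, b q}"
      by auto
    then show "p = q"
      using same[of p q "l p"] pq(1,2) by simp
  qed
  have m_eq: "m = n"
    using forms(1) card_image[OF inj_v] unfolding verts_eq by simp
  have "edges \<Gamma> = (\<lambda>p. {b p, a (Suc p mod m)}) ` {..<m}"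
  proof
    show "(\<lambda>p. {b p, a (Suc p mod m)}) ` {..<m} \<subseteq> edges \<Gamma>"
      using edge by blast
    show "edges \<Gamma> \<subseteq> (\<lambda>p. {b p, a (Suc p mod m)}) ` {..<m}"
    proof
      fix f assume f: "f \<in> edges \<Gamma>"
      then obtain j where j: "j \<in> f"
        using stable_graphD(5)[OF \<Gamma>(1) f] by fastforce
      then have "j \<in> flags \<Gamma>"
        using stable_graphD(6)[OF \<Gamma>(1) f] by blast
      then obtain p where "p < m" "j \<in> {l p, a p, b p}"
        unfolding flags_def verts_eq by auto
      then show "f \<in> (\<lambda>p. {b p, a (Suc p mod m)}) ` {..<m}"
        using edge_cases[OF f _ j] by blast
    qed
  qed
  then have "\<Gamma> = cyc n l a b"
    using verts_eq unfolding m_eq by (intro graph_eqI) simp_all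
  moreover have "cycle_data n l a b"
  proof
    show "3 \<le> n" by (rule assms(2))
    show "inj_on l {..<n}"
      using c(3) m_eq by simp
    show "inj_on a {..<n}" "inj_on b {..<n}"
      using same unfolding m_eq by (auto intro!: inj_onI)
    have "l ` {..<n} \<subseteq> {1..n}"
      using v(2) m_eq by auto
    then show "l ` {..<n} = {1..n}"
      using card_image[OF c(3)] m_eq by (intro card_subset_eq) simp_all
    fix p q assume pq: "p < n" "q < n"
    show "l p \<noteq> a q" "l p \<noteq> b q"
      using v(2)[of p] v(3)[of q] v(4)[of q] pq \<Gamma>(3) m_eq by auto
    show "a p \<noteq> b q"
    proof
      assume eq: "a p = b q"
      then have "p = q"
        using same[of p q "a p"] pq m_eq by simp
      then show False
        using eq v(5)[of p] pq m_eq by simp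
    qed
  qed
  ultimately show ?thesis
    using that c(2) by blast
qed

lemma (in cycle_data) same_vertex_cyc: "same_vertex (cyc n l a b) = Id_on {1..n}"
proof -
  have "i = j" if ij: "(i, j) \<in> same_vertex (cyc n l a b)" for i j
  proof -
    obtain p where p: "p < n" "i \<in> {l p, a p, b p}" "j \<in> {l p, a p, b p}"
      using ij by (auto simp: same_vertex_iff)
    have "i \<in> l ` {..<n}" "j \<in> l ` {..<n}"
      using ij by (simp_all only: same_vertex_iff legs_cyc labels)
    moreover have "a p \<notin> l ` {..<n}" "b p \<notin> l ` {..<n}"
      using distinct(1,2)[OF _ p(1)] by (metis imageE lessThan_iff)+
    ultimately have "i = l p" "j = l p"
      using p(2,3) by (metis insertE empty_iff)+
    then show ?thesis
      by simp
  qed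
  moreover have "i \<in> {1..n}" if "(i, j) \<in> same_vertex (cyc n l a b)" for i j
    using that unfolding same_vertex_iff legs_cyc by blast
  ultimately have "same_vertex (cyc n l a b) \<subseteq> Id_on {1..n}"
    by (intro subrelI) (metis Id_onI)
  moreover have "refl_on {1..n} (same_vertex (cyc n l a b))"
    using equiv_same_vertex[OF stable_cyc] legs_cyc by (simp add: equiv_def del: cyc_simps)
  ultimately show ?thesis
    by (auto simp: refl_on_def)
qed

section \<open>Enumerating the cycles by permutations that fix leg 1\<close>

definition standard_cycle :: "nat \<Rightarrow> (nat \<Rightarrow> nat) \<Rightarrow> graph" where
  "standard_cycle n \<pi> = cyc n (\<lambda>p. \<pi> (Suc p)) (\<lambda>p. n + 1 + 2 * p) (\<lambda>p. n + 2 + 2 * p)"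

text \<open>The half-edges are named by the numbers above \<open>n\<close>, the two kinds
  alternating, so they differ from the labels and from each other.\<close>

lemma standard_cycle_data:
  assumes "3 \<le> n" "\<And>p. p < n \<Longrightarrow> l p \<in> {1..n}" "inj_on l {..<n}"
  shows "cycle_data n l (\<lambda>p. n + 1 + 2 * p) (\<lambda>p. n + 2 + 2 * p)"
proof
  have "l ` {..<n} \<subseteq> {1..n}"
    using assms(2) by auto
  then show "l ` {..<n} = {1..n}"
    using card_image[OF assms(3)] by (intro card_subset_eq) simp_all
  fix p q assume pq: "p < n" "q < n"
  show "l p \<noteq> n + 1 + 2 * q" "l p \<noteq> n + 2 + 2 * q"
    using assms(2)[OF pq(1)] by auto
  show "n + 1 + 2 * p \<noteq> n + 2 + 2 * q"
    by presburger
qed (use assms in \<open>auto simp: inj_on_def\<close>)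

lemma permutes_labels:
  assumes "\<pi> permutes {2..n}"
  shows "\<And>p. p < n \<Longrightarrow> \<pi> (Suc p) \<in> {1..n}" "inj_on (\<lambda>p. \<pi> (Suc p)) {..<n}" "\<pi> (Suc 0) = 1"
proof -
  have "\<pi> permutes {1..n}"
    by (rule permutes_subset[OF assms]) auto
  then show "\<pi> (Suc p) \<in> {1..n}" if "p < n" for p
    using that permutes_in_image[of \<pi> "{1..n}" "Suc p"] by simp
  show "inj_on (\<lambda>p. \<pi> (Suc p)) {..<n}"
    using permutes_inj[OF assms] by (auto simp: inj_on_def inj_def)
  show "\<pi> (Suc 0) = 1"
    using permutes_not_in[OF assms, of "Suc 0"] by simp
qed

lemma standard_cycle_cycle_data:
  assumes "3 \<le> n" "\<pi> permutes {2..n}"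
  shows "cycle_data n (\<lambda>p. \<pi> (Suc p)) (\<lambda>p. n + 1 + 2 * p) (\<lambda>p. n + 2 + 2 * p)"
  by (rule standard_cycle_data[OF assms(1) permutes_labels(1,2)[OF assms(2)]])

text \<open>The reflection \<open>turn\<close>, transported to legs numbered from 1; it fixes 1 and
  reverses the remaining numbers.\<close>

definition mirror :: "nat \<Rightarrow> nat \<Rightarrow> nat" where
  "mirror n i = (if i \<in> {2..n} then n + 2 - i else i)"

lemma mirror_permutes: "mirror n permutes {2..n}"
proof (rule bij_imp_permutes)
  show "bij_betw (mirror n) {2..n} {2..n}"
    by (rule bij_betw_byWitness[where f' = "mirror n"]) (auto simp: mirror_def)
qed (auto simp: mirror_def)

lemma mirror_Suc: "p < n \<Longrightarrow> mirror n (Suc p) = Suc (turn n p)"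
  by (cases "p = 0") (auto simp: mirror_def turn_def)

text \<open>Reversal acts on positions and therefore composes with \<open>\<pi>\<close> on the
  right. It exchanges the two kinds of half-edges, which \<open>isomorphic_cyc\<close>
  absorbs.\<close>

lemma standard_cycle_mirror:
  assumes "3 \<le> n" "\<pi> permutes {2..n}"
  shows "isomorphic (standard_cycle n (\<pi> \<circ> mirror n)) (standard_cycle n \<pi>)"
proof -
  let ?l = "\<lambda>p. \<pi> (Suc p)" and ?a = "\<lambda>p. n + 1 + 2 * p" and ?b = "\<lambda>p. n + 2 + 2 * p"
  interpret c: cycle_data n ?l ?a ?b
    by (rule standard_cycle_cycle_data[OF assms])
  interpret t: cycle_data n "?l \<circ> turn n" "?b \<circ> turn n" "?a \<circ> turn n"
    by (rule c.turned)
  have "\<And>p. p < n \<Longrightarrow> (?l \<circ> turn n) p \<in> {1..n}"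
    using permutes_labels(1)[OF assms(2)] turn_less by simp
  then have data: "cycle_data n (?l \<circ> turn n) ?a ?b"
    by (rule standard_cycle_data[OF assms(1) _ t.inj(1)])
  have "standard_cycle n (\<pi> \<circ> mirror n) = cyc n (?l \<circ> turn n) ?a ?b"
    unfolding standard_cycle_def by (rule cyc_cong) (simp_all add: mirror_Suc)
  moreover have "standard_cycle n \<pi> = cyc n (?l \<circ> turn n) (?b \<circ> turn n) (?a \<circ> turn n)"
    unfolding standard_cycle_def cyc_turn ..
  ultimately show ?thesis
    using isomorphic_cyc[OF data c.turned] by simp
qed

lemma permutes_eqI:
  assumes "\<pi> permutes {2..n}" "\<sigma> permutes {2..n}" "\<And>p. p < n \<Longrightarrow> \<pi> (Suc p) = \<sigma> (Suc p)"
  shows "\<pi> = \<sigma>"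
proof
  fix i
  show "\<pi> i = \<sigma> i"
  proof (cases "i \<in> {2..n}")
    case True
    then show ?thesis
      using assms(3)[of "i - 1"] by (cases i) auto
  next
    case False
    then show ?thesis
      using permutes_not_in assms(1,2) by metis
  qed
qed

text \<open>Both cycles have leg 1 at position 0, which excludes rotations, so only the choice of
  direction is left.\<close>

lemma standard_cycle_isomorphicD:
  assumes "3 \<le> n" "\<pi> permutes {2..n}" "\<sigma> permutes {2..n}"
    and "isomorphic (standard_cycle n \<pi>) (standard_cycle n \<sigma>)"
  shows "\<sigma> = \<pi> \<or> \<sigma> = \<pi> \<circ> mirror n"
proof -
  obtain f where f: "isom f (cyc n (\<lambda>p. \<pi> (Suc p)) (\<lambda>p. n + 1 + 2 * p) (\<lambda>p. n + 2 + 2 * p))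
      (cyc n (\<lambda>p. \<sigma> (Suc p)) (\<lambda>p. n + 1 + 2 * p) (\<lambda>p. n + 2 + 2 * p))"
    using assms(4) unfolding standard_cycle_def isomorphic_def by blast
  have "\<pi> (Suc 0) = \<sigma> (Suc 0)"
    using permutes_labels(3) assms(2,3) by metis
  from standard_cycle_cycle_data[OF assms(1,2)] standard_cycle_cycle_data[OF assms(1,3)] this f
  show ?thesis
  proof (cases rule: isom_cycD)
    case same
    then have "\<pi> = \<sigma>"
      by (intro permutes_eqI[OF assms(2,3)]) blast
    then show ?thesis
      by simp
  next
    case turned
    then have "\<sigma> = \<pi> \<circ> mirror n"
      by (intro permutes_eqI[OF assms(3) permutes_compose[OF mirror_permutes assms(2)]])
        (simp add: mirror_Suc)
    then show ?thesis
      by simp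
  qed
qed

text \<open>The permutations of \<open>{2..n}\<close> map onto the classes of discrete graphs with
  fibres of two elements. The doubled form keeps the count within the integers.\<close>

lemma signed_count:
  assumes "3 \<le> n"
  shows "2 * (\<Sum>\<Gamma>\<in>reps n. weight \<Gamma>) = (- 1) ^ n * fact (n - 1)"
proof -
  define D where "D = {\<Gamma>. \<Gamma> \<in> reps n \<and> same_vertex \<Gamma> = Id_on {1..n}}"
  define perms where "perms = {\<pi>. \<pi> permutes {2..n}}"
  let ?g = "\<lambda>\<pi>. rep (standard_cycle n \<pi>)"
  have fin: "finite perms" "finite D"
    using finite_permutations[of "{2..n}"] finite_even_reps by (simp_all add: perms_def D_def)
  have genus: "standard_cycle n \<pi> \<in> genus_one n" "stable_graph (standard_cycle n \<pi>)"
    "\<not> odd_graph (standard_cycle n \<pi>)" "same_vertex (standard_cycle n \<pi>) = Id_on {1..n}"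
    "card (edges (standard_cycle n \<pi>)) = n"
    if "\<pi> \<in> perms" for \<pi>
  proof -
    have data: "cycle_data n (\<lambda>p. \<pi> (Suc p)) (\<lambda>p. n + 1 + 2 * p) (\<lambda>p. n + 2 + 2 * p)"
      using standard_cycle_cycle_data[OF assms] that by (simp add: perms_def)
    show "standard_cycle n \<pi> \<in> genus_one n" "stable_graph (standard_cycle n \<pi>)"
      "\<not> odd_graph (standard_cycle n \<pi>)" "same_vertex (standard_cycle n \<pi>) = Id_on {1..n}"
      "card (edges (standard_cycle n \<pi>)) = n"
      unfolding standard_cycle_def
      using cycle_data.genus_one_cyc[OF data] cycle_data.stable_cyc[OF data] not_odd_cyc[OF data]
        cycle_data.same_vertex_cyc[OF data] cycle_data.card_edges_cyc[OF data] by blast+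
  qed
  have g_D: "?g \<pi> \<in> D" "card (edges (?g \<pi>)) = n" if "\<pi> \<in> perms" for \<pi>
  proof -
    note g = genus[OF that]
    have iso: "isomorphic (standard_cycle n \<pi>) (?g \<pi>)"
      by (rule isomorphic_rep[OF g(2)])
    show "?g \<pi> \<in> D"
      using rep_mem_reps[OF g(1,3)] same_vertex_isomorphic[OF g(2) iso] g(4) by (simp add: D_def)
    show "card (edges (?g \<pi>)) = n"
      using isomorphic_card_edges[OF g(2) iso] g(5) by simp
  qed
  \<comment> \<open>The reflection sends 2 to \<open>n\<close>, which differs from 2 because
    \<open>3 \<le> n\<close>.\<close>
  have mirror_neq: "\<pi> \<circ> mirror n \<noteq> \<pi>" if "\<pi> \<in> perms" for \<pi>
  proof
    assume "\<pi> \<circ> mirror n = \<pi>"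
    then have "\<pi> (mirror n 2) = \<pi> 2"
      by (metis comp_apply)
    then have "mirror n 2 = 2"
      using permutes_inj[of \<pi> "{2..n}"] that by (simp add: perms_def inj_eq)
    then show False
      using assms by (simp add: mirror_def)
  qed
  have fiber: "\<exists>\<pi>\<in>perms. {\<sigma> \<in> perms. ?g \<sigma> = \<Gamma>} = {\<pi>, \<pi> \<circ> mirror n}" if \<Gamma>: "\<Gamma> \<in> D" for \<Gamma>
  proof -
    have \<Gamma>': "\<Gamma> \<in> genus_one n" "rep \<Gamma> = \<Gamma>" "same_vertex \<Gamma> = Id_on {1..n}"
      using \<Gamma> repsD by (auto simp: D_def)
    obtain l a b where lab: "cycle_data n l a b" "\<Gamma> = cyc n l a b" "l 0 = 1"
      by (rule discrete_cyc[OF \<Gamma>'(1) assms \<Gamma>'(3)])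
    interpret c: cycle_data n l a b by (rule lab(1))
    \<comment> \<open>Reads off the legs along the cycle, with leg \<open>i\<close> of the
      permutation at position \<open>i - 1\<close>; starting at leg 1 makes it fix 1.\<close>
    define \<pi> where "\<pi> i = (if i \<in> {1..n} then l (i - 1) else i)" for i
    have l_\<pi>: "\<pi> (Suc p) = l p" if "p < n" for p
      using that by (simp add: \<pi>_def)
    have "bij_betw \<pi> {1..n} {1..n}"
      unfolding bij_betw_def
    proof
      show "inj_on \<pi> {1..n}"
        using c.l_eq_iff by (auto simp: inj_on_def \<pi>_def)
      have "\<pi> ` {1..n} = (\<lambda>p. \<pi> (Suc p)) ` {..<n}"
        unfolding image_Suc_lessThan[symmetric] image_image ..
      also have "\<dots> = l ` {..<n}"
        using l_\<pi> by (intro image_cong) auto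
      finally show "\<pi> ` {1..n} = {1..n}"
        using c.labels by simp
    qed
    then have "\<pi> permutes {1..n}"
      by (rule bij_imp_permutes) (simp only: \<pi>_def if_False)
    moreover have "\<pi> x = x" if "x \<in> {1..n} - {2..n}" for x
    proof -
      have "x = 1"
        using that by auto
      then show ?thesis
        using lab(3) by (simp add: \<pi>_def)
    qed
    ultimately have "\<pi> permutes {2..n}"
      by (rule permutes_superset)
    then have \<pi>: "\<pi> \<in> perms"
      by (simp add: perms_def)
    have std: "standard_cycle n \<pi> = cyc n l (\<lambda>p. n + 1 + 2 * p) (\<lambda>p. n + 2 + 2 * p)"
      unfolding standard_cycle_def by (rule cyc_cong) (simp_all add: l_\<pi>)
    have "cycle_data n l (\<lambda>p. n + 1 + 2 * p) (\<lambda>p. n + 2 + 2 * p)"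
      using c.labels c.inj(1) by (intro standard_cycle_data[OF assms]) blast+
    then have "isomorphic (standard_cycle n \<pi>) \<Gamma>"
      unfolding std lab(2) by (rule isomorphic_cyc[OF _ lab(1)])
    then have g: "?g \<pi> = \<Gamma>"
      using rep_eq[OF genus(2)[OF \<pi>]] \<Gamma>'(2) by simp
    have m: "\<pi> \<circ> mirror n \<in> perms"
      using permutes_compose[OF mirror_permutes] \<pi> by (simp add: perms_def)
    have "isomorphic (standard_cycle n (\<pi> \<circ> mirror n)) (standard_cycle n \<pi>)"
      using standard_cycle_mirror[OF assms] \<pi> by (simp add: perms_def)
    then have g': "?g (\<pi> \<circ> mirror n) = \<Gamma>"
      using rep_eq[OF genus(2)[OF m]] g by simp
    have "\<sigma> = \<pi> \<or> \<sigma> = \<pi> \<circ> mirror n" if "\<sigma> \<in> perms" "?g \<sigma> = \<Gamma>" for \<sigma>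
      using standard_cycle_isomorphicD[OF assms, of \<pi> \<sigma>] rep_eqD[OF genus(2)[OF \<pi>] genus(2)[OF that(1)]]
        that g \<pi> by (simp add: perms_def)
    then have "{\<sigma> \<in> perms. ?g \<sigma> = \<Gamma>} = {\<pi>, \<pi> \<circ> mirror n}"
      using \<pi> m g g' by blast
    then show ?thesis
      using \<pi> by blast
  qed
  have "int (fact (n - 1)) = (\<Sum>\<pi>\<in>perms. 1)"
    using card_permutations[of "{2..n}" "n - 1"] by (simp add: perms_def)
  also have "\<dots> = (\<Sum>\<Gamma>\<in>D. \<Sum>\<pi>\<in>{\<pi> \<in> perms. ?g \<pi> = \<Gamma>}. 1)"
    by (rule sum.group[symmetric]) (use fin g_D(1) in \<open>simp_all add: image_subset_iff\<close>)
  also have "\<dots> = (\<Sum>\<Gamma>\<in>D. 2)"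
  proof (rule sum.cong[OF refl])
    fix \<Gamma> assume "\<Gamma> \<in> D"
    then obtain \<pi> where "\<pi> \<in> perms" "{\<sigma> \<in> perms. ?g \<sigma> = \<Gamma>} = {\<pi>, \<pi> \<circ> mirror n}"
      using fiber by blast
    then show "(\<Sum>\<pi>\<in>{\<pi> \<in> perms. ?g \<pi> = \<Gamma>}. 1 :: int) = 2"
      using not_sym[OF mirror_neq[of \<pi>]] by simp
  qed
  finally have "int (fact (n - 1)) = 2 * int (card D)"
    by simp
  moreover have "weight \<Gamma> = (- 1) ^ n" if \<Gamma>: "\<Gamma> \<in> D" for \<Gamma>
  proof -
    obtain \<pi> where \<pi>: "\<pi> \<in> perms" "{\<sigma> \<in> perms. ?g \<sigma> = \<Gamma>} = {\<pi>, \<pi> \<circ> mirror n}"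
      using fiber[OF \<Gamma>] by blast
    then have "?g \<pi> = \<Gamma>"
      by blast
    then show ?thesis
      using g_D(2)[OF \<pi>(1)] by (simp add: weight_def)
  qed
  then have "(\<Sum>\<Gamma>\<in>D. weight \<Gamma>) = (- 1) ^ n * int (card D)"
    by simp
  ultimately show ?thesis
    unfolding sum_weight_reps D_def[symmetric] by simp
qed

section \<open>Signs of orderings\<close>

text \<open>The sign relating two orderings of one finite set. For distinct lists with the same
  elements the permutation exists and is unique, so the choice is harmless.\<close>

definition order_sign :: "'a list \<Rightarrow> 'a list \<Rightarrow> int" where
  "order_sign xs ys = sign (SOME \<pi>. \<pi> permutes {..<length xs} \<and> permute_list \<pi> xs = ys)"

lemma permute_list_unique:
  assumes "distinct xs" "\<pi> permutes {..<length xs}" "\<sigma> permutes {..<length xs}"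
    and "permute_list \<pi> xs = permute_list \<sigma> xs"
  shows "\<pi> = \<sigma>"
proof
  fix i
  show "\<pi> i = \<sigma> i"
  proof (cases "i < length xs")
    case True
    have "xs ! \<pi> i = xs ! \<sigma> i"
      using permute_list_nth[OF assms(2) True] permute_list_nth[OF assms(3) True] assms(4) by simp
    moreover have "\<pi> i < length xs" "\<sigma> i < length xs"
      using permutes_in_image[OF assms(2), of i] permutes_in_image[OF assms(3), of i] True by simp_all
    ultimately show ?thesis
      using assms(1) by (simp add: nth_eq_iff_index_eq)
  next
    case False
    then show ?thesis
      using permutes_not_in[OF assms(2), of i] permutes_not_in[OF assms(3), of i] by simp
  qed
qed

lemma order_sign_permute:
  assumes "distinct xs" "\<pi> permutes {..<length xs}"
  shows "order_sign xs (permute_list \<pi> xs) = sign \<pi>"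
proof -
  let ?P = "\<lambda>\<sigma>. \<sigma> permutes {..<length xs} \<and> permute_list \<sigma> xs = permute_list \<pi> xs"
  have "?P (SOME \<sigma>. ?P \<sigma>)"
    by (rule someI[of ?P \<pi>]) (use assms(2) in simp)
  then have "(SOME \<sigma>. ?P \<sigma>) = \<pi>"
    using permute_list_unique[OF assms(1) _ assms(2)] by blast
  then show ?thesis
    by (simp add: order_sign_def)
qed

lemma reorderE:
  assumes "distinct xs" "distinct ys" "set xs = set ys"
  obtains \<pi> where "\<pi> permutes {..<length xs}" "ys = permute_list \<pi> xs"
proof -
  have "mset ys = mset xs"
    using assms by (simp add: set_eq_iff_mset_eq_distinct)
  then show ?thesis
    using that by (metis mset_eq_permutation)
qed

lemma order_sign_refl:
  assumes "distinct xs" shows "order_sign xs xs = 1"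
  using order_sign_permute[OF assms permutes_id] by simp

lemma order_sign_permute_right:
  assumes "distinct xs" "distinct ys" "set xs = set ys" "\<pi> permutes {..<length ys}"
  shows "order_sign xs (permute_list \<pi> ys) = order_sign xs ys * sign \<pi>"
proof -
  obtain \<sigma> where \<sigma>: "\<sigma> permutes {..<length xs}" "ys = permute_list \<sigma> xs"
    by (rule reorderE[OF assms(1-3)])
  then have \<pi>: "\<pi> permutes {..<length xs}"
    using assms(4) by simp
  have "permute_list \<pi> ys = permute_list (\<sigma> \<circ> \<pi>) xs"
    unfolding \<sigma>(2) by (rule permute_list_compose[OF \<pi>, symmetric])
  then have "order_sign xs (permute_list \<pi> ys) = sign (\<sigma> \<circ> \<pi>)"
    using order_sign_permute[OF assms(1) permutes_compose[OF \<pi> \<sigma>(1)]] by simp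
  also have "\<dots> = sign \<sigma> * sign \<pi>"
    using \<sigma>(1) \<pi> by (intro sign_compose) (auto simp: permutation_permutes)
  finally show ?thesis
    using order_sign_permute[OF assms(1) \<sigma>(1)] \<sigma>(2) by simp
qed

lemma order_sign_trans:
  assumes "distinct xs" "distinct ys" "distinct zs" "set xs = set ys" "set ys = set zs"
  shows "order_sign xs zs = order_sign xs ys * order_sign ys zs"
proof -
  obtain \<pi> where \<pi>: "\<pi> permutes {..<length ys}" "zs = permute_list \<pi> ys"
    by (rule reorderE[OF assms(2,3,5)])
  then show ?thesis
    using order_sign_permute_right[OF assms(1,2,4) \<pi>(1)] order_sign_permute[OF assms(2) \<pi>(1)] by simp
qed

lemma order_sign_map:
  assumes "distinct xs" "distinct ys" "set xs = set ys" "inj_on h (set xs)"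
  shows "order_sign (map h xs) (map h ys) = order_sign xs ys"
proof -
  obtain \<pi> where \<pi>: "\<pi> permutes {..<length xs}" "ys = permute_list \<pi> xs"
    by (rule reorderE[OF assms(1-3)])
  have "map h ys = permute_list \<pi> (map h xs)"
    unfolding \<pi>(2) by (rule permute_list_map[OF \<pi>(1), symmetric])
  moreover have "distinct (map h xs)"
    using assms(1,4) by (simp add: distinct_map)
  ultimately show ?thesis
    using order_sign_permute[of "map h xs" \<pi>] order_sign_permute[OF assms(1) \<pi>(1)] \<pi> by simp
qed

text \<open>Here \<open>p\<close> permutes the elements while \<open>order_sign\<close> refers to
  positions. Indexing by \<open>xs\<close> carries one permutation to the other and preserves the
  sign.\<close>

lemma order_sign_permutation:
  assumes "distinct xs" "p permutes set xs"
  shows "order_sign xs (map p xs) = sign p"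
proof -
  have img: "set (map p xs) = set xs"
    using permutes_image[OF assms(2)] by simp
  have dist: "distinct (map p xs)"
    using assms permutes_inj_on[OF assms(2)] by (simp add: distinct_map)
  obtain \<pi> where \<pi>: "\<pi> permutes {..<length xs}" "map p xs = permute_list \<pi> xs"
    by (rule reorderE[OF assms(1) dist img[symmetric]])
  have nth: "inj_on ((!) xs) {..<length xs}"
    using assms(1) by (auto simp: inj_on_def nth_eq_iff_index_eq)
  have set: "(!) xs ` {..<length xs} = set xs"
    by (auto simp: set_conv_nth)
  have "p = map_permutation {..<length xs} ((!) xs) \<pi>"
  proof
    fix e
    show "p e = map_permutation {..<length xs} ((!) xs) \<pi> e"
    proof (cases "e \<in> set xs")
      case True
      then obtain i where i: "i < length xs" "e = xs ! i"
        by (auto simp: set_conv_nth)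
      have "p e = map p xs ! i"
        using i by simp
      also have "\<dots> = xs ! \<pi> i"
        unfolding \<pi>(2) by (rule permute_list_nth[OF \<pi>(1) i(1)])
      finally show ?thesis
        using map_permutation_apply[OF nth, of i \<pi>] i by simp
    next
      case False
      then show ?thesis
        using permutes_not_in[OF assms(2)] by (simp add: map_permutation_def set)
    qed
  qed
  then have "sign p = sign \<pi>"
    using sign_map_permutation[OF nth \<pi>(1)] by simp
  then show ?thesis
    using order_sign_permute[OF assms(1) \<pi>(1)] \<pi>(2) by simp
qed

section \<open>Dimension of the cochain spaces\<close>

lemma fun_sum_apply: "(\<Sum>r\<in>R. f r) x = (\<Sum>r\<in>R. f r x :: 'k::field)"
  by (induction R rule: infinite_finite_induct) simp_all

text \<open>Evaluations at the points \<open>ev s\<close> act as dual functionals: they separate the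
  \<open>B r\<close>, which gives independence, and supply the coefficients that give
  spanning.\<close>

lemma dim_dual_basis:
  fixes B :: "'r \<Rightarrow> 'c \<Rightarrow> 'k::field"
  assumes "finite R" "\<And>r. r \<in> R \<Longrightarrow> B r \<in> V"
    and dual: "\<And>r s. r \<in> R \<Longrightarrow> s \<in> R \<Longrightarrow> B r (ev s) = (if r = s then 1 else 0)"
    and expand: "\<And>\<psi>. \<psi> \<in> V \<Longrightarrow> \<psi> = (\<Sum>r\<in>R. fscale (\<psi> (ev r)) (B r))"
  shows "fun_vs.dim V = card R"
proof (rule fun_vs.dim_unique)
  have inj: "inj_on B R"
  proof (rule inj_onI)
    fix r s assume rs: "r \<in> R" "s \<in> R" "B r = B s"
    then have "B r (ev r) = B s (ev r)"
      by simp
    then show "r = s"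
      using dual rs(1,2) by (auto split: if_splits)
  qed
  show "B ` R \<subseteq> V"
    using assms(2) by blast
  show "V \<subseteq> fun_vs.span (B ` R)"
  proof
    fix \<psi> assume "\<psi> \<in> V"
    moreover have "(\<Sum>r\<in>R. fscale (\<psi> (ev r)) (B r)) \<in> fun_vs.span (B ` R)"
      by (intro fun_vs.span_sum fun_vs.span_scale fun_vs.span_base) blast
    ultimately show "\<psi> \<in> fun_vs.span (B ` R)"
      using expand by metis
  qed
  show "fun_vs.independent (B ` R)"
  proof (rule fun_vs.independent_if_scalars_zero)
    fix c b assume sum: "(\<Sum>b\<in>B ` R. fscale (c b) b) = 0" and "b \<in> B ` R"
    then obtain s where s: "s \<in> R" "b = B s"
      by blast
    have "0 = (\<Sum>r\<in>R. fscale (c (B r)) (B r)) (ev s)"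
      using sum by (simp add: sum.reindex[OF inj])
    also have "\<dots> = (\<Sum>r\<in>R. if r = s then c (B r) else 0)"
      unfolding fun_sum_apply fscale_def using dual s(1) by (intro sum.cong) auto
    also have "\<dots> = c b"
      using assms(1) s by simp
    finally show "c b = 0"
      by simp
  qed (use assms(1) in simp)
  show "card (B ` R) = card R"
    by (rule card_image[OF inj])
qed

section \<open>Cochains of an operad with one-dimensional components in genus zero and one\<close>

locale rank_one_operad =
  fixes M :: "('k::field_char_0, 'b) operad_data"
    and u :: "vertex \<Rightarrow> 'b \<Rightarrow> 'k" and \<kappa> :: "vertex \<Rightarrow> ('b \<Rightarrow> 'k) \<Rightarrow> 'k"
  assumes space: "stable_vertex v \<Longrightarrow> fst v \<le> 1 \<Longrightarrow> op_space M v = range (\<lambda>c. fscale c (u v))"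
    and coord: "stable_vertex v \<Longrightarrow> fst v \<le> 1 \<Longrightarrow> \<kappa> v (fscale c (u v)) = c"
    and act_space: "stable_vertex v \<Longrightarrow> fst v \<le> 1 \<Longrightarrow> inj_on f (snd v) \<Longrightarrow> a \<in> op_space M v
      \<Longrightarrow> op_act M v f a \<in> op_space M (relabel_vertex f v)"
    and coord_act: "stable_vertex v \<Longrightarrow> fst v \<le> 1 \<Longrightarrow> inj_on f (snd v) \<Longrightarrow> a \<in> op_space M v
      \<Longrightarrow> \<kappa> (relabel_vertex f v) (op_act M v f a) = \<kappa> v a"
begin

lemma genus_one_vertex:
  assumes "\<Gamma> \<in> genus_one n" "v \<in> verts \<Gamma>"
  shows "stable_vertex v" "fst v \<le> 1"
  using stable_graphD(3)[OF genus_oneD(1)[OF assms(1)] assms(2)]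
    genus_le_total_genus[OF genus_oneD(1)[OF assms(1)] assms(2)] genus_oneD(2)[OF assms(1)] by simp_all

definition unit_dec :: "graph \<Rightarrow> vertex \<Rightarrow> 'b \<Rightarrow> 'k" where
  "unit_dec \<Gamma> = (\<lambda>v\<in>verts \<Gamma>. u v)"

text \<open>The tensor product of the coordinates. It vanishes off the decorations because the
  elements of \<open>dual_labels\<close> do.\<close>

definition dec_coord :: "graph \<Rightarrow> (vertex \<Rightarrow> 'b \<Rightarrow> 'k) \<Rightarrow> 'k" where
  "dec_coord \<Gamma> x = (if x \<in> decorations M \<Gamma> then \<Prod>v\<in>verts \<Gamma>. \<kappa> v (x v) else 0)"

lemma fscale_one [simp]: "fscale 1 a = a"
  by (simp add: fscale_def)

lemma u_space: "stable_vertex v \<Longrightarrow> fst v \<le> 1 \<Longrightarrow> u v \<in> op_space M v"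
  using space[of v] by (metis fscale_one rangeI)

lemma coord_u: "stable_vertex v \<Longrightarrow> fst v \<le> 1 \<Longrightarrow> \<kappa> v (u v) = 1"
  using coord[of v 1] by simp

lemma unit_dec_mem: "\<Gamma> \<in> genus_one n \<Longrightarrow> unit_dec \<Gamma> \<in> decorations M \<Gamma>"
  using u_space genus_one_vertex unfolding unit_dec_def decorations_def by (simp add: restrict_PiE_iff)

lemma dec_coord_unit: "\<Gamma> \<in> genus_one n \<Longrightarrow> dec_coord \<Gamma> (unit_dec \<Gamma>) = 1"
  using unit_dec_mem[of \<Gamma> n] coord_u genus_one_vertex[of \<Gamma> n]
  by (simp add: dec_coord_def unit_dec_def)

text \<open>A functional on a line is a multiple of its coordinate, so every decomposable form is a
  multiple of the product of the coordinates.\<close>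

lemma dual_labels_line:
  assumes "\<Gamma> \<in> genus_one n"
  shows "dual_labels M \<Gamma> = range (\<lambda>c. fscale c (dec_coord \<Gamma>))"
proof
  let ?S = "{(\<lambda>x. if x \<in> decorations M \<Gamma> then \<Prod>v\<in>verts \<Gamma>. \<alpha> v (x v) else 0) | \<alpha>.
        \<forall>v\<in>verts \<Gamma>. \<alpha> v \<in> functionals (op_space M v)}"
  note v = genus_one_vertex[OF assms]
  have "?S \<subseteq> range (\<lambda>c. fscale c (dec_coord \<Gamma>))"
  proof
    fix \<psi> assume "\<psi> \<in> ?S"
    then obtain \<alpha> where \<alpha>: "\<psi> = (\<lambda>x. if x \<in> decorations M \<Gamma> then \<Prod>v\<in>verts \<Gamma>. \<alpha> v (x v) else 0)"
      "\<forall>v\<in>verts \<Gamma>. \<alpha> v \<in> functionals (op_space M v)"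
      by blast
    have "\<psi> x = (\<Prod>v\<in>verts \<Gamma>. \<alpha> v (u v)) * dec_coord \<Gamma> x" for x
    proof (cases "x \<in> decorations M \<Gamma>")
      case True
      have "\<alpha> w (x w) = \<alpha> w (u w) * \<kappa> w (x w)" if w: "w \<in> verts \<Gamma>" for w
      proof -
        have "x w \<in> op_space M w"
          using True w unfolding decorations_def by blast
        then obtain c where c: "x w = fscale c (u w)"
          using space[OF v[OF w]] by blast
        have "\<alpha> w (fscale c (u w)) = c * \<alpha> w (u w)"
          using \<alpha>(2) w u_space[OF v[OF w]] unfolding functionals_def by blast
        then show ?thesis
          using c coord[OF v[OF w]] by simp
      qed
      then have "(\<Prod>w\<in>verts \<Gamma>. \<alpha> w (x w)) = (\<Prod>w\<in>verts \<Gamma>. \<alpha> w (u w) * \<kappa> w (x w))"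
        by (intro prod.cong) auto
      then show ?thesis
        using True \<alpha>(1) by (simp add: dec_coord_def prod.distrib)
    qed (simp add: \<alpha>(1) dec_coord_def)
    then show "\<psi> \<in> range (\<lambda>c. fscale c (dec_coord \<Gamma>))"
      by (intro range_eqI[of _ _ "\<Prod>v\<in>verts \<Gamma>. \<alpha> v (u v)"]) (simp add: fscale_def fun_eq_iff)
  qed
  then show "dual_labels M \<Gamma> \<subseteq> range (\<lambda>c. fscale c (dec_coord \<Gamma>))"
    unfolding dual_labels_def by (rule fun_vs.span_minimal[OF _ subspace_line])
  have "\<kappa> w \<in> functionals (op_space M w)" if w: "w \<in> verts \<Gamma>" for w
  proof -
    have "\<kappa> w (fscale c (u w) + fscale d (u w)) = c + d" for c d
      using coord[OF v[OF w], of "c + d"] by (simp add: fun_vs.scale_left_distrib)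
    moreover have "\<kappa> w (fscale c (fscale d (u w))) = c * d" for c d
      using coord[OF v[OF w], of "c * d"] by (simp add: fun_vs.scale_scale)
    ultimately show ?thesis
      using coord[OF v[OF w]] unfolding functionals_def space[OF v[OF w]] by auto
  qed
  then have "dec_coord \<Gamma> \<in> ?S"
    unfolding dec_coord_def[abs_def] by blast
  then have "dec_coord \<Gamma> \<in> dual_labels M \<Gamma>"
    unfolding dual_labels_def by (rule fun_vs.span_base)
  then show "range (\<lambda>c. fscale c (dec_coord \<Gamma>)) \<subseteq> dual_labels M \<Gamma>"
    unfolding dual_labels_def by (auto intro: fun_vs.span_scale)
qed

lemma relabel_dec:
  assumes "\<Gamma> \<in> genus_one n" "inj_on f (flags \<Gamma>)" "x \<in> decorations M \<Gamma>"
  shows "relabel_decoration M f \<Gamma> x \<in> decorations M (relabel_graph f \<Gamma>)"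
    and "dec_coord (relabel_graph f \<Gamma>) (relabel_decoration M f \<Gamma> x) = dec_coord \<Gamma> x"
proof -
  have inj: "inj_on (relabel_vertex f) (verts \<Gamma>)"
    by (rule inj_on_relabel_vertex[OF assms(2)])
  have xv: "x v \<in> op_space M v" if "v \<in> verts \<Gamma>" for v
    using assms(3) that unfolding decorations_def by blast
  have inj_v: "inj_on f (snd v)" if "v \<in> verts \<Gamma>" for v
    by (rule inj_on_subset[OF assms(2) snd_subset_flags[OF that]])
  have val: "relabel_decoration M f \<Gamma> x (relabel_vertex f v) = op_act M v f (x v)" if "v \<in> verts \<Gamma>" for v
    using that by (simp add: relabel_decoration_def inv_into_f_f[OF inj])
  have "relabel_decoration M f \<Gamma> x w \<in> op_space M w" if "w \<in> verts (relabel_graph f \<Gamma>)" for w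
  proof -
    obtain v where "v \<in> verts \<Gamma>" "w = relabel_vertex f v"
      using \<open>w \<in> verts (relabel_graph f \<Gamma>)\<close> unfolding relabel_graph_simps by blast
    then show ?thesis
      using val act_space genus_one_vertex[OF assms(1)] inj_v xv by simp
  qed
  then show mem: "relabel_decoration M f \<Gamma> x \<in> decorations M (relabel_graph f \<Gamma>)"
    unfolding decorations_def by (intro PiE_I) (simp_all add: relabel_decoration_def)
  have "(\<Prod>w\<in>verts (relabel_graph f \<Gamma>). \<kappa> w (relabel_decoration M f \<Gamma> x w)) = (\<Prod>v\<in>verts \<Gamma>. \<kappa> v (x v))"
    unfolding relabel_graph_simps prod.reindex[OF inj] o_def
  proof (rule prod.cong[OF refl])
    fix v assume v: "v \<in> verts \<Gamma>"
    show "\<kappa> (relabel_vertex f v) (relabel_decoration M f \<Gamma> x (relabel_vertex f v)) = \<kappa> v (x v)"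
      unfolding val[OF v] by (rule coord_act[OF genus_one_vertex[OF assms(1) v] inj_v[OF v] xv[OF v]])
  qed
  then show "dec_coord (relabel_graph f \<Gamma>) (relabel_decoration M f \<Gamma> x) = dec_coord \<Gamma> x"
    using mem assms(3) unfolding dec_coord_def by simp
qed

lemma cells_iff:
  "(\<Gamma>, es, x) \<in> cells M 1 n d \<longleftrightarrow>
     \<Gamma> \<in> genus_one n \<and> distinct es \<and> set es = edges \<Gamma> \<and> length es = d \<and> x \<in> decorations M \<Gamma>"
  by (auto simp: cells_def genus_one_def)

lemmas cells_iffs = cells_iff cells_iff[unfolded One_nat_def]

text \<open>The labels at \<open>\<Gamma>\<close> form a line, so a cochain is determined by its
  values on unit decorations; afterwards only the edge orderings have to be tracked.\<close>

lemma cochain_factor: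
  assumes "\<Psi> \<in> feynman_cochains M 1 n d" "\<Gamma> \<in> genus_one n"
  shows "\<Psi> (\<Gamma>, es, x) = \<Psi> (\<Gamma>, es, unit_dec \<Gamma>) * dec_coord \<Gamma> x"
proof -
  from assms(1) have "\<forall>\<Gamma> es. (\<lambda>x. \<Psi> (\<Gamma>, es, x)) \<in> dual_labels M \<Gamma>"
    unfolding feynman_cochains_def by (elim CollectE conjE)
  then have "(\<lambda>x. \<Psi> (\<Gamma>, es, x)) \<in> dual_labels M \<Gamma>"
    by (elim allE)
  then obtain c where c: "(\<lambda>x. \<Psi> (\<Gamma>, es, x)) = fscale c (dec_coord \<Gamma>)"
    unfolding dual_labels_line[OF assms(2)] by blast
  then have "\<Psi> (\<Gamma>, es, x) = c * dec_coord \<Gamma> x" for x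
    by (metis fscale_def)
  then show ?thesis
    using dec_coord_unit[OF assms(2)] by simp
qed

lemma cochain_outside:
  assumes "\<Psi> \<in> feynman_cochains M 1 n d" "c \<notin> cells M 1 n d"
  shows "\<Psi> c = 0"
  using assms by (cases c) (auto simp: feynman_cochains_def)

lemma cochain_permute:
  assumes "\<Psi> \<in> feynman_cochains M 1 n d" "(\<Gamma>, es, x) \<in> cells M 1 n d" "\<pi> permutes {..<d}"
  shows "\<Psi> (\<Gamma>, permute_list \<pi> es, x) = of_int (sign \<pi>) * \<Psi> (\<Gamma>, es, x)"
  using assms unfolding feynman_cochains_def by blast

lemma cochain_isom:
  assumes "\<Psi> \<in> feynman_cochains M 1 n d" "\<Gamma> \<in> genus_one n" "distinct es" "set es = edges \<Gamma>"
    "length es = d" "isom f \<Gamma> \<Delta>"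
  shows "\<Psi> (\<Delta>, map ((`) f) es, unit_dec \<Delta>) = \<Psi> (\<Gamma>, es, unit_dec \<Gamma>)"
proof -
  have f: "inj_on f (flags \<Gamma>)" "\<forall>l\<in>legs \<Gamma>. f l = l" "relabel_graph f \<Gamma> = \<Delta>"
    using assms(6) by (auto simp: isom_def)
  have \<Delta>: "\<Delta> \<in> genus_one n"
    by (rule isomorphic_genus_one[OF assms(2)]) (use assms(6) in \<open>auto simp: isomorphic_def\<close>)
  let ?y = "relabel_decoration M f \<Gamma> (unit_dec \<Gamma>)"
  have "(\<Gamma>, es, unit_dec \<Gamma>) \<in> cells M 1 n d"
    using assms unit_dec_mem by (simp add: cells_iffs)
  then have "\<Psi> (relabel_graph f \<Gamma>, map ((`) f) es, ?y) = \<Psi> (\<Gamma>, es, unit_dec \<Gamma>)"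
    using assms(1) f(1,2) unfolding feynman_cochains_def by blast
  moreover have "dec_coord \<Delta> ?y = 1"
    using relabel_dec(2)[OF assms(2) f(1) unit_dec_mem[OF assms(2)]] dec_coord_unit[OF assms(2)] f(3) by simp
  ultimately show ?thesis
    using cochain_factor[OF assms(1) \<Delta>, of "map ((`) f) es" ?y] f(3) by simp
qed

lemma isom_map_edges:
  assumes "\<Gamma> \<in> genus_one n" "distinct es" "set es = edges \<Gamma>" "isom f \<Gamma> \<Delta>"
  shows "distinct (map ((`) f) es)" "set (map ((`) f) es) = edges \<Delta>"
  using assms inj_on_image_edges[OF genus_oneD(1)[OF assms(1)], of f] by (auto simp: isom_def distinct_map)

lemma order_sign_automorphism:
  assumes "\<Gamma> \<in> genus_one n" "distinct es" "set es = edges \<Gamma>" "isom f \<Gamma> \<Gamma>"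
  shows "order_sign es (map ((`) f) es) = sign (edge_perm f \<Gamma>)"
proof -
  have *: "map ((`) f) es = map (edge_perm f \<Gamma>) es"
    using assms(3) by (simp add: edge_perm_def)
  show ?thesis
    unfolding * using edge_perm_permutes[OF genus_oneD(1)[OF assms(1)] assms(4)]
    by (intro order_sign_permutation[OF assms(2)]) (simp only: assms(3))
qed

lemma cochain_order_sign:
  assumes "\<Psi> \<in> feynman_cochains M 1 n d" "\<Gamma> \<in> genus_one n"
    "distinct es" "set es = edges \<Gamma>" "length es = d" "distinct es'" "set es' = edges \<Gamma>"
  shows "\<Psi> (\<Gamma>, es', unit_dec \<Gamma>) = of_int (order_sign es es') * \<Psi> (\<Gamma>, es, unit_dec \<Gamma>)"
proof -
  obtain \<pi> where \<pi>: "\<pi> permutes {..<length es}" "es' = permute_list \<pi> es"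
    by (rule reorderE[OF assms(3,6)]) (simp add: assms(4,7))
  have "(\<Gamma>, es, unit_dec \<Gamma>) \<in> cells M 1 n d"
    using assms unit_dec_mem by (simp add: cells_iffs)
  then show ?thesis
    using cochain_permute[OF assms(1)] \<pi> assms(5) order_sign_permute[OF assms(3) \<pi>(1)] by simp
qed

text \<open>An automorphism leaves the value unchanged but reorders the edges by an odd permutation.
  The value equals its own negative and is zero in characteristic zero.\<close>

lemma cochain_odd_graph:
  assumes "\<Psi> \<in> feynman_cochains M 1 n d" "\<Gamma> \<in> genus_one n" "odd_graph \<Gamma>"
    "distinct es" "set es = edges \<Gamma>" "length es = d"
  shows "\<Psi> (\<Gamma>, es, unit_dec \<Gamma>) = 0"
proof -
  obtain f where f: "isom f \<Gamma> \<Gamma>" "sign (edge_perm f \<Gamma>) = - 1"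
    using assms(3) by (auto simp: odd_graph_def)
  have "\<Psi> (\<Gamma>, es, unit_dec \<Gamma>) = \<Psi> (\<Gamma>, map ((`) f) es, unit_dec \<Gamma>)"
    using cochain_isom[OF assms(1,2,4-6) f(1)] by simp
  also have "\<dots> = of_int (order_sign es (map ((`) f) es)) * \<Psi> (\<Gamma>, es, unit_dec \<Gamma>)"
    by (rule cochain_order_sign[OF assms(1,2,4-6) isom_map_edges[OF assms(2,4,5) f(1)]])
  also have "\<dots> = - \<Psi> (\<Gamma>, es, unit_dec \<Gamma>)"
    using order_sign_automorphism[OF assms(2,4,5) f(1)] f(2) by simp
  finally have "\<Psi> (\<Gamma>, es, unit_dec \<Gamma>) + \<Psi> (\<Gamma>, es, unit_dec \<Gamma>) = 0"
    unfolding eq_neg_iff_add_eq_0 .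
  then have "2 * \<Psi> (\<Gamma>, es, unit_dec \<Gamma>) = 0"
    by (simp only: mult_2)
  then show ?thesis
    by simp
qed

definition edge_list :: "graph \<Rightarrow> nat set list" where
  "edge_list \<Gamma> = (SOME es. distinct es \<and> set es = edges \<Gamma>)"

lemma edge_list:
  assumes "\<Gamma> \<in> genus_one n"
  shows "distinct (edge_list \<Gamma>)" "set (edge_list \<Gamma>) = edges \<Gamma>" "length (edge_list \<Gamma>) = card (edges \<Gamma>)"
proof -
  have "\<exists>es. distinct es \<and> set es = edges \<Gamma>"
    using finite_distinct_list[OF finite_edges[OF genus_oneD(1)[OF assms]]] by blast
  then have *: "distinct (edge_list \<Gamma>) \<and> set (edge_list \<Gamma>) = edges \<Gamma>"
    unfolding edge_list_def by (rule someI_ex)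
  then show "distinct (edge_list \<Gamma>)" "set (edge_list \<Gamma>) = edges \<Gamma>"
    by simp_all
  then show "length (edge_list \<Gamma>) = card (edges \<Gamma>)"
    by (metis distinct_card)
qed

text \<open>Compares an edge ordering of \<open>\<Gamma>\<close> with the reference ordering of
  \<open>\<Gamma>\<^sub>0\<close>, transported along some isomorphism. It is meaningful when
  \<open>\<Gamma>\<^sub>0\<close> has no odd automorphism.\<close>

definition orientation :: "graph \<Rightarrow> graph \<Rightarrow> nat set list \<Rightarrow> int" where
  "orientation \<Gamma>\<^sub>0 \<Gamma> es = order_sign (map ((`) (SOME f. isom f \<Gamma>\<^sub>0 \<Gamma>)) (edge_list \<Gamma>\<^sub>0)) es"

text \<open>Two isomorphisms to \<open>\<Gamma>\<close> differ by an automorphism of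
  \<open>\<Gamma>\<^sub>0\<close>, which is even on edges, so the transported orderings have the
  same sign.\<close>

lemma orientation_eq:
  assumes "\<Gamma>\<^sub>0 \<in> genus_one n" "\<not> odd_graph \<Gamma>\<^sub>0" "isom f \<Gamma>\<^sub>0 \<Gamma>" "distinct es" "set es = edges \<Gamma>"
  shows "orientation \<Gamma>\<^sub>0 \<Gamma> es = order_sign (map ((`) f) (edge_list \<Gamma>\<^sub>0)) es"
proof -
  define g where "g = (SOME f. isom f \<Gamma>\<^sub>0 \<Gamma>)"
  have g: "isom g \<Gamma>\<^sub>0 \<Gamma>"
    unfolding g_def by (rule someI[of _ f]) (rule assms(3))
  note s = genus_oneD(1)[OF assms(1)]
  note el = edge_list(1,2)[OF assms(1)]
  let ?h = "inv_into (flags \<Gamma>\<^sub>0) f \<circ> g"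
  have h: "isom ?h \<Gamma>\<^sub>0 \<Gamma>\<^sub>0"
    by (rule isom_compose[OF s g isom_inverse[OF s assms(3)]])
  have fh: "map ((`) f) (map ((`) ?h) (edge_list \<Gamma>\<^sub>0)) = map ((`) g) (edge_list \<Gamma>\<^sub>0)"
  proof -
    have "f ` ?h ` e = g ` e" if "e \<in> edges \<Gamma>\<^sub>0" for e
    proof -
      have "f (inv_into (flags \<Gamma>\<^sub>0) f (g i)) = g i" if "i \<in> e" for i
      proof (rule f_inv_into_f)
        have "i \<in> flags \<Gamma>\<^sub>0"
          using stable_graphD(6)[OF s \<open>e \<in> edges \<Gamma>\<^sub>0\<close>] \<open>i \<in> e\<close> by blast
        then have "g i \<in> flags \<Gamma>"
          using g flags_relabel[of g \<Gamma>\<^sub>0] by (auto simp: isom_def)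
        then show "g i \<in> f ` flags \<Gamma>\<^sub>0"
          using assms(3) flags_relabel[of f \<Gamma>\<^sub>0] by (auto simp: isom_def)
      qed
      then show ?thesis
        by (simp add: image_image)
    qed
    then show ?thesis
      using el(2) by simp
  qed
  have "sign (edge_perm ?h \<Gamma>\<^sub>0) = 1"
    using assms(2) h sign_cases[of "edge_perm ?h \<Gamma>\<^sub>0"] by (auto simp: odd_graph_def)
  then have "order_sign (edge_list \<Gamma>\<^sub>0) (map ((`) ?h) (edge_list \<Gamma>\<^sub>0)) = 1"
    using order_sign_automorphism[OF assms(1) el h] by simp
  moreover have "inj_on ((`) f) (set (edge_list \<Gamma>\<^sub>0))"
    using inj_on_image_edges[OF s, of f] assms(3) el(2) by (simp add: isom_def)
  then have "order_sign (map ((`) f) (edge_list \<Gamma>\<^sub>0)) (map ((`) f) (map ((`) ?h) (edge_list \<Gamma>\<^sub>0)))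
      = order_sign (edge_list \<Gamma>\<^sub>0) (map ((`) ?h) (edge_list \<Gamma>\<^sub>0))"
    by (intro order_sign_map[OF el(1) isom_map_edges(1)[OF assms(1) el h]])
      (simp_all only: isom_map_edges(2)[OF assms(1) el h] el(2))
  ultimately have "order_sign (map ((`) f) (edge_list \<Gamma>\<^sub>0)) (map ((`) g) (edge_list \<Gamma>\<^sub>0)) = 1"
    unfolding fh by (simp only:)
  then show ?thesis
    using order_sign_trans[OF isom_map_edges(1)[OF assms(1) el assms(3)]
        isom_map_edges(1)[OF assms(1) el g] assms(4)]
      isom_map_edges(2)[OF assms(1) el assms(3)] isom_map_edges(2)[OF assms(1) el g] assms(5)
    by (simp add: orientation_def flip: g_def)
qed

definition basis_cochain :: "nat \<Rightarrow> nat \<Rightarrow> graph \<Rightarrow> ('k, 'b) cell \<Rightarrow> 'k" where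
  "basis_cochain n d \<Gamma>\<^sub>0 = (\<lambda>(\<Gamma>, es, x). if (\<Gamma>, es, x) \<in> cells M 1 n d \<and> isomorphic \<Gamma>\<^sub>0 \<Gamma>
     then of_int (orientation \<Gamma>\<^sub>0 \<Gamma> es) * dec_coord \<Gamma> x else 0)"

text \<open>The alternating property and the invariance under isomorphisms reduce to the behaviour
  of \<open>order_sign\<close> once \<open>orientation_eq\<close> allows a convenient isomorphism to
  be chosen.\<close>

lemma basis_cochain_mem:
  assumes \<Gamma>\<^sub>0: "\<Gamma>\<^sub>0 \<in> genus_one n" "\<not> odd_graph \<Gamma>\<^sub>0"
  shows "basis_cochain n d \<Gamma>\<^sub>0 \<in> feynman_cochains M 1 n d"
  unfolding feynman_cochains_def
proof (intro CollectI conjI allI impI)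
  note s = genus_oneD(1)[OF \<Gamma>\<^sub>0(1)]
  note el = edge_list(1,2)[OF \<Gamma>\<^sub>0(1)]
  show "basis_cochain n d \<Gamma>\<^sub>0 c = 0" if "c \<notin> cells M 1 n d" for c
    using that by (cases c) (auto simp: basis_cochain_def)
  show "(\<lambda>x. basis_cochain n d \<Gamma>\<^sub>0 (\<Gamma>, es, x)) \<in> dual_labels M \<Gamma>" for \<Gamma> es
  proof (cases "\<Gamma> \<in> genus_one n \<and> distinct es \<and> set es = edges \<Gamma> \<and> length es = d \<and> isomorphic \<Gamma>\<^sub>0 \<Gamma>")
    case True
    then have "(\<lambda>x. basis_cochain n d \<Gamma>\<^sub>0 (\<Gamma>, es, x)) = fscale (of_int (orientation \<Gamma>\<^sub>0 \<Gamma> es)) (dec_coord \<Gamma>)"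
      by (auto simp: basis_cochain_def cells_iffs fscale_def dec_coord_def fun_eq_iff)
    then show ?thesis
      using dual_labels_line[of \<Gamma> n] True by blast
  next
    case False
    then have zero: "(\<lambda>x. basis_cochain n d \<Gamma>\<^sub>0 (\<Gamma>, es, x)) = 0"
      by (auto simp: basis_cochain_def cells_iffs fun_eq_iff)
    show ?thesis
      unfolding zero dual_labels_def by (rule fun_vs.span_zero)
  qed
  show "basis_cochain n d \<Gamma>\<^sub>0 (\<Gamma>, permute_list \<pi> es, x) = of_int (sign \<pi>) * basis_cochain n d \<Gamma>\<^sub>0 (\<Gamma>, es, x)"
    if *: "(\<Gamma>, es, x) \<in> cells M 1 n d \<and> \<pi> permutes {..<d}" for \<Gamma> es x \<pi>
  proof (cases "isomorphic \<Gamma>\<^sub>0 \<Gamma>")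
    case True
    then obtain f where f: "isom f \<Gamma>\<^sub>0 \<Gamma>"
      by (auto simp: isomorphic_def)
    have es: "distinct es" "set es = edges \<Gamma>" "\<pi> permutes {..<length es}"
      using * by (auto simp: cells_iffs)
    have es': "distinct (permute_list \<pi> es)" "set (permute_list \<pi> es) = edges \<Gamma>"
      using es by simp_all
    have "orientation \<Gamma>\<^sub>0 \<Gamma> (permute_list \<pi> es) = orientation \<Gamma>\<^sub>0 \<Gamma> es * sign \<pi>"
      unfolding orientation_eq[OF \<Gamma>\<^sub>0 f es(1,2)] orientation_eq[OF \<Gamma>\<^sub>0 f es']
      by (rule order_sign_permute_right[OF isom_map_edges(1)[OF \<Gamma>\<^sub>0(1) el f] es(1) _ es(3)])
        (simp only: isom_map_edges(2)[OF \<Gamma>\<^sub>0(1) el f] es(2))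
    moreover have "(\<Gamma>, permute_list \<pi> es, x) \<in> cells M 1 n d"
      using * es' by (simp add: cells_iffs)
    ultimately show ?thesis
      using * by (simp add: basis_cochain_def)
  qed (simp add: basis_cochain_def)
  show "basis_cochain n d \<Gamma>\<^sub>0 (relabel_graph f \<Gamma>, map ((`) f) es, relabel_decoration M f \<Gamma> x)
      = basis_cochain n d \<Gamma>\<^sub>0 (\<Gamma>, es, x)"
    if *: "(\<Gamma>, es, x) \<in> cells M 1 n d \<and> inj_on f (flags \<Gamma>) \<and> (\<forall>l\<in>legs \<Gamma>. f l = l)" for \<Gamma> es x f
  proof -
    have c: "\<Gamma> \<in> genus_one n" "distinct es" "set es = edges \<Gamma>" "length es = d" "x \<in> decorations M \<Gamma>"
      and inj: "inj_on f (flags \<Gamma>)"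
      using * by (auto simp: cells_iffs)
    note s\<Gamma> = genus_oneD(1)[OF c(1)]
    have f: "isom f \<Gamma> (relabel_graph f \<Gamma>)"
      using * by (simp add: isom_def)
    then have iso: "isomorphic \<Gamma> (relabel_graph f \<Gamma>)"
      by (auto simp: isomorphic_def)
    have cell: "(relabel_graph f \<Gamma>, map ((`) f) es, relabel_decoration M f \<Gamma> x) \<in> cells M 1 n d"
      unfolding cells_iff using isomorphic_genus_one[OF c(1) iso] isom_map_edges[OF c(1-3) f] c(4)
        relabel_dec(1)[OF c(1) inj c(5)] by simp
    have iso_iff: "isomorphic \<Gamma>\<^sub>0 (relabel_graph f \<Gamma>) \<longleftrightarrow> isomorphic \<Gamma>\<^sub>0 \<Gamma>"
      using isomorphic_trans[OF s] iso isomorphic_sym[OF s\<Gamma> iso] by blast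
    have "orientation \<Gamma>\<^sub>0 (relabel_graph f \<Gamma>) (map ((`) f) es) = orientation \<Gamma>\<^sub>0 \<Gamma> es" if "isomorphic \<Gamma>\<^sub>0 \<Gamma>"
    proof -
      obtain g where g: "isom g \<Gamma>\<^sub>0 \<Gamma>"
        using \<open>isomorphic \<Gamma>\<^sub>0 \<Gamma>\<close> by (auto simp: isomorphic_def)
      have m: "map ((`) (f \<circ> g)) (edge_list \<Gamma>\<^sub>0) = map ((`) f) (map ((`) g) (edge_list \<Gamma>\<^sub>0))"
        by (simp add: image_comp)
      have "orientation \<Gamma>\<^sub>0 (relabel_graph f \<Gamma>) (map ((`) f) es)
          = order_sign (map ((`) f) (map ((`) g) (edge_list \<Gamma>\<^sub>0))) (map ((`) f) es)"
        unfolding m[symmetric]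
        by (rule orientation_eq[OF \<Gamma>\<^sub>0 isom_compose[OF s g f] isom_map_edges[OF c(1-3) f]])
      also have "\<dots> = order_sign (map ((`) g) (edge_list \<Gamma>\<^sub>0)) es"
        by (rule order_sign_map)
          (simp_all only: isom_map_edges[OF \<Gamma>\<^sub>0(1) el g] c(2,3) inj_on_image_edges[OF s\<Gamma> inj])
      finally show ?thesis
        unfolding orientation_eq[OF \<Gamma>\<^sub>0 g c(2,3)] .
    qed
    then show ?thesis
      using cell * iso_iff relabel_dec(2)[OF c(1) inj c(5)] by (simp add: basis_cochain_def)
  qed
qed

text \<open>The coordinates are the values at the representatives, each with its reference edge
  ordering and unit decoration. Isomorphism invariance and the alternating property carry these
  values to the whole class, while odd classes contribute nothing.\<close>

lemma dim_feynman_cochains: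
  "fun_vs.dim (feynman_cochains M 1 n d) = card {\<Gamma> \<in> reps n. card (edges \<Gamma>) = d}"
proof (rule dim_dual_basis[where B = "basis_cochain n d" and ev = "\<lambda>\<Gamma>. (\<Gamma>, edge_list \<Gamma>, unit_dec \<Gamma>)"])
  let ?R = "{\<Gamma> \<in> reps n. card (edges \<Gamma>) = d}"
  show fin: "finite ?R"
    using finite_even_reps by simp
  show "basis_cochain n d \<Gamma> \<in> feynman_cochains M 1 n d" if "\<Gamma> \<in> ?R" for \<Gamma>
    using that repsD by (intro basis_cochain_mem) auto
  have iso_iff: "isomorphic \<Gamma> \<Delta> \<longleftrightarrow> \<Gamma> = \<Delta>" if "\<Gamma> \<in> ?R" "\<Delta> \<in> ?R" for \<Gamma> \<Delta>
  proof
    have s: "stable_graph \<Gamma>"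
      using that(1) repsD(1) genus_oneD(1) by blast
    show "\<Gamma> = \<Delta>" if "isomorphic \<Gamma> \<Delta>"
      using rep_eq[OF s that] repsD(2) \<open>\<Gamma> \<in> ?R\<close> \<open>\<Delta> \<in> ?R\<close> by (metis mem_Collect_eq)
    show "isomorphic \<Gamma> \<Delta>" if "\<Gamma> = \<Delta>"
      using isomorphic_refl[OF s] that by simp
  qed
  show "basis_cochain n d \<Gamma> (\<Delta>, edge_list \<Delta>, unit_dec \<Delta>) = (if \<Gamma> = \<Delta> then 1 else 0)"
    if *: "\<Gamma> \<in> ?R" "\<Delta> \<in> ?R" for \<Gamma> \<Delta>
  proof (cases "\<Gamma> = \<Delta>")
    case True
    have \<Gamma>: "\<Gamma> \<in> genus_one n" "\<not> odd_graph \<Gamma>" "card (edges \<Gamma>) = d"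
      using *(1) repsD by auto
    have "orientation \<Gamma> \<Gamma> (edge_list \<Gamma>) = 1"
      using orientation_eq[OF \<Gamma>(1,2) isom_refl[OF genus_oneD(1)[OF \<Gamma>(1)]] edge_list(1,2)[OF \<Gamma>(1)]]
        order_sign_refl[OF edge_list(1)[OF \<Gamma>(1)]] by simp
    then show ?thesis
      using True \<Gamma> edge_list[OF \<Gamma>(1)] unit_dec_mem[OF \<Gamma>(1)] dec_coord_unit[OF \<Gamma>(1)]
        iso_iff[OF *(1,1)] by (simp add: basis_cochain_def cells_iffs)
  qed (use iso_iff[OF *] in \<open>simp add: basis_cochain_def\<close>)
  show "\<Psi> = (\<Sum>\<Gamma>\<in>?R. fscale (\<Psi> (\<Gamma>, edge_list \<Gamma>, unit_dec \<Gamma>)) (basis_cochain n d \<Gamma>))"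
    if \<Psi>: "\<Psi> \<in> feynman_cochains M 1 n d" for \<Psi>
  proof
    fix c :: "('k, 'b) cell"
    obtain \<Gamma> es x where c: "c = (\<Gamma>, es, x)"
      by (cases c)
    let ?rhs = "\<Sum>\<Delta>\<in>?R. \<Psi> (\<Delta>, edge_list \<Delta>, unit_dec \<Delta>) * basis_cochain n d \<Delta> (\<Gamma>, es, x)"
    have "\<Psi> (\<Gamma>, es, x) = ?rhs"
    proof (cases "(\<Gamma>, es, x) \<in> cells M 1 n d")
      case False
      moreover have "\<Psi> (\<Gamma>, es, x) = 0"
        by (rule cochain_outside[OF \<Psi> False])
      ultimately show ?thesis
        by (simp add: basis_cochain_def)
    next
      case cell: True
      then have \<Gamma>: "\<Gamma> \<in> genus_one n" "distinct es" "set es = edges \<Gamma>" "length es = d"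
        by (auto simp: cells_iffs)
      note s = genus_oneD(1)[OF \<Gamma>(1)]
      have card: "card (edges \<Gamma>) = d"
        using \<Gamma>(2-4) distinct_card by metis
      show ?thesis
      proof (cases "odd_graph \<Gamma>")
        case True
        \<comment> \<open>Oddness is invariant under isomorphism, so no basis cochain lives on this
          class; \<open>\<Psi>\<close> vanishes there as well.\<close>
        have "basis_cochain n d \<Delta> (\<Gamma>, es, x) = 0" if "\<Delta> \<in> ?R" for \<Delta>
        proof -
          have \<Delta>: "\<Delta> \<in> genus_one n" "\<not> odd_graph \<Delta>"
            using that repsD by auto
          have "\<not> isomorphic \<Delta> \<Gamma>"
            using odd_graph_isomorphic[OF s isomorphic_sym[OF genus_oneD(1)[OF \<Delta>(1)]] True] \<Delta>(2) by blast
          then show ?thesis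
            by (simp add: basis_cochain_def)
        qed
        then have "?rhs = 0"
          by (intro sum.neutral) simp
        then show ?thesis
          using cochain_factor[OF \<Psi> \<Gamma>(1), of es x] cochain_odd_graph[OF \<Psi> \<Gamma>(1) True \<Gamma>(2-4)] by simp
      next
        case False
        let ?\<Theta> = "rep \<Gamma>"
        have iso: "isomorphic \<Gamma> ?\<Theta>"
          by (rule isomorphic_rep[OF s])
        have \<Theta>: "?\<Theta> \<in> ?R"
          using rep_mem_reps[OF \<Gamma>(1) False] isomorphic_card_edges[OF s iso] card by simp
        then have g: "?\<Theta> \<in> genus_one n" "\<not> odd_graph ?\<Theta>"
          using repsD by auto
        then have \<Theta>': "?\<Theta> \<in> genus_one n" "\<not> odd_graph ?\<Theta>" "length (edge_list ?\<Theta>) = d"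
          using edge_list(3)[OF g(1)] \<Theta> by auto
        obtain f where f: "isom f ?\<Theta> \<Gamma>"
          using isomorphic_sym[OF s iso] by (auto simp: isomorphic_def)
        have zero: "basis_cochain n d \<Delta> (\<Gamma>, es, x) = 0" if "\<Delta> \<in> ?R - {?\<Theta>}" for \<Delta>
        proof -
          have "stable_graph \<Delta>"
            using that repsD(1) genus_oneD(1) by blast
          then have "\<not> isomorphic \<Delta> \<Gamma>"
            using isomorphic_trans[of \<Delta> \<Gamma> ?\<Theta>] iso iso_iff[of \<Delta> ?\<Theta>] \<Theta> that by auto
          then show ?thesis
            by (simp add: basis_cochain_def)
        qed
        have "?rhs = \<Psi> (?\<Theta>, edge_list ?\<Theta>, unit_dec ?\<Theta>) * basis_cochain n d ?\<Theta> (\<Gamma>, es, x)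
            + (\<Sum>\<Delta>\<in>?R - {?\<Theta>}. \<Psi> (\<Delta>, edge_list \<Delta>, unit_dec \<Delta>) * basis_cochain n d \<Delta> (\<Gamma>, es, x))"
          by (rule sum.remove[OF fin \<Theta>])
        also have "(\<Sum>\<Delta>\<in>?R - {?\<Theta>}. \<Psi> (\<Delta>, edge_list \<Delta>, unit_dec \<Delta>) * basis_cochain n d \<Delta> (\<Gamma>, es, x)) = 0"
          using zero by (intro sum.neutral) simp
        finally have rhs: "?rhs = \<Psi> (?\<Theta>, edge_list ?\<Theta>, unit_dec ?\<Theta>) *
            (of_int (orientation ?\<Theta> \<Gamma> es) * dec_coord \<Gamma> x)"
          using cell isomorphic_sym[OF s iso] by (simp add: basis_cochain_def)
        let ?es = "map ((`) f) (edge_list ?\<Theta>)"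
        note el = edge_list(1,2)[OF \<Theta>'(1)]
        \<comment> \<open>The given ordering is first replaced by the transported reference
          ordering, at the cost of the orientation sign; the value is then moved along
          \<open>f\<close> to the representative.\<close>
        have "\<Psi> (\<Gamma>, es, unit_dec \<Gamma>) = of_int (order_sign ?es es) * \<Psi> (\<Gamma>, ?es, unit_dec \<Gamma>)"
          using \<Theta>'(3) by (intro cochain_order_sign[OF \<Psi> \<Gamma>(1) isom_map_edges[OF \<Theta>'(1) el f] _ \<Gamma>(2,3)]) simp
        also have "order_sign ?es es = orientation ?\<Theta> \<Gamma> es"
          by (rule orientation_eq[OF \<Theta>'(1,2) f \<Gamma>(2,3), symmetric])
        also have "\<Psi> (\<Gamma>, ?es, unit_dec \<Gamma>) = \<Psi> (?\<Theta>, edge_list ?\<Theta>, unit_dec ?\<Theta>)"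
          by (rule cochain_isom[OF \<Psi> \<Theta>'(1) el \<Theta>'(3) f])
        finally show ?thesis
          unfolding rhs using cochain_factor[OF \<Psi> \<Gamma>(1), of es x] by simp
      qed
    qed
    then show "\<Psi> c = (\<Sum>\<Gamma>\<in>?R. fscale (\<Psi> (\<Gamma>, edge_list \<Gamma>, unit_dec \<Gamma>)) (basis_cochain n d \<Gamma>)) c"
      unfolding fun_sum_apply c by (simp add: fscale_def)
  qed
qed

lemma euler_char_feynman: "euler_char (feynman_transform M 1 n) = (\<Sum>\<Gamma>\<in>reps n. weight \<Gamma>)"
proof -
  let ?R = "\<lambda>d. {\<Gamma> \<in> reps n. card (edges \<Gamma>) = d}"
  have "(\<Sum>\<Gamma>\<in>reps n. weight \<Gamma>) = (\<Sum>d\<in>(\<lambda>\<Gamma>. card (edges \<Gamma>)) ` reps n. \<Sum>\<Gamma>\<in>?R d. weight \<Gamma>)"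
    using finite_even_reps by (intro sum.group[symmetric]) auto
  also have "\<dots> = (\<Sum>d\<in>(\<lambda>\<Gamma>. card (edges \<Gamma>)) ` reps n. (- 1) ^ d * int (card (?R d)))"
    by (rule sum.cong) (simp_all add: weight_def)
  also have "(\<lambda>\<Gamma>. card (edges \<Gamma>)) ` reps n = {d. card (?R d) \<noteq> 0}"
    using finite_even_reps by auto
  finally show ?thesis
    by (simp add: euler_char_def feynman_transform_def dim_feynman_cochains dim_feynman_cochains[unfolded One_nat_def])
qed

end

theorem corollary1p5:
  fixes M :: "('k::field_char_0, 'b) operad_data"
    and \<eta> :: "vertex \<Rightarrow> (unit \<Rightarrow> 'k) \<Rightarrow> ('b \<Rightarrow> 'k)"
    and n :: nat
  assumes "modular_envelope com_operad M \<eta>"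
    and "n \<ge> 3"
  shows "real_of_int (euler_char (feynman_transform M 1 n)) = (- 1) ^ n * fact (n - 1) / 2"
proof -
  interpret com_envelope M \<eta>
    by (rule com_envelope.intro[OF assms(1)])
  obtain \<kappa> where
    "\<And>v c. stable_vertex v \<Longrightarrow> fst v \<le> 1 \<Longrightarrow> \<kappa> v (fscale c (generator v)) = c"
    "\<And>v f a. stable_vertex v \<Longrightarrow> fst v \<le> 1 \<Longrightarrow> inj_on f (snd v) \<Longrightarrow> a \<in> op_space M v
       \<Longrightarrow> \<kappa> (relabel_vertex f v) (op_act M v f a) = \<kappa> v a"
    using coordinate by metis
  then have "rank_one_operad M generator \<kappa>"
    by (intro rank_one_operad.intro space_generator M.act_space) simp_all
  then have "2 * euler_char (feynman_transform M 1 n) = (- 1) ^ n * fact (n - 1)"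
    using signed_count[OF assms(2)] rank_one_operad.euler_char_feynman by metis
  then have "real_of_int (2 * euler_char (feynman_transform M 1 n)) = real_of_int ((- 1) ^ n * fact (n - 1))"
    by (simp only:)
  then show ?thesis
    by simp
qed

end
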